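(* Let $E$ be a complex Banach space and let $C\in L(E)$ be injective. Suppose that $\mathcal{G}$ is a $C$-distribution semigroup in $E$ with generator $A$, and that $\mathcal{G}$ is $\tilde{E}$-weakly almost periodic for some linear subspace $\tilde{E}$ of $Z(A)$. If $\tilde{E}$ is dense in $E$ and $E$ is weakly sequentially complete, then the set $D$ of all eigenvectors of $A$ corresponding to purely imaginary eigenvalues (i.e. eigenvalues in $i\mathbb{R}$, zero included) is total in $E$ (its linear span is dense in $E$), and $\mathcal{G}$ is $\mathrm{span}(D)$-almost periodic.
   Context: **Test functions and distributions.** $E$ is a complex Banach space, $E^*$ its dual, $L(E)$ the bounded linear operators on $E$, $C\in L(E)$ is injective. $\mathcal{D}=C_0^\infty(\mathbb{R})$ with its usual inductive limit topology; $\mathcal{D}_0$ is the set of $\varphi\in\mathcal{D}$ with $\mathrm{supp}(\varphi)\subseteq[0,\infty)$. $\mathcal{D}'_0(L(E))$ is the space of continuous linear maps $\mathcal{D}\to L(E)$ with support in $[0,\infty)$. For $\varphi,\psi\in\mathcal{D}$, $(\varphi*_0\psi)(t):=\int_0^t\varphi(t-s)\psi(s)\,ds$, $t\in\mathbb{R}$. **$C$-distribution semigroups.** $\mathcal{G}\in\mathcal{D}_0'(L(E))$ with $C\mathcal{G}(\varphi)=\mathcal{G}(\varphi)C$ for all $\varphi\in\mathcal{D}$ is a $C$-distribution semigroup iff (a) $\mathcal{G}(\varphi*_0\psi)C=\mathcal{G}(\varphi)\mathcal{G}(\psi)$ for all $\varphi,\psi\in\mathcal{D}$, and (b) $\bigcap_{\varphi\in\mathcal{D}_0}N(\mathcal{G}(\varphi))=\{0\}$.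 For a scalar distribution $T$ with compact support contained in $[0,\infty)$, $G(T)$ is the closed linear operator with graph $$G(T):=\{(x,y)\in E\times E:\ \mathcal{G}(T*\varphi)x=\mathcal{G}(\varphi)y\ \text{ for all }\varphi\in\mathcal{D}_0\}.$$ In particular $G(\delta_t)$, $t\ge0$, is defined using $\delta_t*\varphi=\varphi(\cdot-t)$. The generator of $\mathcal{G}$ is $A:=G(-\delta')$, i.e. $(x,y)\in A$ iff $\mathcal{G}(-\varphi')x=\mathcal{G}(\varphi)y$ for all $\varphi\in\mathcal{D}_0$. **Solution space $Z(A)$.** $Z(A)$ is the set of $x\in E$ for which there is $u(\cdot,x)\in C([0,\infty):E)$ with $\int_0^tu(s,x)\,ds\in D(A)$ and $A\int_0^tu(s,x)\,ds=u(t,x)-x$ for all $t\ge0$. For the generator $A$ of $\mathcal{G}$, it is known that $Z(A)$ is the set of all $x\in\bigcap_{t\ge0}D(G(\delta_t))$ for which $t\mapsto G(\delta_t)x$, $t\ge 0$, is continuous, and $u(t,x)=G(\delta_t)x$ for $x\in Z(A)$. **Almost periodicity.** For a Banach space $X$, a continuous function $f:[0,\infty)\to X$ is almost periodic iff for each $\epsilon>0$ there is $l>0$ such that every subinterval of $[0,\infty)$ of length $l$ contains some $\tau$ with $\|f(t+\tau)-f(t)\|\le\epsilon$ for all $t\ge0$. A function $f:[0,\infty)\to E$ is weakly almost periodic iff $x^*(f(\cdot))$ is almost periodic for each $x^*\in E^*$. For a linear subspace $\tilde E$ of $Z(A)$, $\mathcal{G}$ is $\tilde E$-(weakly) almost periodic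 iff for each $x\in\tilde E$ the mapping $t\mapsto G(\delta_t)x$, $t\ge0$, is (weakly) almost periodic. (The assertion that $\mathcal{G}$ is $\mathrm{span}(D)$-almost periodic includes $\mathrm{span}(D)\subseteq Z(A)$.) *)

theory Defs
  imports "HOL-Analysis.Analysis"
begin

section \<open>Complex Banach spaces\<close>

text \<open>The libraries only provide real normed spaces; a complex one is a real one with a compatible
  multiplication by complex scalars.\<close>

class complex_normed_vector = real_normed_vector +
  fixes scaleC :: "complex \<Rightarrow> 'a \<Rightarrow> 'a" (infixr \<open>*\<^sub>C\<close> 75)
  assumes scaleC_add_right: "c *\<^sub>C (x + y) = c *\<^sub>C x + c *\<^sub>C y"
    and scaleC_add_left: "(c + d) *\<^sub>C x = c *\<^sub>C x + d *\<^sub>C x"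
    and scaleC_scaleC: "c *\<^sub>C d *\<^sub>C x = (c * d) *\<^sub>C x"
    and scaleC_of_real: "complex_of_real r *\<^sub>C x = r *\<^sub>R x"
    and norm_scaleC: "norm (c *\<^sub>C x) = cmod c * norm x"

class complex_banach = complex_normed_vector + complete_space

subclass (in complex_banach) banach ..

instantiation complex :: complex_banach
begin

definition scaleC_complex :: "complex \<Rightarrow> complex \<Rightarrow> complex"
  where "scaleC_complex c z = c * z"

instance
  by standard
    (simp_all add: scaleC_complex_def algebra_simps norm_mult scaleR_conv_of_real)

end

interpretation complex_vector: vector_space "scaleC :: complex \<Rightarrow> 'a \<Rightarrow> 'a::complex_normed_vector"
proof
  show "1 *\<^sub>C x = x" for x :: 'a
    using scaleC_of_real[of 1 x] by simp
qed (simp_all add: scaleC_add_right scaleC_add_left scaleC_scaleC)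

abbreviation csubspace :: "'a::complex_normed_vector set \<Rightarrow> bool"
  where "csubspace \<equiv> complex_vector.subspace"

abbreviation cspan :: "'a::complex_normed_vector set \<Rightarrow> 'a set"
  where "cspan \<equiv> complex_vector.span"

definition bounded_clinear :: "('a::complex_normed_vector \<Rightarrow> 'b::complex_normed_vector) \<Rightarrow> bool"
  where "bounded_clinear f \<longleftrightarrow> bounded_linear f \<and> (\<forall>c x. f (c *\<^sub>C x) = c *\<^sub>C f x)"

text \<open>\<open>L(E)\<close>, inside the real-linear operators, from which it takes the operator norm.\<close>

definition clinear_ops :: "('a::complex_normed_vector \<Rightarrow>\<^sub>L 'a) set"
  where "clinear_ops = {T. bounded_clinear (blinfun_apply T)}"

definition cdual :: "('a::complex_normed_vector \<Rightarrow> complex) set"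
  where "cdual = {f. bounded_clinear f}"

definition weakly_sequentially_complete :: "'a::complex_normed_vector itself \<Rightarrow> bool"
  where "weakly_sequentially_complete _ \<longleftrightarrow>
    (\<forall>X :: nat \<Rightarrow> 'a. (\<forall>f\<in>cdual. Cauchy (\<lambda>n. f (X n))) \<longrightarrow>
      (\<exists>x. \<forall>f\<in>cdual. (\<lambda>n. f (X n)) \<longlonglongrightarrow> f x))"

section \<open>Test functions\<close>

definition vderiv :: "(real \<Rightarrow> complex) \<Rightarrow> real \<Rightarrow> complex"
  where "vderiv \<phi> = (\<lambda>t. vector_derivative \<phi> (at t))"

definition smooth :: "(real \<Rightarrow> complex) \<Rightarrow> bool"
  where "smooth \<phi> \<longleftrightarrow> (\<forall>n t. (vderiv ^^ n) \<phi> differentiable (at t))"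

definition supp :: "(real \<Rightarrow> complex) \<Rightarrow> real set"
  where "supp \<phi> = closure {t. \<phi> t \<noteq> 0}"

definition test_fun :: "(real \<Rightarrow> complex) set"
  where "test_fun = {\<phi>. smooth \<phi> \<and> compact (supp \<phi>)}"

definition test_fun0 :: "(real \<Rightarrow> complex) set"
  where "test_fun0 = {\<phi> \<in> test_fun. supp \<phi> \<subseteq> {0..}}"

definition test_fun_on :: "real set \<Rightarrow> (real \<Rightarrow> complex) set"
  where "test_fun_on K = {\<phi> \<in> test_fun. supp \<phi> \<subseteq> K}"

text \<open>\<open>V\<close> meets \<open>test_fun_on K\<close> in a neighbourhood of \<open>0\<close> for the Frechet topology given by the
  seminorms \<open>\<phi> \<mapsto> sup \<bar>\<phi>\<^sup>(\<^sup>j\<^sup>)\<bar>\<close>.\<close>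

definition zero_nbhd_on :: "real set \<Rightarrow> (real \<Rightarrow> complex) set \<Rightarrow> bool"
  where "zero_nbhd_on K V \<longleftrightarrow>
    (\<exists>m::nat. \<exists>\<epsilon>>0. \<forall>\<phi>\<in>test_fun_on K. (\<forall>j\<le>m. \<forall>t. cmod ((vderiv ^^ j) \<phi> t) \<le> \<epsilon>) \<longrightarrow> \<phi> \<in> V)"

text \<open>The absolutely convex sets that are neighbourhoods of \<open>0\<close> in every \<open>test_fun_on K\<close>: the usual
  base of neighbourhoods of \<open>0\<close> of the locally convex inductive limit.\<close>

definition zero_base :: "(real \<Rightarrow> complex) set set"
  where "zero_base = {V. V \<subseteq> test_fun \<and>
    (\<forall>\<phi>\<in>V. \<forall>\<psi>\<in>V. \<forall>a b. cmod a + cmod b \<le> 1 \<longrightarrow> (\<lambda>t. a * \<phi> t + b * \<psi> t) \<in> V) \<and>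
    (\<forall>K. compact K \<longrightarrow> zero_nbhd_on K V)}"

definition test_topology :: "(real \<Rightarrow> complex) topology"
  where "test_topology = topology (\<lambda>U. U \<subseteq> test_fun \<and>
    (\<forall>\<phi>\<in>U. \<exists>V\<in>zero_base. \<forall>\<psi>\<in>V. (\<lambda>t. \<phi> t + \<psi> t) \<in> U))"

lemma zero_base_Int:
  assumes "V \<in> zero_base" "W \<in> zero_base"
  shows "V \<inter> W \<in> zero_base"
proof -
  have "zero_nbhd_on K (V \<inter> W)" if "compact K" for K
  proof -
    obtain m d where m: "d > 0" "\<forall>\<phi>\<in>test_fun_on K. (\<forall>j\<le>m. \<forall>t. cmod ((vderiv ^^ j) \<phi> t) \<le> d) \<longrightarrow> \<phi> \<in> V"
      using assms(1) \<open>compact K\<close> unfolding zero_base_def zero_nbhd_on_def by blast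
    obtain n e where n: "e > 0" "\<forall>\<phi>\<in>test_fun_on K. (\<forall>j\<le>n. \<forall>t. cmod ((vderiv ^^ j) \<phi> t) \<le> e) \<longrightarrow> \<phi> \<in> W"
      using assms(2) \<open>compact K\<close> unfolding zero_base_def zero_nbhd_on_def by blast
    show ?thesis
      unfolding zero_nbhd_on_def
      by (rule exI[of _ "max m n"], rule exI[of _ "min d e"]) (use m n in auto)
  qed
  then show ?thesis
    using assms by (auto simp: zero_base_def)
qed

lemma openin_test_topology:
  "openin test_topology U \<longleftrightarrow> U \<subseteq> test_fun \<and>
    (\<forall>\<phi>\<in>U. \<exists>V\<in>zero_base. \<forall>\<psi>\<in>V. (\<lambda>t. \<phi> t + \<psi> t) \<in> U)"
proof -
  let ?P = "\<lambda>U. U \<subseteq> test_fun \<and> (\<forall>\<phi>\<in>U. \<exists>V\<in>zero_base. \<forall>\<psi>\<in>V. (\<lambda>t. \<phi> t + \<psi> t) \<in> U)"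
  have "istopology ?P"
    unfolding istopology_def
  proof (intro conjI allI impI)
    fix S T assume S: "?P S" and T: "?P T"
    show "S \<inter> T \<subseteq> test_fun" using S by blast
    show "\<forall>\<phi>\<in>S \<inter> T. \<exists>V\<in>zero_base. \<forall>\<psi>\<in>V. (\<lambda>t. \<phi> t + \<psi> t) \<in> S \<inter> T"
    proof
      fix \<phi> assume "\<phi> \<in> S \<inter> T"
      obtain V where V: "V \<in> zero_base" "\<forall>\<psi>\<in>V. (\<lambda>t. \<phi> t + \<psi> t) \<in> S"
        using S \<open>\<phi> \<in> S \<inter> T\<close> by blast
      obtain W where W: "W \<in> zero_base" "\<forall>\<psi>\<in>W. (\<lambda>t. \<phi> t + \<psi> t) \<in> T"
        using T \<open>\<phi> \<in> S \<inter> T\<close> by blast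
      show "\<exists>V\<in>zero_base. \<forall>\<psi>\<in>V. (\<lambda>t. \<phi> t + \<psi> t) \<in> S \<inter> T"
        using V(2) W(2) by (intro bexI[OF _ zero_base_Int[OF V(1) W(1)]]) blast
    qed
  next
    fix \<K> assume \<K>: "\<forall>K\<in>\<K>. ?P K"
    then show "\<Union>\<K> \<subseteq> test_fun" by blast
    show "\<forall>\<phi>\<in>\<Union>\<K>. \<exists>V\<in>zero_base. \<forall>\<psi>\<in>V. (\<lambda>t. \<phi> t + \<psi> t) \<in> \<Union>\<K>"
    proof
      fix \<phi> assume "\<phi> \<in> \<Union>\<K>"
      then obtain U where U: "U \<in> \<K>" "\<phi> \<in> U" by blast
      obtain V where V: "V \<in> zero_base" "\<forall>\<psi>\<in>V. (\<lambda>t. \<phi> t + \<psi> t) \<in> U"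
        using bspec[OF \<K> U(1)] U(2) by blast
      show "\<exists>V\<in>zero_base. \<forall>\<psi>\<in>V. (\<lambda>t. \<phi> t + \<psi> t) \<in> \<Union>\<K>"
        using V(2) U(1) by (intro bexI[OF _ V(1)]) blast
    qed
  qed
  then show ?thesis
    unfolding test_topology_def by (subst topology_inverse') (assumption, rule refl)
qed

lemma vderiv_funpow_lincomb:
  assumes "smooth \<phi>" "smooth \<psi>"
  shows "(vderiv ^^ n) (\<lambda>t. a * \<phi> t + b * \<psi> t) = (\<lambda>t. a * (vderiv ^^ n) \<phi> t + b * (vderiv ^^ n) \<psi> t)"
proof (induction n)
  case (Suc n)
  have d: "((vderiv ^^ n) \<phi> has_vector_derivative vderiv ((vderiv ^^ n) \<phi>) t) (at t)"
    "((vderiv ^^ n) \<psi> has_vector_derivative vderiv ((vderiv ^^ n) \<psi>) t) (at t)" for t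
    using assms by (simp_all add: smooth_def vderiv_def vector_derivative_works[symmetric])
  have "((\<lambda>t. a * (vderiv ^^ n) \<phi> t + b * (vderiv ^^ n) \<psi> t) has_vector_derivative
      a * vderiv ((vderiv ^^ n) \<phi>) t + b * vderiv ((vderiv ^^ n) \<psi>) t) (at t)" for t
    by (intro has_vector_derivative_add has_vector_derivative_mult_right d)
  then have "vderiv (\<lambda>t. a * (vderiv ^^ n) \<phi> t + b * (vderiv ^^ n) \<psi> t) =
      (\<lambda>t. a * vderiv ((vderiv ^^ n) \<phi>) t + b * vderiv ((vderiv ^^ n) \<psi>) t)"
    unfolding vderiv_def[of "\<lambda>t. a * (vderiv ^^ n) \<phi> t + b * (vderiv ^^ n) \<psi> t"]
    by (intro ext vector_derivative_at)
  then show ?case by (simp add: Suc.IH)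
qed simp

lemma test_fun_lincomb:
  assumes "\<phi> \<in> test_fun" "\<psi> \<in> test_fun"
  shows "(\<lambda>t. a * \<phi> t + b * \<psi> t) \<in> test_fun"
proof -
  have s: "smooth \<phi>" "smooth \<psi>" and c: "compact (supp \<phi> \<union> supp \<psi>)"
    using assms by (auto simp: test_fun_def)
  have "smooth (\<lambda>t. a * \<phi> t + b * \<psi> t)"
    unfolding smooth_def vderiv_funpow_lincomb[OF s]
    using s by (auto simp: smooth_def intro!: differentiable_add differentiable_mult)
  moreover have "compact (supp (\<lambda>t. a * \<phi> t + b * \<psi> t))"
  proof -
    have "supp (\<lambda>t. a * \<phi> t + b * \<psi> t) \<subseteq> supp \<phi> \<union> supp \<psi>"
      unfolding supp_def closure_Un[symmetric] by (rule closure_mono) auto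
    then have "supp (\<lambda>t. a * \<phi> t + b * \<psi> t) =
        (supp \<phi> \<union> supp \<psi>) \<inter> supp (\<lambda>t. a * \<phi> t + b * \<psi> t)"
      by blast
    then show ?thesis
      using compact_Int_closed[OF c, of "supp (\<lambda>t. a * \<phi> t + b * \<psi> t)"]
      by (simp add: supp_def)
  qed
  ultimately show ?thesis
    by (simp add: test_fun_def)
qed

lemma topspace_test_topology [simp]: "topspace test_topology = test_fun"
proof -
  have "zero_nbhd_on K test_fun" for K
    unfolding zero_nbhd_on_def test_fun_on_def by (intro exI[of _ 0] exI[of _ 1]) auto
  then have "test_fun \<in> zero_base"
    by (auto simp: zero_base_def test_fun_lincomb)
  moreover have "(\<lambda>t. \<phi> t + \<psi> t) \<in> test_fun" if "\<phi> \<in> test_fun" "\<psi> \<in> test_fun" for \<phi> \<psi>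
    using test_fun_lincomb[OF that, of 1 1] by simp
  ultimately have "openin test_topology test_fun"
    unfolding openin_test_topology by blast
  moreover have "topspace test_topology \<subseteq> test_fun"
    using openin_topspace[of test_topology] unfolding openin_test_topology by (rule conjunct1)
  ultimately show ?thesis
    using openin_subset by blast
qed

section \<open>Operator-valued distributions and \<open>C\<close>-distribution semigroups\<close>

text \<open>A distribution is a function of which only the values on \<open>test_fun\<close> are relevant.\<close>

definition dist_support :: "((real \<Rightarrow> complex) \<Rightarrow> 'a::zero) \<Rightarrow> real set"
  where "dist_support G = - \<Union>{U. open U \<and> (\<forall>\<phi>\<in>test_fun. supp \<phi> \<subseteq> U \<longrightarrow> G \<phi> = 0)}"

definition op_distribution0 :: "((real \<Rightarrow> complex) \<Rightarrow> ('a::complex_banach \<Rightarrow>\<^sub>L 'a)) \<Rightarrow> bool"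
  where "op_distribution0 G \<longleftrightarrow>
    G ` test_fun \<subseteq> clinear_ops \<and>
    (\<forall>\<phi>\<in>test_fun. \<forall>\<psi>\<in>test_fun. \<forall>a b x.
      G (\<lambda>t. a * \<phi> t + b * \<psi> t) x = a *\<^sub>C G \<phi> x + b *\<^sub>C G \<psi> x) \<and>
    continuous_map test_topology euclidean G \<and>
    dist_support G \<subseteq> {0..}"

text \<open>For \<open>t < 0\<close> the interval integral is the oriented one.\<close>

definition conv0 :: "(real \<Rightarrow> complex) \<Rightarrow> (real \<Rightarrow> complex) \<Rightarrow> real \<Rightarrow> complex"
  where "conv0 \<phi> \<psi> = (\<lambda>t. LBINT s=0..t. \<phi> (t - s) * \<psi> s)"

definition C_distribution_semigroup ::
    "('a::complex_banach \<Rightarrow>\<^sub>L 'a) \<Rightarrow> ((real \<Rightarrow> complex) \<Rightarrow> ('a \<Rightarrow>\<^sub>L 'a)) \<Rightarrow> bool"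
  where "C_distribution_semigroup C G \<longleftrightarrow>
    op_distribution0 G \<and>
    (\<forall>\<phi>\<in>test_fun. C o\<^sub>L G \<phi> = G \<phi> o\<^sub>L C) \<and>
    (\<forall>\<phi>\<in>test_fun. \<forall>\<psi>\<in>test_fun. G (conv0 \<phi> \<psi>) o\<^sub>L C = G \<phi> o\<^sub>L G \<psi>) \<and>
    (\<Inter>\<phi>\<in>test_fun0. {x. G \<phi> x = 0}) = {0}"

definition delta :: "real \<Rightarrow> (real \<Rightarrow> complex) \<Rightarrow> complex"
  where "delta t \<phi> = \<phi> t"

definition dist_deriv :: "((real \<Rightarrow> complex) \<Rightarrow> complex) \<Rightarrow> (real \<Rightarrow> complex) \<Rightarrow> complex"
  where "dist_deriv T \<phi> = - T (vderiv \<phi>)"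

definition dist_conv :: "((real \<Rightarrow> complex) \<Rightarrow> complex) \<Rightarrow> (real \<Rightarrow> complex) \<Rightarrow> real \<Rightarrow> complex"
  where "dist_conv T \<phi> = (\<lambda>t. T (\<lambda>s. \<phi> (t - s)))"

lemma dist_conv_delta: "dist_conv (delta t) \<phi> = (\<lambda>s. \<phi> (s - t))"
  by (simp add: dist_conv_def delta_def)

lemma dist_conv_minus_delta_deriv:
  assumes "smooth \<phi>"
  shows "dist_conv (\<lambda>\<psi>. - dist_deriv (delta 0) \<psi>) \<phi> = (\<lambda>t. - vderiv \<phi> t)"
proof
  fix t :: real
  have d: "(\<phi> has_vector_derivative vderiv \<phi> t) (at t)"
    using assms[unfolded smooth_def, rule_format, of 0 t]
    by (simp add: vderiv_def vector_derivative_works[symmetric])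
  have "((\<phi> \<circ> (\<lambda>s. t - s)) has_vector_derivative (- 1) *\<^sub>R vderiv \<phi> t) (at 0)"
    by (rule vector_diff_chain_at) (use d in \<open>auto intro!: derivative_eq_intros\<close>)
  then show "dist_conv (\<lambda>\<psi>. - dist_deriv (delta 0) \<psi>) \<phi> t = - vderiv \<phi> t"
    by (simp add: dist_conv_def dist_deriv_def delta_def vderiv_def[of "\<lambda>s. \<phi> (t - s)"]
        o_def vector_derivative_at)
qed

text \<open>Linear operators in \<open>E\<close> are represented by their graphs.\<close>

definition dist_op :: "((real \<Rightarrow> complex) \<Rightarrow> ('a::complex_banach \<Rightarrow>\<^sub>L 'a)) \<Rightarrow>
    ((real \<Rightarrow> complex) \<Rightarrow> complex) \<Rightarrow> ('a \<times> 'a) set"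
  where "dist_op G T = {(x, y). \<forall>\<phi>\<in>test_fun0. G (dist_conv T \<phi>) x = G \<phi> y}"

definition generator :: "((real \<Rightarrow> complex) \<Rightarrow> ('a::complex_banach \<Rightarrow>\<^sub>L 'a)) \<Rightarrow> ('a \<times> 'a) set"
  where "generator G = dist_op G (\<lambda>\<phi>. - dist_deriv (delta 0) \<phi>)"

definition op_app :: "('a \<times> 'a) set \<Rightarrow> 'a \<Rightarrow> 'a"
  where "op_app A x = (THE y. (x, y) \<in> A)"

definition solution_space :: "('a::complex_banach \<times> 'a) set \<Rightarrow> 'a set"
  where "solution_space A = {x. \<exists>u :: real \<Rightarrow> 'a. continuous_on {0..} u \<and>
    (\<forall>t\<ge>0. (integral {0..t} u, u t - x) \<in> A)}"

definition imaginary_eigenvectors :: "('a::complex_banach \<times> 'a) set \<Rightarrow> 'a set"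
  where "imaginary_eigenvectors A = {x. x \<noteq> 0 \<and> (\<exists>r::real. (x, (\<i> * r) *\<^sub>C x) \<in> A)}"

section \<open>Almost periodicity\<close>

definition almost_periodic :: "(real \<Rightarrow> 'a::complex_banach) \<Rightarrow> bool"
  where "almost_periodic f \<longleftrightarrow> continuous_on {0..} f \<and>
    (\<forall>\<epsilon>>0. \<exists>l>0. \<forall>a\<ge>0. \<exists>\<tau>\<in>{a..a + l}. \<forall>t\<ge>0. norm (f (t + \<tau>) - f t) \<le> \<epsilon>)"

definition weakly_almost_periodic :: "(real \<Rightarrow> 'a::complex_banach) \<Rightarrow> bool"
  where "weakly_almost_periodic f \<longleftrightarrow> (\<forall>g\<in>cdual. almost_periodic (\<lambda>t. g (f t)))"

text \<open>In the next two definitions \<open>S\<close> is meant to be a subspace of \<open>solution_space (generator G)\<close>;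
  then each \<open>x \<in> S\<close> lies in the domain of every \<open>dist_op G (delta t)\<close> with \<open>t \<ge> 0\<close>.\<close>

definition almost_periodic_on ::
    "'a set \<Rightarrow> ((real \<Rightarrow> complex) \<Rightarrow> ('a::complex_banach \<Rightarrow>\<^sub>L 'a)) \<Rightarrow> bool"
  where "almost_periodic_on S G \<longleftrightarrow>
    (\<forall>x\<in>S. almost_periodic (\<lambda>t. op_app (dist_op G (delta t)) x))"

definition weakly_almost_periodic_on ::
    "'a set \<Rightarrow> ((real \<Rightarrow> complex) \<Rightarrow> ('a::complex_banach \<Rightarrow>\<^sub>L 'a)) \<Rightarrow> bool"
  where "weakly_almost_periodic_on S G \<longleftrightarrow>
    (\<forall>x\<in>S. weakly_almost_periodic (\<lambda>t. op_app (dist_op G (delta t)) x))"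

end

(* For x in E' let u be the mild solution starting at x. Weak almost periodicity makes the means
   (1/n) \<integral>\<^sub>0\<^sup>n exp(-irs) u(s) ds weakly Cauchy, and by weak sequential completeness they converge weakly
   to some p; since (1/n) exp(-irn) u(n) is weakly null, (p, ir p) lies in A. If the eigenvectors were
   not total, Hahn-Banach would give a functional f \<noteq> 0 vanishing on all of them, so that every
   Bohr-Fourier coefficient of the almost periodic function f(u(.)) would be zero. Then f(u(.)) = 0, in
   particular f(x) = 0 for all x in the dense set E', a contradiction.

   That an almost periodic function g without nonzero Bohr-Fourier coefficients is zero is shown by finite Fourier
   analysis of the samples a(j) = g(j/M), j < K. The exponential sums of a are o(K) uniformly in the
   frequency, so by Parseval the correlations of a have small energy; but the almost periods of g
   supply a proportion of shifts, bounded below independently of M, at which the correlation is at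
   least a fixed multiple of K unless g = 0. *)

theory Submission
  imports Defs
begin

section \<open>The Hahn-Banach theorem\<close>

text \<open>Finite sums stand in for the classical convolution argument, in which the correlation of
  an almost periodic function has the squared moduli of its Bohr-Fourier coefficients as
  coefficients. The obstacle is uniformity: Parseval for samples of mesh \<open>1 / M\<close>
  involves all frequencies up to \<open>pi * M\<close>, whereas the hypothesis speaks of each
  frequency separately. Frequencies up to a bound \<open>R\<close> are made uniform by compactness;
  beyond \<open>R\<close> the sum is compared with its own shift by less than the modulus of
  continuity. The bound \<open>R\<close> depends on the tolerance and not on \<open>M\<close>. On
  the half-line there are no negative translates, so points are moved by almost periods lying just
  before them, and identities that hold only from some point on are carried back by an almost period
  beyond that point. Orbits need not be given by bounded operators. Statements about
  \<open>generator G\<close> are tested through the operators \<open>G \<phi>\<close> with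
  \<open>\<phi>\<close> in \<open>test_fun0\<close>, where a shift of the orbit becomes a
  translation of \<open>\<phi>\<close>, which is differentiable in operator norm; these operators
  separate points and let weak limits pass.\<close>

definition sublinear :: "('a::real_vector \<Rightarrow> real) \<Rightarrow> bool"
  where "sublinear p \<longleftrightarrow> (\<forall>x y. p (x + y) \<le> p x + p y) \<and> (\<forall>t x. 0 \<le> t \<longrightarrow> p (t *\<^sub>R x) = t * p x)"

lemma sublinear_add: "sublinear p \<Longrightarrow> p (x + y) \<le> p x + p y"
  and sublinear_scale: "sublinear p \<Longrightarrow> 0 \<le> t \<Longrightarrow> p (t *\<^sub>R x) = t * p x"
  by (auto simp: sublinear_def)

lemma sublinear_zero: "sublinear p \<Longrightarrow> p 0 = 0"
  using sublinear_scale[of p 0 0] by simp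

lemma sublinear_minus: "sublinear p \<Longrightarrow> - p (- x) \<le> p x"
  using sublinear_add[of p x "- x"] sublinear_zero[of p] by simp

text \<open>Lowers \<open>p\<close> as far as sublinearity permits so that it becomes linear along \<open>y\<close>.\<close>

definition sublinear_shift :: "('a::real_vector \<Rightarrow> real) \<Rightarrow> 'a \<Rightarrow> 'a \<Rightarrow> real"
  where "sublinear_shift p y x = (INF t\<in>{0..}. p (x + t *\<^sub>R y) - t * p y)"

lemma sublinear_shift_bdd:
  assumes "sublinear p"
  shows "bdd_below ((\<lambda>t. p (x + t *\<^sub>R y) - t * p y) ` {0..})"
proof (rule bdd_belowI2)
  fix t :: real assume "t \<in> {0..}"
  then have "t * p y = p (t *\<^sub>R y)" using sublinear_scale[OF assms] by simp
  also have "\<dots> \<le> p (x + t *\<^sub>R y) + p (- x)"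
    using sublinear_add[OF assms, of "x + t *\<^sub>R y" "- x"] by simp
  finally show "- p (- x) \<le> p (x + t *\<^sub>R y) - t * p y" by simp
qed

lemma sublinear_shift_le:
  assumes "sublinear p" "0 \<le> t"
  shows "sublinear_shift p y x \<le> p (x + t *\<^sub>R y) - t * p y"
  unfolding sublinear_shift_def
  by (rule cINF_lower[OF sublinear_shift_bdd[OF assms(1)]]) (use assms in auto)

lemma sublinear_shift_greatest:
  assumes "\<And>t. 0 \<le> t \<Longrightarrow> c \<le> p (x + t *\<^sub>R y) - t * p y"
  shows "c \<le> sublinear_shift p y x"
  unfolding sublinear_shift_def by (rule cINF_greatest) (use assms in auto)

lemma sublinear_shift:
  assumes p: "sublinear p"
  shows "sublinear (sublinear_shift p y)"
proof -
  let ?q = "sublinear_shift p y"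
  have add: "?q (x + z) \<le> ?q x + ?q z" for x z
  proof -
    have 1: "?q (x + z) - (p (z + s *\<^sub>R y) - s * p y) \<le> p (x + t *\<^sub>R y) - t * p y"
      if "0 \<le> t" "0 \<le> s" for s t
    proof -
      have "?q (x + z) \<le> p ((x + z) + (t + s) *\<^sub>R y) - (t + s) * p y"
        by (rule sublinear_shift_le) (use p that in auto)
      also have "(x + z) + (t + s) *\<^sub>R y = (x + t *\<^sub>R y) + (z + s *\<^sub>R y)"
        by (simp add: algebra_simps)
      also have "p \<dots> \<le> p (x + t *\<^sub>R y) + p (z + s *\<^sub>R y)" by (rule sublinear_add[OF p])
      finally show ?thesis by (simp add: algebra_simps)
    qed
    have 2: "?q (x + z) - (p (z + s *\<^sub>R y) - s * p y) \<le> ?q x" if "0 \<le> s" for s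
      by (rule sublinear_shift_greatest) (use 1 that in auto)
    have "?q (x + z) - ?q x \<le> ?q z"
      by (rule sublinear_shift_greatest) (use 2 in \<open>auto simp: algebra_simps\<close>)
    then show ?thesis by simp
  qed
  have le: "t * ?q x \<le> ?q (t *\<^sub>R x)" if "0 < t" for t x
  proof (rule sublinear_shift_greatest)
    fix s :: real assume "0 \<le> s"
    then have "?q x \<le> p (x + (s / t) *\<^sub>R y) - (s / t) * p y"
      by (intro sublinear_shift_le) (use p that in auto)
    then have "t * ?q x \<le> t * p (x + (s / t) *\<^sub>R y) - s * p y"
      using that by (simp add: field_simps)
    also have "t * p (x + (s / t) *\<^sub>R y) = p (t *\<^sub>R x + s *\<^sub>R y)"
      using sublinear_scale[OF p, of t "x + (s / t) *\<^sub>R y"] that by (simp add: scaleR_add_right)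
    finally show "t * ?q x \<le> p (t *\<^sub>R x + s *\<^sub>R y) - s * p y" .
  qed
  have scale: "?q (t *\<^sub>R x) = t * ?q x" if "0 < t" for t x
  proof (rule antisym)
    show "?q (t *\<^sub>R x) \<le> t * ?q x"
      using le[of "1 / t" "t *\<^sub>R x"] that by (simp add: field_simps)
  qed (rule le[OF that])
  have "?q 0 = 0"
  proof (rule antisym)
    show "?q 0 \<le> 0"
      using sublinear_shift_le[OF p, of 0 y 0] sublinear_zero[OF p] by simp
    show "0 \<le> ?q 0"
      by (rule sublinear_shift_greatest) (simp add: sublinear_scale[OF p])
  qed
  then have "?q (t *\<^sub>R x) = t * ?q x" if "0 \<le> t" for t x
    using scale[of t x] that by (cases "t = 0") auto
  then show ?thesis
    using add by (auto simp: sublinear_def)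
qed

text \<open>Along a chain the pointwise infimum is again sublinear: it is finite because each member
  satisfies \<open>- p (- x) \<le> q x\<close>, and subadditivity uses the smaller of two members.
  Zorn's lemma is applied to the reversed order.\<close>

lemma minimal_sublinear_exists:
  assumes p: "sublinear p"
  obtains g where "sublinear g" "\<And>x. g x \<le> p x"
    "\<And>q. sublinear q \<Longrightarrow> (\<forall>x. q x \<le> g x) \<Longrightarrow> q = g"
proof -
  let ?A = "{q. sublinear q \<and> q \<le> p}"
  have "\<exists>m\<in>?A. \<forall>a\<in>?A. a \<le> m \<longrightarrow> a = m"
  proof (rule predicate_Zorn[where P = "\<lambda>a b. b \<le> a"])
    show "partial_order_on ?A (relation_of (\<lambda>a b. b \<le> a) ?A)"
      by (rule partial_order_on_relation_ofI) auto
    fix \<C> assume ch: "\<C> \<in> Chains (relation_of (\<lambda>a b. b \<le> a) ?A)"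
    have sub: "\<C> \<subseteq> ?A" and cmp: "\<And>a b. a \<in> \<C> \<Longrightarrow> b \<in> \<C> \<Longrightarrow> a \<le> b \<or> b \<le> a"
      using ch by (auto simp: Chains_def relation_of_def)
    show "\<exists>u\<in>?A. \<forall>a\<in>\<C>. u \<le> a"
    proof (cases "\<C> = {}")
      case True
      then show ?thesis using p by auto
    next
      case False
      define u where "u x = (INF q\<in>\<C>. q x)" for x
      have bdd: "bdd_below ((\<lambda>q. q x) ` \<C>)" for x
      proof (rule bdd_belowI2)
        fix q assume "q \<in> \<C>"
        then have "sublinear q" "q (- x) \<le> p (- x)" using sub by (auto simp: le_fun_def)
        then show "- p (- x) \<le> q x" using sublinear_minus[of q x] by linarith
      qed
      have le: "u x \<le> q x" if "q \<in> \<C>" for q x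
        unfolding u_def by (rule cINF_lower[OF bdd that])
      have ge: "c \<le> u x" if "\<And>q. q \<in> \<C> \<Longrightarrow> c \<le> q x" for c x
        unfolding u_def by (rule cINF_greatest) (use False that in auto)
      have "u (x + y) \<le> u x + u y" for x y
      proof -
        have 1: "u (x + y) - r y \<le> q x" if "q \<in> \<C>" "r \<in> \<C>" for q r
        proof -
          obtain s where s: "s \<in> \<C>" "s \<le> q" "s \<le> r" using cmp[OF \<open>q \<in> \<C>\<close> \<open>r \<in> \<C>\<close>] \<open>q \<in> \<C>\<close> \<open>r \<in> \<C>\<close> by blast
          have "u (x + y) \<le> s (x + y)" by (rule le[OF s(1)])
          also have "\<dots> \<le> s x + s y" using s(1) sub by (auto intro: sublinear_add)
          also have "\<dots> \<le> q x + r y" using s by (auto simp: le_fun_def intro: add_mono)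
          finally show ?thesis by simp
        qed
        have "u (x + y) - r y \<le> u x" if "r \<in> \<C>" for r
          by (rule ge) (use 1 that in auto)
        then have "u (x + y) - u x \<le> u y"
          by (intro ge) (auto simp: algebra_simps)
        then show ?thesis by simp
      qed
      moreover have "u (t *\<^sub>R x) = t * u x" if "0 \<le> t" for t x
      proof -
        have "u (t *\<^sub>R x) = (INF q\<in>\<C>. t * q x)"
          unfolding u_def using sub that by (intro INF_cong) (auto intro: sublinear_scale)
        also have "\<dots> = t * u x"
        proof (cases "t = 0")
          case True then show ?thesis using False by simp
        next
          case False
          then have t: "0 < t" using that by simp
          have bt: "bdd_below ((\<lambda>q. t * q x) ` \<C>)"
          proof -
            obtain m where "\<And>q. q \<in> \<C> \<Longrightarrow> m \<le> q x" using bdd[of x] by (auto simp: bdd_below_def)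
            then show ?thesis using t by (intro bdd_belowI2[of _ "t * m"]) auto
          qed
          show ?thesis
          proof (rule antisym)
            have "(INF q\<in>\<C>. t * q x) / t \<le> u x"
              by (rule ge) (use t cINF_lower[OF bt] in \<open>auto simp: field_simps\<close>)
            then show "(INF q\<in>\<C>. t * q x) \<le> t * u x" using t by (simp add: field_simps)
            show "t * u x \<le> (INF q\<in>\<C>. t * q x)"
              by (rule cINF_greatest) (use \<open>\<C> \<noteq> {}\<close> t le in auto)
          qed
        qed
        finally show ?thesis .
      qed
      ultimately have "sublinear u" by (auto simp: sublinear_def)
      moreover have "u \<le> p"
        using False sub le unfolding le_fun_def by (blast intro: order_trans)
      ultimately show ?thesis using le by (auto simp: le_fun_def)
    qed
  qed
  then obtain g where g: "sublinear g" "g \<le> p" "\<forall>a\<in>?A. a \<le> g \<longrightarrow> a = g" by auto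
  show ?thesis
  proof
    fix q assume "sublinear q" "\<forall>x. q x \<le> g x"
    moreover from this have "q \<le> p" using g(2) by (auto simp: le_fun_def intro: order_trans)
    ultimately show "q = g" using g(3) by (auto simp: le_fun_def)
  qed (use g in \<open>auto simp: le_fun_def\<close>)
qed

text \<open>A minimal sublinear \<open>g\<close> equals each of its shifts
  \<open>sublinear_shift g y\<close>, and \<open>t = 1\<close> in the shift gives
  \<open>g x + g y \<le> g (x + y)\<close>. Minimality is taken below
  \<open>sublinear_shift p z\<close> instead of \<open>p\<close>, which forces
  \<open>g (- z) \<le> - p z\<close> and hence equality at \<open>z\<close>.\<close>

lemma Hahn_Banach_sublinear:
  assumes p: "sublinear p"
  obtains g where "linear g" "\<And>x. g x \<le> p x" "g z = p z"
proof -
  obtain g where g: "sublinear g" "\<And>x. g x \<le> sublinear_shift p z x"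
    and min: "\<And>q. sublinear q \<Longrightarrow> (\<forall>x. q x \<le> g x) \<Longrightarrow> q = g"
    using minimal_sublinear_exists[OF sublinear_shift[OF p]] by blast
  have gp: "g x \<le> p x" for x
    using g(2)[of x] sublinear_shift_le[OF p, of 0 z x] by simp
  have fix_shift: "sublinear_shift g y = g" for y
    by (rule min[OF sublinear_shift[OF g(1)]])
      (use sublinear_shift_le[OF g(1), of 0] in simp)
  have add: "g (x + y) = g x + g y" for x y
    using sublinear_add[OF g(1), of x y] sublinear_shift_le[OF g(1), of 1 y x] fix_shift[of y]
    by simp
  have minus: "g (- x) = - g x" for x
    using add[of x "- x"] sublinear_zero[OF g(1)] by simp
  have "g (t *\<^sub>R x) = t * g x" for t x
  proof (cases "0 \<le> t")
    case False
    then have "g ((- t) *\<^sub>R x) = (- t) * g x" by (intro sublinear_scale[OF g(1)]) simp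
    then show ?thesis using minus[of "t *\<^sub>R x"] by simp
  qed (rule sublinear_scale[OF g(1)])
  then have "linear g" by (intro linearI) (auto simp: add)
  moreover have "g z = p z"
    using g(2)[of "- z"] sublinear_shift_le[OF p, of 1 z "- z"] minus[of z] gp[of z]
      sublinear_zero[OF p] by simp
  ultimately show ?thesis using that gp by blast
qed

section \<open>Separation of points and closed complex subspaces by functionals\<close>

lemma infdist_subspace_sublinear:
  fixes S :: "'a::real_normed_vector set"
  assumes "subspace S"
  shows "sublinear (\<lambda>x. infdist x S)"
proof -
  have ne: "S \<noteq> {}" using assms subspace_0 by blast
  have "infdist (x + y) S \<le> infdist x S + infdist y S" for x y
  proof (rule field_le_epsilon)
    fix e :: real assume "0 < e"
    have "\<exists>a\<in>S. dist w a < infdist w S + e / 2" for w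
      using cINF_less_iff[of S "dist w" "infdist w S + e / 2"] ne \<open>0 < e\<close>
      by (auto simp: infdist_notempty intro: bdd_belowI2[of _ 0])
    then obtain a b where ab: "a \<in> S" "b \<in> S"
      "dist x a < infdist x S + e / 2" "dist y b < infdist y S + e / 2" by meson
    have "infdist (x + y) S \<le> dist (x + y) (a + b)"
      by (intro infdist_le subspace_add assms ab)
    also have "\<dots> \<le> dist x a + dist y b" by (rule dist_triangle_add)
    finally show "infdist (x + y) S \<le> infdist x S + infdist y S + e" using ab by linarith
  qed
  moreover have "infdist (t *\<^sub>R x) S = t * infdist x S" if "0 \<le> t" for t x
  proof -
    have le: "infdist (s *\<^sub>R w) S \<le> s * infdist w S" if "0 < s" for s w
    proof -
      have "infdist (s *\<^sub>R w) S / s \<le> dist w a" if "a \<in> S" for a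
      proof -
        have "infdist (s *\<^sub>R w) S \<le> dist (s *\<^sub>R w) (s *\<^sub>R a)"
          by (intro infdist_le subspace_scale assms that)
        also have "\<dots> = s * dist w a"
          using \<open>0 < s\<close> by (simp add: dist_norm flip: scaleR_diff_right)
        finally show ?thesis using \<open>0 < s\<close> by (simp add: field_simps)
      qed
      then have "infdist (s *\<^sub>R w) S / s \<le> infdist w S"
        unfolding infdist_notempty[OF ne, of w] by (intro cINF_greatest ne) auto
      then show ?thesis using that by (simp add: field_simps)
    qed
    show ?thesis
    proof (cases "t = 0")
      case True then show ?thesis using subspace_0[OF assms] by simp
    next
      case False
      then have "infdist ((1 / t) *\<^sub>R t *\<^sub>R x) S \<le> 1 / t * infdist (t *\<^sub>R x) S"
        using that by (intro le) simp
      then show ?thesis using le[of t x] that False by (simp add: field_simps)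
    qed
  qed
  ultimately show ?thesis by (auto simp: sublinear_def)
qed

lemma csubspace_imp_subspace:
  assumes "csubspace S" shows "subspace S"
proof (rule subspaceI)
  fix c x assume "x \<in> S"
  then show "c *\<^sub>R x \<in> S"
    using complex_vector.subspace_scale[OF assms, of x "complex_of_real c"] by (simp add: scaleC_of_real)
qed (use assms in \<open>auto intro: complex_vector.subspace_0 complex_vector.subspace_add\<close>)

text \<open>The distance to \<open>S\<close> is sublinear, zero on \<open>S\<close> and positive at
  \<open>z\<close>, so a real functional below it that attains its value at \<open>z\<close>
  vanishes on \<open>S\<close> but not at \<open>z\<close>.\<close>

lemma Hahn_Banach_separation:
  fixes S :: "'a::complex_normed_vector set"
  assumes S: "csubspace S" "closed S" and z: "z \<notin> S"
  obtains f where "f \<in> cdual" "\<And>x. x \<in> S \<Longrightarrow> f x = 0" "f z \<noteq> 0"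
proof -
  let ?p = "\<lambda>x. infdist x S"
  have sub: "subspace S" by (rule csubspace_imp_subspace[OF S(1)])
  obtain g where g: "linear g" "\<And>x. g x \<le> ?p x" "g z = ?p z"
    by (rule Hahn_Banach_sublinear[OF infdist_subspace_sublinear[OF sub]]) blast
  have pm: "?p (- x) \<le> norm x" for x
    using infdist_le[of 0 S "- x"] subspace_0[OF sub] by simp
  have gn: "\<bar>g x\<bar> \<le> norm x" for x
    using g(2)[of x] g(2)[of "- x"] pm[of x] pm[of "- x"] linear_neg[OF g(1), of x] by simp
  have gS: "g x = 0" if "x \<in> S" for x
    using g(2)[of x] g(2)[of "- x"] linear_neg[OF g(1), of x] that subspace_neg[OF sub that] by simp
  \<comment> \<open>The unique complex-linear functional with real part \<open>g\<close>.\<close>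
  define f where "f x = Complex (g x) (- g (\<i> *\<^sub>C x))" for x
  have gadd: "g (x + y) = g x + g y" and gsc: "g (t *\<^sub>R x) = t * g x" for x y t
    using g(1) by (auto simp: linear_add linear_cmul)
  have ii: "\<i> *\<^sub>C \<i> *\<^sub>C x = - x" for x :: 'a
    using complex_vector.scale_minus_left[of 1 x] by (simp add: scaleC_scaleC)
  have fadd: "f (x + y) = f x + f y" for x y
    by (simp add: f_def scaleC_add_right gadd complex_eq_iff)
  have fi: "f (\<i> *\<^sub>C x) = \<i> * f x" for x
    using linear_neg[OF g(1)] by (simp add: f_def ii complex_eq_iff)
  have fr: "f (complex_of_real t *\<^sub>C x) = complex_of_real t * f x" for t x
  proof -
    have "\<i> *\<^sub>C t *\<^sub>R x = t *\<^sub>R \<i> *\<^sub>C x"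
      by (simp flip: scaleC_of_real add: scaleC_scaleC mult.commute)
    then show ?thesis by (simp add: scaleC_of_real f_def gsc complex_eq_iff)
  qed
  have fc: "f (c *\<^sub>C x) = c * f x" for c x
  proof -
    have "c *\<^sub>C x = complex_of_real (Re c) *\<^sub>C x + \<i> *\<^sub>C complex_of_real (Im c) *\<^sub>C x"
      by (simp add: scaleC_scaleC flip: scaleC_add_left complex_eq)
    also have "f \<dots> = (complex_of_real (Re c) + \<i> * complex_of_real (Im c)) * f x"
      unfolding fadd fi fr by (simp add: algebra_simps)
    finally show ?thesis by (simp flip: complex_eq)
  qed
  have "bounded_linear f"
  proof (rule bounded_linear_intro[of _ 2])
    show "f (r *\<^sub>R x) = r *\<^sub>R f x" for r x
      using fr[of r x] by (simp add: scaleC_of_real scaleR_conv_of_real)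
    show "norm (f x) \<le> norm x * 2" for x
      using cmod_le[of "f x"] gn[of x] gn[of "\<i> *\<^sub>C x"] by (simp add: f_def norm_scaleC)
  qed (rule fadd)
  then have "f \<in> cdual" by (simp add: cdual_def bounded_clinear_def fc scaleC_complex_def)
  moreover have "f x = 0" if "x \<in> S" for x
    using gS[OF that] gS[OF complex_vector.subspace_scale[OF S(1) that, of \<i>]] by (simp add: f_def complex_eq_iff)
  moreover have "f z \<noteq> 0"
  proof -
    have "?p z > 0"
      using infdist_pos_not_in_closed[OF S(2) _ z] subspace_0[OF sub] by blast
    then show ?thesis using g(3) by (simp add: f_def complex_eq_iff)
  qed
  ultimately show ?thesis using that by blast
qed

lemma cdual_separates:
  fixes x y :: "'a::complex_normed_vector"
  assumes "\<And>f. f \<in> cdual \<Longrightarrow> f x = f y"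
  shows "x = y"
proof (rule ccontr)
  assume "x \<noteq> y"
  moreover have "csubspace {0::'a}" by (simp add: complex_vector.subspace_def)
  ultimately obtain f :: "'a \<Rightarrow> complex" where f: "f \<in> cdual" "f (x - y) \<noteq> 0"
    using Hahn_Banach_separation[of "{0}" "x - y"] by auto
  then show False
    using assms[of f] by (simp add: cdual_def bounded_clinear_def bounded_linear.linear linear_diff)
qed

section \<open>Means of functions with precompact orbit of translates\<close>

text \<open>Total boundedness of the set of translates in the supremum norm. This form is used
  because it passes to products by refining two finite partitions, which is how the factors
  \<open>cis (r * t)\<close> are handled.\<close>

definition precompact_translates :: "(real \<Rightarrow> complex) \<Rightarrow> bool"
  where "precompact_translates f \<longleftrightarrow>
    (\<forall>e>0. \<exists>P. finite P \<and> P \<subseteq> {0..} \<and> (\<forall>s\<ge>0. \<exists>p\<in>P. \<forall>t\<ge>0. norm (f (t + s) - f (t + p)) \<le> e))"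

lemma integrable_on_halfline:
  fixes g :: "real \<Rightarrow> 'b::banach"
  assumes "continuous_on {0..} g" "0 \<le> a"
  shows "g integrable_on {a..b}"
  by (rule integrable_continuous_real, rule continuous_on_subset[OF assms(1)]) (use assms(2) in auto)

lemma norm_integral_halfline_le:
  fixes g :: "real \<Rightarrow> 'b::banach" and B :: real
  assumes "continuous_on {0..} g" "0 \<le> a" "a \<le> b" "\<And>t. a \<le> t \<Longrightarrow> t \<le> b \<Longrightarrow> norm (g t) \<le> B"
  shows "norm (integral {a..b} g) \<le> B * (b - a)"
  by (rule integral_bound[OF assms(3) continuous_on_subset[OF assms(1)]]) (use assms in auto)

lemma integral_block_bound:
  fixes g :: "real \<Rightarrow> 'b::banach" and T n :: nat and B e :: real
  assumes g: "continuous_on {0..} g" "\<And>t. 0 \<le> t \<Longrightarrow> norm (g t) \<le> B" and T: "0 < T"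
    and win: "\<And>a::real. 0 \<le> a \<Longrightarrow> norm (integral {a..a + T} g) \<le> e * T"
  shows "norm (integral {0..n} g) \<le> e * n + T * B"
proof (induction n rule: less_induct)
  case (less n)
  have B: "0 \<le> B" using g(2)[of 0] norm_ge_zero[of "g 0"] by linarith
  have "0 \<le> e * T" using win[of 0] norm_ge_zero order_trans by blast
  then have e: "0 \<le> e" using T by (simp add: zero_le_mult_iff)
  show ?case
  proof (cases "n < T")
    case True
    have "norm (integral {0..n} g) \<le> B * (real n - 0)"
      by (rule norm_integral_halfline_le[OF g(1)]) (use g in auto)
    also have "\<dots> \<le> T * B" using True B by (simp add: mult.commute[of B] mult_right_mono)
    finally show ?thesis using e by (simp add: add_increasing)
  next
    case False
    have "integral {0..n} g = integral {0..real (n - T)} g + integral {real (n - T)..real (n - T) + T} g"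
      using False by (subst Henstock_Kurzweil_Integration.integral_combine)
        (auto intro: integrable_on_halfline[OF g(1)] simp: of_nat_diff)
    also have "norm \<dots> \<le> (e * real (n - T) + T * B) + e * T"
      using less[of "n - T"] win[of "real (n - T)"] False T by (intro norm_triangle_mono) auto
    also have "\<dots> = e * n + T * B" using False by (simp add: of_nat_diff algebra_simps)
    finally show ?thesis .
  qed
qed

lemma integral_window_shift:
  fixes g :: "real \<Rightarrow> 'b::banach"
  shows "integral {a..a + T} g = integral {0..T} (\<lambda>t. g (t + a))"
  using integral_shift_Icc_real[of 0 T g a] by (simp add: o_def add.commute)

text \<open>Every translate of \<open>g\<close> is within \<open>e / 2\<close> of one of finitely
  many, and moving the window by a bounded amount \<open>p\<close> changes the integral only by the
  two unmatched end pieces, at most \<open>2 * p * B\<close>, which is small against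
  \<open>e * T\<close> for long windows.\<close>

lemma windows_uniform:
  fixes g :: "real \<Rightarrow> complex" and B e :: real
  assumes g: "continuous_on {0..} g" "\<And>t. 0 \<le> t \<Longrightarrow> norm (g t) \<le> B"
    and pc: "precompact_translates g" and e: "0 < e"
  obtains T0 where "0 < T0"
    "\<And>a T :: real. 0 \<le> a \<Longrightarrow> T0 \<le> T \<Longrightarrow> norm (integral {a..a + T} g - integral {0..T} g) \<le> e * T"
proof -
  obtain P where P: "finite P" "P \<subseteq> {0..}"
    and close: "\<And>s. 0 \<le> s \<Longrightarrow> \<exists>p\<in>P. \<forall>t\<ge>0. norm (g (t + s) - g (t + p)) \<le> e / 2"
    using pc e unfolding precompact_translates_def by (meson half_gt_zero)
  define m where "m = Max (insert 0 P)"
  have m: "0 \<le> m" "\<And>p. p \<in> P \<Longrightarrow> p \<le> m" using P by (auto simp: m_def)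
  have B: "0 \<le> B" using g(2)[of 0] norm_ge_zero[of "g 0"] by linarith
  \<comment> \<open>As every \<open>p\<close> is at most \<open>m\<close>, this makes
    \<open>2 * p * B \<le> e / 2 * T\<close>; the \<open>1\<close> keeps \<open>T0\<close>
    positive.\<close>
  define T0 where "T0 = max 1 (4 * m * B / e)"
  have shift: "norm (integral {p..p + T} g - integral {0..T} g) \<le> 2 * p * B"
    if "0 \<le> p" "0 \<le> T" for p T
  proof -
    have "integral {0..p} g + integral {p..p + T} g = integral {0..p + T} g"
      "integral {0..T} g + integral {T..T + p} g = integral {0..T + p} g"
      using that
      by (auto intro!: Henstock_Kurzweil_Integration.integral_combine integrable_on_halfline[OF g(1)])
    then have "integral {p..p + T} g - integral {0..T} g = integral {T..T + p} g - integral {0..p} g"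
      by (simp add: algebra_simps)
    also have "norm \<dots> \<le> B * ((T + p) - T) + B * (p - 0)"
      using that g(2) by (intro order_trans[OF norm_triangle_ineq4] add_mono norm_integral_halfline_le[OF g(1)]) auto
    finally show ?thesis by (simp add: mult_ac)
  qed
  show ?thesis
  proof
    show "0 < T0" by (simp add: T0_def)
    fix a T :: real assume a: "0 \<le> a" and T: "T0 \<le> T"
    then have T': "0 < T" "4 * m * B \<le> e * T" using e by (auto simp: T0_def field_simps)
    obtain p where p: "p \<in> P" "\<forall>t\<ge>0. norm (g (t + a) - g (t + p)) \<le> e / 2" using close[OF a] by blast
    then have p0: "0 \<le> p" "p \<le> m" using P m by auto
    have c: "continuous_on {0..} (\<lambda>t. g (t + q))" if "0 \<le> q" for q
      by (rule continuous_on_compose2[OF g(1)]) (use that in \<open>auto intro!: continuous_intros\<close>)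
    have "integral {a..a + T} g - integral {p..p + T} g = integral {0..T} (\<lambda>t. g (t + a) - g (t + p))"
      unfolding integral_window_shift
      by (rule Henstock_Kurzweil_Integration.integral_diff[symmetric])
        (use a p0 in \<open>auto intro!: integrable_on_halfline c\<close>)
    also have "norm \<dots> \<le> e / 2 * (T - 0)"
      by (rule norm_integral_halfline_le) (use a p p0 T' in \<open>auto intro!: continuous_intros c\<close>)
    finally have 1: "norm (integral {a..a + T} g - integral {p..p + T} g) \<le> e / 2 * T" by simp
    have "2 * p * B \<le> 2 * m * B" using p0 B by (simp add: mult_right_mono)
    then have 2: "norm (integral {p..p + T} g - integral {0..T} g) \<le> e / 2 * T"
      using shift[of p T] p0 T' by linarith
    show "norm (integral {a..a + T} g - integral {0..T} g) \<le> e * T"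
      using norm_triangle_le[OF add_mono[OF 1 2]] by (simp add: algebra_simps)
  qed
qed

text \<open>All windows of one fixed length \<open>T\<close> have almost the same mean
  \<open>c\<close>, so a long integral, cut into such windows, has mean close to \<open>c\<close> up
  to an error of order \<open>1 / n\<close>.\<close>

lemma means_Cauchy:
  fixes g :: "real \<Rightarrow> complex" and B e :: real
  assumes g: "continuous_on {0..} g" "\<And>t. 0 \<le> t \<Longrightarrow> norm (g t) \<le> B"
    and pc: "precompact_translates g"
  shows "Cauchy (\<lambda>n. integral {0..real n} g / n)"
proof (rule CauchyI')
  fix e :: real assume e: "0 < e"
  then have e4: "0 < e / 8" by simp
  obtain T0 where T0: "0 < T0"
    "\<And>a T :: real. 0 \<le> a \<Longrightarrow> T0 \<le> T \<Longrightarrow> norm (integral {a..a + T} g - integral {0..T} g) \<le> e / 8 * T"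
    using windows_uniform[OF g pc e4] by metis
  define T where "T = nat \<lceil>T0\<rceil>"
  have T: "0 < T" "T0 \<le> T" using T0(1) by (auto simp: T_def of_nat_ceiling)
  define c where "c = integral {0..real T} g / T"
  have B: "0 \<le> B" using g(2)[of 0] norm_ge_zero[of "g 0"] by linarith
  have bd: "norm (integral {0..real n} g - c * n) \<le> e / 8 * n + T * (B + norm c)" for n :: nat
  proof -
    have "norm (integral {0..real n} (\<lambda>t. g t - c)) \<le> e / 8 * n + T * (B + norm c)"
    proof (rule integral_block_bound[OF _ _ T(1)])
      show "continuous_on {0..} (\<lambda>t. g t - c)" by (intro continuous_intros g)
      show "norm (g t - c) \<le> B + norm c" if "0 \<le> t" for t
        using norm_triangle_ineq4[of "g t" c] g(2)[OF that] by linarith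
      fix a :: real assume a: "0 \<le> a"
      have "integral {a..a + T} (\<lambda>t. g t - c) = integral {a..a + T} g - c * T"
        using a by (subst Henstock_Kurzweil_Integration.integral_diff)
          (auto intro: integrable_on_halfline[OF g(1)] simp: scaleR_conv_of_real)
      then show "norm (integral {a..a + T} (\<lambda>t. g t - c)) \<le> e / 8 * T"
        using T0(2)[OF a T(2)] T by (simp add: c_def)
    qed
    moreover have "integral {0..real n} (\<lambda>t. g t - c) = integral {0..real n} g - c * n"
      by (subst Henstock_Kurzweil_Integration.integral_diff)
          (auto intro: integrable_on_halfline[OF g(1)] simp: scaleR_conv_of_real)
    ultimately show ?thesis by simp
  qed
  \<comment> \<open>From \<open>N\<close> on the incomplete block costs at most \<open>e / 8\<close>
    of the mean; \<open>Suc\<close> keeps the divisor \<open>n\<close> positive.\<close>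
  define N where "N = Suc (nat \<lceil>8 * (T * (B + norm c)) / e\<rceil>)"
  have mean: "norm (integral {0..real n} g / n - c) \<le> e / 4" if "N \<le> n" for n
  proof -
    have n: "0 < real n" "8 * (T * (B + norm c)) / e \<le> n"
      using that by (auto simp: N_def) (metis Suc_leD ceiling_le_iff nat_ceiling_le_eq of_int_of_nat_eq of_nat_le_iff order_trans)
    then have "T * (B + norm c) \<le> e / 8 * n" using e by (simp add: field_simps)
    then have "norm (integral {0..real n} g - c * n) \<le> e / 4 * n" using bd[of n] by simp
    moreover have "integral {0..real n} g / n - c = (integral {0..real n} g - c * n) / n"
      using n by (simp add: field_simps)
    ultimately show ?thesis using n by (simp add: norm_divide field_simps)
  qed
  show "\<exists>N. \<forall>m\<ge>N. \<forall>n>m. dist (integral {0..real m} g / m) (integral {0..real n} g / n) < e"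
  proof (intro exI allI impI)
    fix m n assume "N \<le> m" "m < n"
    then have "norm ((integral {0..real m} g / m - c) - (integral {0..real n} g / n - c)) \<le> e / 4 + e / 4"
      by (intro order_trans[OF norm_triangle_ineq4] add_mono mean) auto
    then show "dist (integral {0..real m} g / m) (integral {0..real n} g / n) < e"
      using e by (simp add: dist_norm)
  qed
qed

text \<open>Uniformity over windows transfers the small mean of one initial window to every
  position.\<close>

lemma mean_zero_windows:
  fixes g :: "real \<Rightarrow> complex" and B e :: real
  assumes g: "continuous_on {0..} g" "\<And>t. 0 \<le> t \<Longrightarrow> norm (g t) \<le> B"
    and pc: "precompact_translates g" and e: "0 < e"
    and zero: "(\<lambda>n. integral {0..real n} g / n) \<longlonglongrightarrow> 0"
  obtains T :: nat where "0 < T" "\<And>a::real. 0 \<le> a \<Longrightarrow> norm (integral {a..a + T} g) \<le> e * T"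
proof -
  obtain T0 where T0: "0 < T0"
    "\<And>a T :: real. 0 \<le> a \<Longrightarrow> T0 \<le> T \<Longrightarrow> norm (integral {a..a + T} g - integral {0..T} g) \<le> e / 2 * T"
    using windows_uniform[OF g pc, of "e / 2"] e by (metis half_gt_zero)
  have "\<forall>\<^sub>F n in sequentially. norm (integral {0..real n} g / n) < e / 2"
    using tendstoD[OF zero, of "e / 2"] e by simp
  moreover have "\<forall>\<^sub>F n in sequentially. T0 \<le> real n"
    using filterlim_real_sequentially by (simp add: filterlim_at_top)
  ultimately have "\<forall>\<^sub>F n in sequentially. norm (integral {0..real n} g / n) < e / 2 \<and> T0 \<le> real n"
    by eventually_elim auto
  then obtain T where T: "norm (integral {0..real T} g / T) < e / 2" "T0 \<le> real T"
    by (auto simp: eventually_sequentially)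
  then have T': "0 < real T" using T0 by linarith
  show ?thesis
  proof
    show "0 < T" using T' by simp
    fix a :: real assume "0 \<le> a"
    have 1: "norm (integral {0..real T} g) \<le> e / 2 * T"
      using T T' by (simp add: norm_divide field_simps)
    show "norm (integral {a..a + T} g) \<le> e * T"
      using norm_triangle_le[OF add_mono[OF T0(2)[OF \<open>0 \<le> a\<close> T(2)] 1]] by (simp add: algebra_simps)
  qed
qed

lemma norm_cis_diff_le: "norm (cis x - cis y) \<le> \<bar>x - y\<bar>"
proof -
  have "norm (cis u - 1) \<le> \<bar>u\<bar>" for u
  proof -
    have "(norm (cis u - 1))\<^sup>2 = (cos u - 1)\<^sup>2 + (sin u)\<^sup>2" by (simp add: cmod_power2)
    also have "\<dots> = 2 - 2 * cos (2 * (u / 2))" using sin_cos_squared_add[of u] by (simp add: power2_eq_square algebra_simps)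
    also have "\<dots> = (2 * sin (u / 2))\<^sup>2" by (simp only: cos_double_sin) (simp add: power2_eq_square)
    also have "\<dots> \<le> \<bar>u\<bar>\<^sup>2"
      using abs_sin_x_le_abs_x[of "u / 2"] by (intro abs_le_square_iff[THEN iffD1]) auto
    finally show ?thesis by (rule power2_le_imp_le) simp
  qed
  moreover have "cis x - cis y = cis y * (cis (x - y) - 1)"
    by (simp add: algebra_simps cis_mult)
  ultimately show ?thesis by (simp add: norm_mult)
qed

text \<open>On a window of length \<open>T\<close> starting at \<open>a\<close>, the factor
  \<open>cis (- r * t)\<close> is the constant phase \<open>cis (- (r - r0) * a)\<close> times
  \<open>cis (- r0 * t)\<close>, up to an error of at most \<open>\<bar>r - r0\<bar> * T\<close>. So
  a window length good for \<open>r0\<close> serves all nearby \<open>r\<close>, and compactness of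
  \<open>{-R..R}\<close> leaves finitely many \<open>r0\<close>.\<close>

lemma means_uniform_frequency:
  fixes f :: "real \<Rightarrow> complex" and B e R :: real
  assumes f: "continuous_on {0..} f" "\<And>t. 0 \<le> t \<Longrightarrow> norm (f t) \<le> B"
    and pc: "\<And>r. precompact_translates (\<lambda>t. cis (- r * t) * f t)"
    and zero: "\<And>r. (\<lambda>n. integral {0..real n} (\<lambda>t. cis (- r * t) * f t) / n) \<longlonglongrightarrow> 0"
    and e: "0 < e"
  obtains N where "\<And>n r. N \<le> n \<Longrightarrow> \<bar>r\<bar> \<le> R \<Longrightarrow>
    norm (integral {0..real n} (\<lambda>t. cis (- r * t) * f t)) \<le> e * n"
proof -
  have B: "0 \<le> B" using f(2)[of 0] norm_ge_zero[of "f 0"] by linarith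
  have cont: "continuous_on {0..} (\<lambda>t. cis (- r * t) * f t)" for r
    by (intro continuous_intros f)
  have bound: "norm (cis (- r * t) * f t) \<le> B" if "0 \<le> t" for r t
    using f(2)[OF that] by (simp add: norm_mult)
  have loc: "\<exists>d>0. \<exists>N. \<forall>n\<ge>N. \<forall>r. \<bar>r - r0\<bar> < d \<longrightarrow>
    norm (integral {0..real n} (\<lambda>t. cis (- r * t) * f t)) \<le> e * n" for r0
  proof -
    obtain T :: nat where T: "0 < T"
      "\<And>a::real. 0 \<le> a \<Longrightarrow> norm (integral {a..a + T} (\<lambda>t. cis (- r0 * t) * f t)) \<le> e / 4 * T"
      using mean_zero_windows[OF cont bound pc _ zero, of "e / 4" r0] e by auto
    \<comment> \<open>The phase error over a window, times the bound of \<open>f\<close>, is then at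
      most \<open>e / 4\<close>; the \<open>+ 1\<close> avoids a division by zero when
      \<open>B = 0\<close>.\<close>
    define d where "d = e / (4 * T * (B + 1))"
    have d: "0 < d" using e T B by (simp add: d_def)
    have dB: "d * T * B \<le> e / 4"
      using B T e by (simp add: d_def divide_simps)
    define N where "N = nat \<lceil>2 * (T * B) / e\<rceil>"
    have "norm (integral {0..real n} (\<lambda>t. cis (- r * t) * f t)) \<le> e * n"
      if n: "N \<le> n" and r: "\<bar>r - r0\<bar> < d" for n r
    proof -
      have "norm (integral {0..real n} (\<lambda>t. cis (- r * t) * f t)) \<le> e / 2 * n + T * B"
      proof (rule integral_block_bound[OF cont bound T(1)])
        fix a :: real assume a: "0 \<le> a"
        let ?h = "\<lambda>t. cis (- r * t) * f t" and ?w = "\<lambda>t. cis (- (r - r0) * a) * (cis (- r0 * t) * f t)"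
        have c0: "continuous_on {0..} ?w" by (intro continuous_intros f)
        have "integral {a..a + T} ?h = integral {a..a + T} ?w + integral {a..a + T} (\<lambda>t. ?h t - ?w t)"
          using a by (subst Henstock_Kurzweil_Integration.integral_diff)
            (auto intro!: integrable_on_halfline continuous_intros f)
        moreover have "norm (integral {a..a + T} ?w) \<le> e / 4 * T"
          using T(2)[OF a] by (simp add: norm_mult)
        moreover have "norm (integral {a..a + T} (\<lambda>t. ?h t - ?w t)) \<le> e / 4 * ((a + T) - a)"
        proof (rule norm_integral_halfline_le)
          show "continuous_on {0..} (\<lambda>t. ?h t - ?w t)" by (intro continuous_intros f)
          fix t assume t: "a \<le> t" "t \<le> a + T"
          have h0: "?w t = cis (- (r - r0) * a - r0 * t) * f t"
            by (simp add: mult.assoc[symmetric] cis_mult)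
          have "?h t - ?w t = (cis (- r * t) - cis (- (r - r0) * a - r0 * t)) * f t"
            unfolding h0 left_diff_distrib[of _ _ "f t"] ..
          also have "norm \<dots> \<le> \<bar>- r * t - (- (r - r0) * a - r0 * t)\<bar> * B"
            unfolding norm_mult using t a f(2)[of t] by (intro mult_mono norm_cis_diff_le) auto
          also have "- r * t - (- (r - r0) * a - r0 * t) = - ((r - r0) * (t - a))"
            by (simp add: algebra_simps)
          also have "\<bar>\<dots>\<bar> * B \<le> (d * T) * B"
            unfolding abs_minus_cancel abs_mult using t r B by (intro mult_mono) auto
          finally show "norm (?h t - ?w t) \<le> e / 4" using dB by simp
        qed (use a in auto)
        ultimately have "norm (integral {a..a + T} ?h) \<le> e / 4 * T + e / 4 * T"
          by (simp only: add_diff_cancel_left') (erule norm_triangle_mono)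
        then show "norm (integral {a..a + T} ?h) \<le> e / 2 * T" by simp
      qed
      moreover have "T * B \<le> e / 2 * n"
      proof -
        have "2 * (T * B) / e \<le> n" using n by (simp add: N_def nat_ceiling_le_eq)
        then show ?thesis using e by (simp add: field_simps)
      qed
      ultimately show ?thesis by simp
    qed
    then show ?thesis using d by blast
  qed
  then obtain d N where dN: "\<And>r0. 0 < d r0"
    "\<And>r0 n r. N r0 \<le> n \<Longrightarrow> \<bar>r - r0\<bar> < d r0 \<Longrightarrow>
      norm (integral {0..real n} (\<lambda>t. cis (- r * t) * f t)) \<le> e * n"
    by metis
  have "{-R..R} \<subseteq> (\<Union>r0\<in>{-R..R}. ball r0 (d r0))" using dN(1) by force
  then obtain D where D: "finite D" "{-R..R} \<subseteq> (\<Union>r0\<in>D. ball r0 (d r0))"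
    by (rule compactE_image[OF compact_Icc open_ball])
  show ?thesis
  proof
    fix n r assume n: "Max (insert 0 (N ` D)) \<le> n" and "\<bar>r\<bar> \<le> R"
    then have "r \<in> {-R..R}" by (simp add: abs_le_iff)
    then obtain r0 where r0: "r0 \<in> D" "\<bar>r - r0\<bar> < d r0"
      using D(2) by (force simp: dist_real_def abs_minus_commute)
    moreover have "N r0 \<le> n" using n r0 D by simp
    ultimately show "norm (integral {0..real n} (\<lambda>t. cis (- r * t) * f t)) \<le> e * n"
      using dN(2) by blast
  qed
qed

section \<open>Correlations of finite sequences\<close>

lemma sum_roots_of_unity:
  fixes i j M :: nat
  assumes "i < M" "j < M"
  shows "(\<Sum>k<M. cis (2 * pi * real k / M) ^ i * cnj (cis (2 * pi * real k / M) ^ j)) = (if i = j then of_nat M else 0)"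
proof -
  define z where "z = cis (2 * pi * (real i - real j) / M)"
  have M: "0 < real M" using assms by simp
  have "cis (2 * pi * real k / M) ^ i * cnj (cis (2 * pi * real k / M) ^ j) = z ^ k" for k
  proof -
    have "cis (2 * pi * real k / M) ^ i * cnj (cis (2 * pi * real k / M) ^ j) =
        cis (i * (2 * pi * real k / M) - j * (2 * pi * real k / M))"
      unfolding Complex.DeMoivre cis_cnj cis_mult by simp
    also have "i * (2 * pi * real k / M) - j * (2 * pi * real k / M) = k * (2 * pi * (real i - real j) / M)"
      using M by (simp add: field_simps)
    also have "cis \<dots> = z ^ k" by (simp only: Complex.DeMoivre z_def)
    finally show ?thesis .
  qed
  then have eq: "(\<Sum>k<M. cis (2 * pi * real k / M) ^ i * cnj (cis (2 * pi * real k / M) ^ j)) = (\<Sum>k<M. z ^ k)"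
    by simp
  show ?thesis
  proof (cases "i = j")
    case True
    then show ?thesis unfolding eq by (simp add: z_def)
  next
    case False
    have "z \<noteq> 1"
    proof
      assume "z = 1"
      then have "cos (2 * pi * (real i - real j) / M) = 1" by (simp add: z_def complex_eq_iff)
      then obtain n :: int where "2 * pi * (real i - real j) / M = real_of_int n * 2 * pi"
        using cos_one_2pi_int by blast
      then have "(2 * pi) * (real i - real j) = (2 * pi) * (n * real M)" using M by (simp add: field_simps)
      then have "real i - real j = n * real M" by (subst (asm) mult_left_cancel) auto
      then have n: "int i - int j = n * int M" by (metis of_int_diff of_int_eq_iff of_int_mult of_int_of_nat_eq)
      then have "n \<noteq> 0" using False by auto
      then have "int M \<le> \<bar>n * int M\<bar>" using mult_right_mono[of 1 "\<bar>n\<bar>" "int M"] by (simp add: abs_mult)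
      then show False using n assms by linarith
    qed
    moreover have "z ^ M = 1"
    proof -
      have "M * (2 * pi * (real i - real j) / M) = 2 * pi * of_int (int i - int j)"
        using M by simp
      then have "z ^ M = cis (2 * pi * of_int (int i - int j))"
        by (simp only: z_def Complex.DeMoivre)
      then show ?thesis by (simp add: cis_multiple_2pi)
    qed
    ultimately show ?thesis using False unfolding eq by (simp add: geometric_sum)
  qed
qed

lemma Parseval_roots_of_unity:
  fixes c :: "nat \<Rightarrow> complex"
  assumes "0 < M"
  shows "(\<Sum>k<M. (norm (\<Sum>i<M. c i * cis (2 * pi * real k / M) ^ i))\<^sup>2) = M * (\<Sum>i<M. (norm (c i))\<^sup>2)"
proof -
  let ?w = "\<lambda>k. cis (2 * pi * real k / M)"
  have "complex_of_real (\<Sum>k<M. (norm (\<Sum>i<M. c i * ?w k ^ i))\<^sup>2) =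
      (\<Sum>k<M. (\<Sum>i<M. c i * ?w k ^ i) * cnj (\<Sum>j<M. c j * ?w k ^ j))"
    by (simp only: of_real_sum complex_norm_square)
  also have "\<dots> = (\<Sum>k<M. \<Sum>i<M. \<Sum>j<M. (c i * cnj (c j)) * (?w k ^ i * cnj (?w k ^ j)))"
    by (simp add: sum_product mult_ac)
  also have "\<dots> = (\<Sum>i<M. \<Sum>k<M. \<Sum>j<M. (c i * cnj (c j)) * (?w k ^ i * cnj (?w k ^ j)))"
    by (rule sum.swap)
  also have "\<dots> = (\<Sum>i<M. \<Sum>j<M. \<Sum>k<M. (c i * cnj (c j)) * (?w k ^ i * cnj (?w k ^ j)))"
    by (intro sum.cong refl sum.swap)
  also have "\<dots> = (\<Sum>i<M. \<Sum>j<M. (c i * cnj (c j)) * (if i = j then of_nat M else 0))"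
    by (intro sum.cong refl) (simp only: sum_distrib_left[symmetric] sum_roots_of_unity lessThan_iff)
  also have "\<dots> = (\<Sum>i<M. of_nat M * (c i * cnj (c i)))"
    by (intro sum.cong refl) (simp add: if_distrib sum.delta cong: if_cong)
  also have "\<dots> = complex_of_real (M * (\<Sum>i<M. (norm (c i))\<^sup>2))"
    by (simp only: of_real_mult of_real_sum complex_norm_square of_real_of_nat_eq sum_distrib_left)
  finally show ?thesis by (simp only: of_real_eq_iff)
qed

text \<open>The correlations of \<open>a\<close> are among the coefficients of the product of the polynomial with
  coefficients \<open>a\<close> and its reciprocal polynomial, which has the same modulus on the unit circle.\<close>

lemma correlation_energy_le:
  fixes a :: "nat \<Rightarrow> complex"
  assumes K: "0 < K" and H: "\<And>z. norm z = 1 \<Longrightarrow> norm (\<Sum>j<K. a j * z ^ j) \<le> H"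
  shows "(\<Sum>d<K. (norm (\<Sum>j<K - d. a (j + d) * cnj (a j)))\<^sup>2) \<le> H\<^sup>2 * (\<Sum>j<K. (norm (a j))\<^sup>2)"
proof -
  \<comment> \<open>The product has degree at most \<open>2 * K - 2\<close>, so Parseval over
    \<open>2 * K\<close> roots of unity sees each coefficient separately.\<close>
  define M where "M = 2 * K"
  have M: "0 < M" using K by (simp add: M_def)
  let ?w = "\<lambda>k. cis (2 * pi * real k / M)"
  define S where "S = {..<K} \<times> {..<K}"
  \<comment> \<open>The exponent of a pair in the product with the reciprocal polynomial: the lag
    \<open>fst x - snd x\<close>, offset by \<open>K - 1\<close> to remain a natural number.\<close>
  define g :: "nat \<times> nat \<Rightarrow> nat" where "g x = fst x + (K - 1 - snd x)" for x
  define c where "c i = (\<Sum>x | x \<in> S \<and> g x = i. a (fst x) * cnj (a (snd x)))" for i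
  have finS: "finite S" by (simp add: S_def)
  have gS: "g ` S \<subseteq> {..<M}" by (auto simp: S_def g_def M_def)
  have cz: "norm (\<Sum>i<M. c i * z ^ i) = norm (\<Sum>j<K. a j * z ^ j) * norm (\<Sum>j<K. a j * z ^ j)"
    if z: "norm z = 1" for z
  proof -
    have inv: "z ^ (K - 1 - j) = z ^ (K - 1) * cnj (z ^ j)" if "j < K" for j
    proof -
      have "z ^ (K - 1) = z ^ (K - 1 - j) * z ^ j" using that by (simp flip: power_add)
      moreover have "z ^ j * cnj (z ^ j) = 1"
        using z by (simp add: norm_power flip: complex_norm_square del: complex_cnj_power)
      ultimately show ?thesis by (simp add: mult.assoc)
    qed
    have "(\<Sum>i<M. c i * z ^ i) = (\<Sum>i<M. \<Sum>x | x \<in> S \<and> g x = i. a (fst x) * cnj (a (snd x)) * z ^ g x)"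
      by (auto simp: c_def sum_distrib_right intro!: sum.cong)
    also have "\<dots> = (\<Sum>x\<in>S. a (fst x) * cnj (a (snd x)) * z ^ g x)"
      by (rule sum.group[OF finS _ gS]) simp
    also have "\<dots> = (\<Sum>j<K. \<Sum>l<K. (a j * z ^ j) * (cnj (a l) * z ^ (K - 1 - l)))"
      by (simp add: S_def g_def sum.cartesian_product case_prod_unfold power_add mult_ac)
    also have "\<dots> = (\<Sum>j<K. a j * z ^ j) * (\<Sum>l<K. cnj (a l) * z ^ (K - 1 - l))"
      by (rule sum_product[symmetric])
    also have "(\<Sum>l<K. cnj (a l) * z ^ (K - 1 - l)) = (\<Sum>l<K. z ^ (K - 1) * cnj (a l * z ^ l))"
      by (rule sum.cong[OF refl]) (simp only: lessThan_iff inv complex_cnj_mult mult_ac)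
    also have "\<dots> = z ^ (K - 1) * cnj (\<Sum>l<K. a l * z ^ l)"
      by (simp only: sum_distrib_left[symmetric] cnj_sum)
    finally show ?thesis using z by (simp add: norm_mult norm_power del: cnj_sum)
  qed
  have w: "norm (?w k) = 1" for k by simp
  have "M * (\<Sum>i<M. (norm (c i))\<^sup>2) = (\<Sum>k<M. (norm (\<Sum>i<M. c i * ?w k ^ i))\<^sup>2)"
    by (rule Parseval_roots_of_unity[OF M, symmetric])
  also have "\<dots> = (\<Sum>k<M. (norm (\<Sum>j<K. a j * ?w k ^ j))\<^sup>2 * (norm (\<Sum>j<K. a j * ?w k ^ j))\<^sup>2)"
    by (simp only: cz[OF w] power_mult_distrib)
  \<comment> \<open>Only one of the two squared factors is estimated by \<open>H\<close>; the other
    is kept for Parseval.\<close>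
  also have "\<dots> \<le> (\<Sum>k<M. H\<^sup>2 * (norm (\<Sum>j<K. a j * ?w k ^ j))\<^sup>2)"
    by (intro sum_mono mult_right_mono power_mono H) auto
  also have "\<dots> = H\<^sup>2 * (\<Sum>k<M. (norm (\<Sum>j<M. (if j < K then a j else 0) * ?w k ^ j))\<^sup>2)"
  proof -
    have "(\<Sum>j<M. (if j < K then a j else 0) * z ^ j) = (\<Sum>j<K. a j * z ^ j)" for z
      by (rule sum.mono_neutral_cong_right) (auto simp: M_def)
    then show ?thesis by (simp add: sum_distrib_left)
  qed
  also have "\<dots> = H\<^sup>2 * (M * (\<Sum>j<M. (norm (if j < K then a j else 0))\<^sup>2))"
    by (simp only: Parseval_roots_of_unity[OF M])
  also have "(\<Sum>j<M. (norm (if j < K then a j else 0))\<^sup>2) = (\<Sum>j<K. (norm (a j))\<^sup>2)"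
    by (rule sum.mono_neutral_cong_right) (auto simp: M_def)
  finally have "M * (\<Sum>i<M. (norm (c i))\<^sup>2) \<le> M * (H\<^sup>2 * (\<Sum>j<K. (norm (a j))\<^sup>2))" by (simp add: mult_ac)
  then have le: "(\<Sum>i<M. (norm (c i))\<^sup>2) \<le> H\<^sup>2 * (\<Sum>j<K. (norm (a j))\<^sup>2)"
    using M by simp
  \<comment> \<open>The exponent \<open>K - 1 + d\<close> collects exactly the pairs with lag
    \<open>d\<close>; the exponents below \<open>K - 1\<close> belong to negative lags and are
    dropped at the end.\<close>
  have cd: "c (K - 1 + d) = (\<Sum>j<K - d. a (j + d) * cnj (a j))" if "d < K" for d
  proof -
    have "g x = K - 1 + d \<longleftrightarrow> fst x = snd x + d" if "x \<in> S" for x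
      using that by (auto simp: S_def g_def)
    then have "{x \<in> S. g x = K - 1 + d} = (\<lambda>j. (j + d, j)) ` {..<K - d}"
      by (auto simp: S_def image_iff g_def)
    then show ?thesis by (simp add: c_def sum.reindex inj_on_def)
  qed
  have "(\<Sum>d<K. (norm (\<Sum>j<K - d. a (j + d) * cnj (a j)))\<^sup>2) = (\<Sum>d<K. (norm (c (K - 1 + d)))\<^sup>2)"
    by (intro sum.cong refl) (simp only: cd lessThan_iff)
  also have "\<dots> = (\<Sum>i\<in>(\<lambda>d. K - 1 + d) ` {..<K}. (norm (c i))\<^sup>2)"
    by (subst sum.reindex) (auto simp: inj_on_def)
  also have "\<dots> \<le> (\<Sum>i<M. (norm (c i))\<^sup>2)"
    by (rule sum_mono2) (auto simp: M_def)
  finally show ?thesis using le by linarith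
qed

text \<open>Comparison of the sum with its shift by \<open>m\<close>: multiplication by
  \<open>1 - z ^ m\<close> leaves the increments \<open>a (j + m) - a j\<close> and two boundary
  blocks of \<open>m\<close> terms each.\<close>

lemma exponential_sum_shift_le:
  fixes a :: "nat \<Rightarrow> complex"
  assumes z: "norm z = 1" "1 \<le> norm (1 - z ^ m)"
    and a: "\<And>j. norm (a j) \<le> B" "\<And>j. norm (a (j + m) - a j) \<le> e"
  shows "norm (\<Sum>j<K. a j * z ^ j) \<le> e * K + 2 * m * B"
proof -
  let ?S = "\<lambda>A. \<Sum>j\<in>A. a j * z ^ j"
  have nz: "norm (w * z ^ j) = norm w" for w j using z(1) by (simp add: norm_mult norm_power)
  have "?S {..<K} + ?S {K..<K + m} = ?S {..<m + K}"
    "?S {..<m} + ?S {m..<m + K} = ?S {..<m + K}"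
    by (auto simp: sum.union_disjoint[symmetric] ivl_disj_un ivl_disj_int add.commute)
  moreover have "?S {m..<m + K} = (\<Sum>j<K. a (j + m) * z ^ (j + m))"
    using sum.shift_bounds_nat_ivl[of "\<lambda>j. a j * z ^ j" 0 m K] by (simp add: atLeast0LessThan add.commute)
  ultimately have "(1 - z ^ m) * ?S {..<K} =
      (\<Sum>j<K. (a (j + m) - a j) * z ^ (j + m)) + (?S {..<m} - ?S {K..<K + m})"
    by (simp add: algebra_simps sum_distrib_left sum_subtractf power_add)
  also have "norm \<dots> \<le> (\<Sum>j<K. e) + ((\<Sum>j<m. B) + (\<Sum>j=K..<K + m. B))"
    by (intro norm_triangle_mono order_trans[OF norm_triangle_ineq4] add_mono sum_norm_le)
      (auto simp: nz a)
  finally have "norm (1 - z ^ m) * norm (?S {..<K}) \<le> e * K + 2 * m * B"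
    unfolding norm_mult by (simp add: algebra_simps)
  moreover have "norm (?S {..<K}) \<le> norm (1 - z ^ m) * norm (?S {..<K})"
    using mult_right_mono[OF z(2), of "norm (?S {..<K})"] by simp
  ultimately show ?thesis by linarith
qed

section \<open>Uniqueness of the Fourier coefficients of an almost periodic function\<close>

lemma almost_periodic_continuous: "almost_periodic f \<Longrightarrow> continuous_on {0..} f"
  by (simp add: almost_periodic_def)

lemma almost_period_between:
  assumes "almost_periodic f" "0 < e"
  obtains l where "0 < l"
    "\<And>a. 0 \<le> a \<Longrightarrow> \<exists>\<tau>\<ge>a. \<tau> \<le> a + l \<and> (\<forall>t\<ge>0. norm (f (t + \<tau>) - f t) \<le> e)"
  using assms unfolding almost_periodic_def by (metis atLeastAtMost_iff)

text \<open>Subtracting an almost period just before \<open>s\<close> brings \<open>s\<close> into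
  \<open>{0..l}\<close> without leaving the half-line, so a compact interval controls the whole
  function. Windows of almost periods start at \<open>a \<ge> 0\<close>, hence the choice
  \<open>0\<close> for \<open>s \<le> l\<close>.\<close>

lemma almost_period_before:
  assumes "almost_periodic f" "0 < e"
  obtains l where "0 < l"
    "\<And>s. 0 \<le> s \<Longrightarrow> \<exists>\<tau>\<ge>0. \<tau> \<le> s \<and> s \<le> \<tau> + l \<and> (\<forall>t\<ge>0. norm (f (t + \<tau>) - f t) \<le> e)"
proof -
  obtain l where l: "0 < l"
    "\<And>a. 0 \<le> a \<Longrightarrow> \<exists>\<tau>\<ge>a. \<tau> \<le> a + l \<and> (\<forall>t\<ge>0. norm (f (t + \<tau>) - f t) \<le> e)"
    using almost_period_between[OF assms] by blast
  have "\<exists>\<tau>\<ge>0. \<tau> \<le> s \<and> s \<le> \<tau> + l \<and> (\<forall>t\<ge>0. norm (f (t + \<tau>) - f t) \<le> e)" if "0 \<le> s" for s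
  proof (cases "s \<le> l")
    case True
    then show ?thesis using that assms(2) by (intro exI[of _ 0]) auto
  next
    case False
    then obtain \<tau> where "s - l \<le> \<tau>" "\<tau> \<le> s - l + l" "\<forall>t\<ge>0. norm (f (t + \<tau>) - f t) \<le> e"
      using l(2)[of "s - l"] by auto
    then show ?thesis using False by (intro exI[of _ \<tau>]) auto
  qed
  then show ?thesis using that l(1) by blast
qed

lemma almost_periodic_bounded:
  assumes "almost_periodic f"
  obtains B where "0 < B" "\<And>t. 0 \<le> t \<Longrightarrow> norm (f t) \<le> B"
proof -
  obtain l where l: "0 < l"
    "\<And>s. 0 \<le> s \<Longrightarrow> \<exists>\<tau>\<ge>0. \<tau> \<le> s \<and> s \<le> \<tau> + l \<and> (\<forall>t\<ge>0. norm (f (t + \<tau>) - f t) \<le> 1)"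
    using almost_period_before[OF assms zero_less_one] by blast
  have "compact (f ` {0..l})"
    by (rule compact_continuous_image[OF continuous_on_subset[OF almost_periodic_continuous[OF assms]]]) auto
  then obtain b where b: "0 < b" "\<And>t. t \<in> {0..l} \<Longrightarrow> norm (f t) \<le> b"
    using bounded_pos[THEN iffD1, OF compact_imp_bounded] by (metis imageI)
  show ?thesis
  proof
    show "0 < b + 1" using b by simp
    fix s :: real assume "0 \<le> s"
    then obtain \<tau> where \<tau>: "0 \<le> \<tau>" "\<tau> \<le> s" "s \<le> \<tau> + l" "\<forall>t\<ge>0. norm (f (t + \<tau>) - f t) \<le> 1"
      using l(2) by blast
    have "norm (f ((s - \<tau>) + \<tau>) - f (s - \<tau>)) \<le> 1" using \<tau> by (intro \<tau>(4)[rule_format]) simp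
    moreover have "norm (f (s - \<tau>)) \<le> b" using \<tau> by (intro b(2)) auto
    ultimately show "norm (f s) \<le> b + 1"
      using norm_triangle_sub[of "f s" "f (s - \<tau>)"] by simp
  qed
qed

lemma almost_periodic_uniformly_continuous:
  assumes "almost_periodic f" "0 < e"
  obtains d where "0 < d" "\<And>s t. 0 \<le> s \<Longrightarrow> 0 \<le> t \<Longrightarrow> \<bar>s - t\<bar> < d \<Longrightarrow> norm (f s - f t) \<le> e"
proof -
  have e3: "0 < e / 3" using assms(2) by simp
  obtain l where l: "0 < l"
    "\<And>s. 0 \<le> s \<Longrightarrow> \<exists>\<tau>\<ge>0. \<tau> \<le> s \<and> s \<le> \<tau> + l \<and> (\<forall>t\<ge>0. norm (f (t + \<tau>) - f t) \<le> e / 3)"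
    using almost_period_before[OF assms(1) e3] by blast
  \<comment> \<open>The length \<open>l + 1\<close> leaves room for both points after subtracting
    one almost period taken for \<open>min s t\<close>, since their distance is below
    \<open>1\<close>.\<close>
  have "uniformly_continuous_on {0..l + 1} f"
    by (rule compact_uniformly_continuous[OF continuous_on_subset[OF almost_periodic_continuous[OF assms(1)]]]) auto
  then obtain d where d: "0 < d"
    "\<And>s t. s \<in> {0..l + 1} \<Longrightarrow> t \<in> {0..l + 1} \<Longrightarrow> \<bar>s - t\<bar> < d \<Longrightarrow> norm (f s - f t) < e / 3"
    unfolding uniformly_continuous_on_def dist_norm real_norm_def using e3 by metis
  show ?thesis
  proof
    show "0 < min d 1" using d by simp
    fix s t :: real assume st: "0 \<le> s" "0 \<le> t" "\<bar>s - t\<bar> < min d 1"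
    then obtain \<tau> where \<tau>: "0 \<le> \<tau>" "\<tau> \<le> min s t" "min s t \<le> \<tau> + l"
      "\<forall>t\<ge>0. norm (f (t + \<tau>) - f t) \<le> e / 3"
      using l(2)[of "min s t"] by auto
    have 1: "norm (f s - f (s - \<tau>)) \<le> e / 3" using \<tau>(4)[rule_format, of "s - \<tau>"] \<tau> by simp
    have 2: "norm (f t - f (t - \<tau>)) \<le> e / 3" using \<tau>(4)[rule_format, of "t - \<tau>"] \<tau> by simp
    have 3: "norm (f (s - \<tau>) - f (t - \<tau>)) \<le> e / 3"
      using \<tau> st by (intro less_imp_le[OF d(2)]) auto
    have "f s - f t = (f s - f (s - \<tau>)) + (f (s - \<tau>) - f (t - \<tau>)) - (f t - f (t - \<tau>))" by simp
    also have "norm \<dots> \<le> e / 3 + e / 3 + e / 3"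
      by (intro order_trans[OF norm_triangle_ineq4] norm_triangle_mono add_mono 1 2 3)
    finally show "norm (f s - f t) \<le> e" by simp
  qed
qed

text \<open>An almost period just before \<open>s\<close> moves \<open>s\<close> into
  \<open>{0..l}\<close>, where uniform continuity allows rounding down to a finite grid.\<close>

lemma almost_periodic_precompact:
  assumes "almost_periodic f" "0 < e"
  obtains P where "finite P" "P \<subseteq> {0..}"
    "\<And>s. 0 \<le> s \<Longrightarrow> \<exists>p\<in>P. \<forall>t\<ge>0. norm (f (t + s) - f (t + p)) \<le> e"
proof -
  have e2: "0 < e / 2" using assms(2) by simp
  obtain l where l: "0 < l"
    "\<And>s. 0 \<le> s \<Longrightarrow> \<exists>\<tau>\<ge>0. \<tau> \<le> s \<and> s \<le> \<tau> + l \<and> (\<forall>t\<ge>0. norm (f (t + \<tau>) - f t) \<le> e / 2)"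
    using almost_period_before[OF assms(1) e2] by blast
  obtain d where d: "0 < d" "\<And>s t. 0 \<le> s \<Longrightarrow> 0 \<le> t \<Longrightarrow> \<bar>s - t\<bar> < d \<Longrightarrow> norm (f s - f t) \<le> e / 2"
    using almost_periodic_uniformly_continuous[OF assms(1) e2] by blast
  define h where "h = d / 2"
  have h: "0 < h" "h < d" using d by (auto simp: h_def)
  define P where "P = (\<lambda>k. real k * h) ` {..nat \<lfloor>l / h\<rfloor>}"
  show ?thesis
  proof
    show "finite P" "P \<subseteq> {0..}" using h by (auto simp: P_def)
    fix s :: real assume "0 \<le> s"
    then obtain \<tau> where \<tau>: "0 \<le> \<tau>" "\<tau> \<le> s" "s \<le> \<tau> + l" "\<forall>t\<ge>0. norm (f (t + \<tau>) - f t) \<le> e / 2"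
      using l(2) by blast
    define k where "k = nat \<lfloor>(s - \<tau>) / h\<rfloor>"
    have k: "real k = of_int \<lfloor>(s - \<tau>) / h\<rfloor>" using \<tau> h by (simp add: k_def)
    have "real k \<le> (s - \<tau>) / h" "(s - \<tau>) / h < real k + 1"
      unfolding k by linarith+
    then have p: "real k * h \<le> s - \<tau>" "s - \<tau> < real k * h + h"
      using h by (auto simp: field_simps)
    have "(s - \<tau>) / h \<le> l / h" using \<tau> h by (simp add: divide_right_mono)
    then have "k \<le> nat \<lfloor>l / h\<rfloor>" unfolding k_def by (intro nat_mono floor_mono)
    then have "real k * h \<in> P" by (auto simp: P_def)
    moreover have "norm (f (t + s) - f (t + real k * h)) \<le> e" if "0 \<le> t" for t
    proof -
      have "norm (f ((t + s - \<tau>) + \<tau>) - f (t + s - \<tau>)) \<le> e / 2"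
        using \<tau> that by (intro \<tau>(4)[rule_format]) auto
      moreover have "norm (f (t + s - \<tau>) - f (t + real k * h)) \<le> e / 2"
        using p h \<tau> that by (intro d(2)) auto
      ultimately show ?thesis
        using norm_triangle_mono[of "f (t + s) - f (t + s - \<tau>)" "e / 2" "f (t + s - \<tau>) - f (t + real k * h)" "e / 2"]
        by simp
    qed
    ultimately show "\<exists>p\<in>P. \<forall>t\<ge>0. norm (f (t + s) - f (t + p)) \<le> e" by blast
  qed
qed

text \<open>Choosing one element of \<open>A\<close> for each pair \<open>(p s, q s)\<close> that
  occurs gives finitely many representatives for both relations at once. They lie in
  \<open>A\<close> even if \<open>P\<close> and \<open>Q\<close> consist of objects of other kinds,
  such as points of the circle.\<close>

lemma common_representatives:
  assumes "finite P" "\<And>s. s \<in> A \<Longrightarrow> \<exists>p\<in>P. R s p" "finite Q" "\<And>s. s \<in> A \<Longrightarrow> \<exists>q\<in>Q. S s q"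
  obtains T where "finite T" "T \<subseteq> A"
    "\<And>s. s \<in> A \<Longrightarrow> \<exists>t\<in>T. (\<exists>p\<in>P. R s p \<and> R t p) \<and> (\<exists>q\<in>Q. S s q \<and> S t q)"
proof -
  obtain p q where pq: "\<And>s. s \<in> A \<Longrightarrow> p s \<in> P \<and> R s (p s) \<and> q s \<in> Q \<and> S s (q s)"
    using assms(2,4) by metis
  let ?g = "\<lambda>s. (p s, q s)"
  have "?g ` A \<subseteq> P \<times> Q" using pq by auto
  then have "finite (?g ` A)" by (rule finite_subset) (use assms in simp)
  then obtain T where T: "T \<subseteq> A" "finite T" "?g ` A = ?g ` T"
    using finite_subset_image[of "?g ` A" ?g A] by auto
  show ?thesis
  proof
    fix s assume s: "s \<in> A"
    then obtain t where "t \<in> T" "?g s = ?g t" using T(3) by (metis (no_types, lifting) imageE imageI)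
    then show "\<exists>t\<in>T. (\<exists>p\<in>P. R s p \<and> R t p) \<and> (\<exists>q\<in>Q. S s q \<and> S t q)"
      using pq[OF s] pq[of t] T(1) by (intro bexI[of _ t]) auto
  qed (use T in auto)
qed

lemma circle_net:
  assumes "0 < (e::real)"
  obtains Q where "finite Q" "\<And>x. \<exists>q\<in>Q. norm (cis x - q) < e"
proof -
  have "compact (sphere (0::complex) 1)" by simp
  moreover have "sphere (0::complex) 1 \<subseteq> (\<Union>q\<in>sphere 0 1. ball q e)" using assms by force
  ultimately obtain Q where Q: "finite Q" "sphere (0::complex) 1 \<subseteq> (\<Union>q\<in>Q. ball q e)"
    by (rule compactE_image[OF _ open_ball]) blast
  have "\<exists>q\<in>Q. norm (cis x - q) < e" for x
  proof -
    have "cis x \<in> (\<Union>q\<in>Q. ball q e)" using Q(2) by (rule subsetD) simp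
    then show ?thesis by (auto simp: dist_norm norm_minus_commute)
  qed
  then show ?thesis using that Q(1) by blast
qed

text \<open>A shift that matches both the translate of \<open>f\<close> and the phase
  \<open>cis (r * s)\<close> matches the product. The tolerances \<open>e / 4\<close> and
  \<open>e / (4 * B)\<close> are each spent twice, because two shifts are compared through a common
  net point.\<close>

lemma precompact_translates_modulate:
  assumes "almost_periodic f"
  shows "precompact_translates (\<lambda>t. cis (r * t) * f t)"
  unfolding precompact_translates_def
proof (intro allI impI)
  fix e :: real assume e: "0 < e"
  obtain B where B: "0 < B" "\<And>t. 0 \<le> t \<Longrightarrow> norm (f t) \<le> B"
    using almost_periodic_bounded[OF assms] by blast
  obtain P where P: "finite P" "\<And>s. s \<in> {0..} \<Longrightarrow> \<exists>p\<in>P. \<forall>t\<ge>0. norm (f (t + s) - f (t + p)) \<le> e / 4"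
    using almost_periodic_precompact[OF assms, of "e / 4"] e by (metis atLeast_iff divide_pos_pos zero_less_numeral)
  have "0 < e / (4 * B)" using e B by simp
  then obtain Q where Q: "finite Q" "\<And>s. \<exists>q\<in>Q. norm (cis (r * s) - q) < e / (4 * B)"
    using circle_net by metis
  obtain T where T: "finite T" "T \<subseteq> {0..}"
    "\<And>s. s \<in> {0..} \<Longrightarrow> \<exists>p\<in>T. (\<exists>x\<in>P. (\<forall>t\<ge>0. norm (f (t + s) - f (t + x)) \<le> e / 4) \<and> (\<forall>t\<ge>0. norm (f (t + p) - f (t + x)) \<le> e / 4)) \<and>
      (\<exists>q\<in>Q. norm (cis (r * s) - q) < e / (4 * B) \<and> norm (cis (r * p) - q) < e / (4 * B))"
    by (rule common_representatives[where R = "\<lambda>s p. \<forall>t\<ge>0. norm (f (t + s) - f (t + p)) \<le> e / 4"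
        and S = "\<lambda>s q. norm (cis (r * s) - q) < e / (4 * B)" and A = "{0..}", OF P Q]) (assumption, rule that)
  show "\<exists>P. finite P \<and> P \<subseteq> {0..} \<and>
    (\<forall>s\<ge>0. \<exists>p\<in>P. \<forall>t\<ge>0. norm (cis (r * (t + s)) * f (t + s) - cis (r * (t + p)) * f (t + p)) \<le> e)"
  proof (intro exI[of _ T] conjI allI impI T(1,2))
    fix s :: real assume s: "0 \<le> s"
    obtain p x q where p: "p \<in> T" and x: "\<And>t. 0 \<le> t \<Longrightarrow> norm (f (t + s) - f (t + x)) \<le> e / 4"
      "\<And>t. 0 \<le> t \<Longrightarrow> norm (f (t + p) - f (t + x)) \<le> e / 4"
      and q: "norm (cis (r * s) - q) < e / (4 * B)" "norm (cis (r * p) - q) < e / (4 * B)"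
      using T(3)[of s] s by auto
    have "norm (cis (r * (t + s)) * f (t + s) - cis (r * (t + p)) * f (t + p)) \<le> e" if t: "0 \<le> t" for t
    proof -
      have fd: "norm (f (t + s) - f (t + p)) \<le> e / 4 + e / 4"
        using norm_triangle_le_diff[OF add_mono[OF x(1)[OF t] x(2)[OF t]]] by simp
      have cd: "norm (cis (r * s) - cis (r * p)) \<le> e / (4 * B) + e / (4 * B)"
        using norm_triangle_le_diff[OF add_mono[OF less_imp_le[OF q(1)] less_imp_le[OF q(2)]]] by simp
      have c: "cis (r * (t + u)) = cis (r * t) * cis (r * u)" for u
        by (simp add: cis_mult algebra_simps)
      have "cis (r * (t + s)) * f (t + s) - cis (r * (t + p)) * f (t + p) =
          cis (r * t) * (cis (r * s) * (f (t + s) - f (t + p)) + (cis (r * s) - cis (r * p)) * f (t + p))"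
        unfolding c by (simp add: algebra_simps)
      also have "norm \<dots> \<le> norm (f (t + s) - f (t + p)) + norm (cis (r * s) - cis (r * p)) * norm (f (t + p))"
        by (simp add: norm_mult order_trans[OF norm_triangle_ineq])
      also have "\<dots> \<le> (e / 4 + e / 4) + (e / (4 * B) + e / (4 * B)) * B"
        using T(2) p t e B(1) by (intro add_mono mult_mono fd cd B(2)) auto
      also have "\<dots> = e" using B by (simp add: field_simps)
      finally show ?thesis .
    qed
    then show "\<exists>p\<in>T. \<forall>t\<ge>0. norm (cis (r * (t + s)) * f (t + s) - cis (r * (t + p)) * f (t + p)) \<le> e"
      using p by blast
  qed
qed

lemma almost_periodic_means_Cauchy:
  assumes "almost_periodic f"
  shows "Cauchy (\<lambda>n. integral {0..real n} (\<lambda>t. cis (r * t) * f t) / n)"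
proof -
  obtain B where B: "\<And>t. 0 \<le> t \<Longrightarrow> norm (f t) \<le> B"
    using almost_periodic_bounded[OF assms] by blast
  show ?thesis
    by (rule means_Cauchy[where B = B, OF _ _ precompact_translates_modulate[OF assms]])
      (auto intro!: continuous_intros almost_periodic_continuous[OF assms] simp: norm_mult B)
qed

section \<open>Discretization: Riemann sums, the mean square and exponential sums of samples\<close>

lemma Riemann_sum_approx:
  fixes g :: "real \<Rightarrow> 'b::banach" and e h :: real
  assumes g: "continuous_on {0..} g" and h: "0 < h"
    and close: "\<And>j s. real j * h \<le> s \<Longrightarrow> s \<le> real j * h + h \<Longrightarrow> norm (g s - g (real j * h)) \<le> e"
  shows "norm (integral {0..real K * h} g - h *\<^sub>R (\<Sum>j<K. g (real j * h))) \<le> e * (real K * h)"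
proof (induction K)
  case (Suc K)
  let ?a = "real K * h"
  have a: "0 \<le> ?a" using h by simp
  have 1: "integral {0..real (Suc K) * h} g = integral {0..?a} g + integral {?a..?a + h} g"
    using h by (subst Henstock_Kurzweil_Integration.integral_combine)
      (auto intro!: integrable_on_halfline[OF g] simp: algebra_simps)
  have "integral {?a..?a + h} g - h *\<^sub>R g ?a = integral {?a..?a + h} (\<lambda>s. g s - g ?a)"
    using h a by (subst Henstock_Kurzweil_Integration.integral_diff) (auto intro!: integrable_on_halfline[OF g])
  also have "norm \<dots> \<le> e * ((?a + h) - ?a)"
    by (rule norm_integral_halfline_le) (use h a close in \<open>auto intro!: continuous_intros g\<close>)
  finally have 2: "norm (integral {?a..?a + h} g - h *\<^sub>R g ?a) \<le> e * h" by simp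
  have "norm (integral {0..real (Suc K) * h} g - h *\<^sub>R (\<Sum>j<Suc K. g (real j * h))) =
      norm ((integral {0..?a} g - h *\<^sub>R (\<Sum>j<K. g (real j * h))) + (integral {?a..?a + h} g - h *\<^sub>R g ?a))"
    unfolding 1 by (simp add: algebra_simps)
  also have "\<dots> \<le> e * (real K * h) + e * h"
    by (intro norm_triangle_mono Suc.IH 2)
  finally show ?case by (simp add: algebra_simps)
qed simp

lemma integral_block_lower_bound:
  fixes g :: "real \<Rightarrow> real" and T n :: nat and c :: real
  assumes g: "continuous_on {0..} g" "\<And>t. 0 \<le> t \<Longrightarrow> 0 \<le> g t" and T: "0 < T" and c: "0 \<le> c"
    and win: "\<And>a::real. 0 \<le> a \<Longrightarrow> c * T \<le> integral {a..a + T} g"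
  shows "c * n - c * T \<le> integral {0..n} g"
proof (induction n rule: less_induct)
  case (less n)
  show ?case
  proof (cases "n < T")
    case True
    have "0 \<le> integral {0..real n} g" by (rule integral_nonneg[OF integrable_on_halfline[OF g(1)]]) (use g in auto)
    moreover have "c * n \<le> c * T" using True c by (intro mult_left_mono) auto
    ultimately show ?thesis by linarith
  next
    case False
    have "integral {0..n} g = integral {0..real (n - T)} g + integral {real (n - T)..real (n - T) + T} g"
      using False by (subst Henstock_Kurzweil_Integration.integral_combine)
        (auto intro: integrable_on_halfline[OF g(1)] simp: of_nat_diff)
    moreover have "c * real (n - T) - c * T \<le> integral {0..real (n - T)} g"
      using less[of "n - T"] False T by simp
    ultimately show ?thesis using win[of "real (n - T)"] False by (simp add: of_nat_diff algebra_simps)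
  qed
qed

text \<open>Near every translate of \<open>t0\<close> by an almost period, \<open>norm (f t)\<close>
  stays above half of \<open>norm (f t0)\<close>, and such intervals of length \<open>d / 2\<close>
  recur in every window of length \<open>T\<close>.\<close>

lemma almost_periodic_mean_square_pos:
  fixes f :: "real \<Rightarrow> complex"
  assumes f: "almost_periodic f" and t0: "0 \<le> t0" "f t0 \<noteq> 0"
  obtains m N where "0 < m" "\<And>n. N \<le> n \<Longrightarrow> m * real n \<le> integral {0..real n} (\<lambda>t. (norm (f t))\<^sup>2)"
proof -
  define \<kappa> where "\<kappa> = norm (f t0)"
  have \<kappa>: "0 < \<kappa>" "0 < \<kappa> / 4" using t0 by (auto simp: \<kappa>_def)
  obtain l where l: "0 < l"
    "\<And>a. 0 \<le> a \<Longrightarrow> \<exists>\<tau>\<ge>a. \<tau> \<le> a + l \<and> (\<forall>t\<ge>0. norm (f (t + \<tau>) - f t) \<le> \<kappa> / 4)"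
    using almost_period_between[OF f \<kappa>(2)] by blast
  obtain d where d: "0 < d" "\<And>s t. 0 \<le> s \<Longrightarrow> 0 \<le> t \<Longrightarrow> \<bar>s - t\<bar> < d \<Longrightarrow> norm (f s - f t) \<le> \<kappa> / 4"
    using almost_periodic_uniformly_continuous[OF f \<kappa>(2)] by blast
  let ?g = "\<lambda>t. (norm (f t))\<^sup>2"
  have g: "continuous_on {0..} ?g" by (intro continuous_intros almost_periodic_continuous[OF f])
  define T where "T = Suc (nat \<lceil>l + t0 + d\<rceil>)"
  have T: "0 < T" "l + t0 + d \<le> real T" by (simp_all add: T_def) linarith
  define c where "c = (\<kappa> / 2)\<^sup>2 * (d / 2) / T"
  have c: "0 < c" using \<kappa> d T by (simp add: c_def)
  have win: "c * T \<le> integral {a..a + T} ?g" if a: "0 \<le> a" for a :: real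
  proof -
    obtain \<tau> where \<tau>: "a \<le> \<tau>" "\<tau> \<le> a + l" "\<forall>t\<ge>0. norm (f (t + \<tau>) - f t) \<le> \<kappa> / 4"
      using l(2)[OF a] by blast
    let ?b = "t0 + \<tau>"
    have low: "(\<kappa> / 2)\<^sup>2 \<le> ?g s" if s: "s \<in> {?b..?b + d / 2}" for s
    proof (rule power_mono)
      have "norm (f ?b - f t0) \<le> \<kappa> / 4" using \<tau>(3) t0 by simp
      moreover have "norm (f s - f ?b) \<le> \<kappa> / 4" using s d t0 \<tau> a by (intro d(2)) auto
      ultimately have "norm (f s - f t0) \<le> \<kappa> / 4 + \<kappa> / 4"
        using norm_triangle_mono[of "f s - f ?b" "\<kappa> / 4" "f ?b - f t0" "\<kappa> / 4"] by simp
      then show "\<kappa> / 2 \<le> norm (f s)"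
        using norm_triangle_sub[of "f t0" "f s"] by (simp add: \<kappa>_def norm_minus_commute)
    qed (use \<kappa> in simp)
    have "c * T = integral {?b..?b + d / 2} (\<lambda>s. (\<kappa> / 2)\<^sup>2)"
      using T d by (simp add: c_def)
    also have "\<dots> \<le> integral {?b..?b + d / 2} ?g"
      by (rule integral_le) (use low t0 \<tau> a in \<open>auto intro!: integrable_on_halfline g\<close>)
    also have "\<dots> \<le> integral {a..a + T} ?g"
      by (rule integral_subset_le) (use t0 \<tau> a d T in \<open>auto intro!: integrable_on_halfline g\<close>)
    finally show ?thesis .
  qed
  show ?thesis
  proof
    show "0 < c / 2" using c by simp
    \<comment> \<open>From here on the loss \<open>c * T\<close> is at most half of
      \<open>c * n\<close>.\<close>
    fix n assume n: "2 * T \<le> n"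
    have "c * n - c * T \<le> integral {0..real n} ?g"
      by (rule integral_block_lower_bound[OF g _ T(1) _ win]) (use c in auto)
    moreover have "c * (2 * real T) \<le> c * real n" using n c by (intro mult_left_mono) auto
    ultimately show "c / 2 * real n \<le> integral {0..real n} ?g" by simp
  qed
qed

text \<open>Small frequencies are handled by comparison with the mean values, large ones by uniform
  continuity.\<close>

lemma exponential_sum_small:
  fixes f :: "real \<Rightarrow> complex"
  assumes f: "almost_periodic f"
    and zero: "\<And>r. (\<lambda>n. integral {0..real n} (\<lambda>t. cis (- r * t) * f t) / n) \<longlonglongrightarrow> 0"
    and \<eta>: "0 < \<eta>"
  obtains M0 N where "\<And>M n z. M0 \<le> M \<Longrightarrow> N \<le> n \<Longrightarrow> 0 < M \<Longrightarrow> norm z = 1 \<Longrightarrow>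
    norm (\<Sum>j<M * n. f (real j / M) * z ^ j) \<le> \<eta> * (M * n)"
proof -
  obtain B where B: "0 < B" "\<And>t. 0 \<le> t \<Longrightarrow> norm (f t) \<le> B"
    using almost_periodic_bounded[OF f] by blast
  have cont: "continuous_on {0..} f" by (rule almost_periodic_continuous[OF f])
  have \<eta>4: "0 < \<eta> / 4" and \<eta>2: "0 < \<eta> / 2" using \<eta> by auto
  obtain d where d: "0 < d" "\<And>s t. 0 \<le> s \<Longrightarrow> 0 \<le> t \<Longrightarrow> \<bar>s - t\<bar> < d \<Longrightarrow> norm (f s - f t) \<le> \<eta> / 4"
    using almost_periodic_uniformly_continuous[OF f \<eta>4] by blast
  \<comment> \<open>For \<open>\<bar>\<theta>\<bar> * M > R\<close> this bounds
    \<open>pi / (3 * \<bar>\<theta>\<bar>)\<close> by \<open>M * d / 3\<close>, using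
    \<open>pi < 4\<close>; the shift \<open>m / M\<close> chosen below then stays under the modulus
    of continuity \<open>d\<close>.\<close>
  define R where "R = 4 / d"
  have R: "0 < R" using d by (simp add: R_def)
  obtain N1 where N1: "\<And>n r. N1 \<le> n \<Longrightarrow> \<bar>r\<bar> \<le> R \<Longrightarrow>
      norm (integral {0..real n} (\<lambda>t. cis (- r * t) * f t)) \<le> \<eta> / 2 * n"
    using means_uniform_frequency[OF cont B(2) precompact_translates_modulate[OF f] zero \<eta>2] by blast
  \<comment> \<open>\<open>3 / d\<close> makes the mesh \<open>1 / M\<close> at most
    \<open>d / 3\<close>; \<open>4 * B * R / \<eta>\<close> makes the phase change over one mesh
    cell, times \<open>B\<close>, at most \<open>\<eta> / 4\<close>.\<close>
  define M0 where "M0 = nat \<lceil>max (3 / d) (4 * B * R / \<eta>)\<rceil>"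
  \<comment> \<open>The two boundary blocks of \<open>m < M * d\<close> terms then cost at most
    three quarters of \<open>\<eta> * (M * n)\<close>.\<close>
  define N where "N = max N1 (nat \<lceil>8 * d * B / (3 * \<eta>)\<rceil>)"
  have main: "norm (\<Sum>j<M * n. f (real j / M) * z ^ j) \<le> \<eta> * (M * n)"
    if M0: "M0 \<le> M" and n: "N \<le> n" and M: "0 < M" and z: "norm z = 1" for M n z
  proof -
    have Md: "3 / d \<le> M" and MB: "4 * B * R / \<eta> \<le> M"
      using M0 by (simp_all add: M0_def nat_ceiling_le_eq)
    \<comment> \<open>With this sign \<open>z ^ j\<close> is the sample at \<open>j / M\<close> of
      \<open>cis (- r * t)\<close> for \<open>r = \<theta> * M\<close>.\<close>
    define \<theta> where "\<theta> = - Arg z"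
    have \<theta>: "z = cis (- \<theta>)" "\<bar>\<theta>\<bar> \<le> pi"
      using z Arg_bounded[of z] cis_Arg[of z] by (force simp: \<theta>_def sgn_div_norm)+
    show ?thesis
    proof (cases "\<bar>\<theta> * M\<bar> \<le> R")
      case True
      define r where "r = \<theta> * M"
      let ?g = "\<lambda>t. cis (- r * t) * f t"
      have summand: "f (real j / M) * z ^ j = ?g (real j * (1 / M))" for j
        using M by (simp add: \<theta>(1) Complex.DeMoivre r_def mult.commute)
      have "norm (integral {0..real (M * n) * (1 / M)} ?g - (1 / M) *\<^sub>R (\<Sum>j<M * n. ?g (real j * (1 / M))))
          \<le> (\<eta> / 4 + \<eta> / 4) * (real (M * n) * (1 / M))"
      proof (rule Riemann_sum_approx)
        show "continuous_on {0..} ?g" by (intro continuous_intros cont)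
        show "0 < 1 / real M" using M by simp
        fix j s assume s: "real j * (1 / M) \<le> s" "s \<le> real j * (1 / M) + 1 / M"
        let ?x = "real j * (1 / M)"
        have s0: "0 \<le> ?x" "0 \<le> s" using s M by (auto intro: order_trans[rotated])
        have "1 / M < d" using Md d M by (simp add: field_simps)
        then have 1: "norm (f s - f ?x) \<le> \<eta> / 4" using s s0 by (intro d(2)) auto
        have "norm (cis (- r * s) - cis (- r * ?x)) \<le> \<bar>- r * s - - r * ?x\<bar>" by (rule norm_cis_diff_le)
        also have "- r * s - - r * ?x = - (r * (s - ?x))" by (simp add: right_diff_distrib)
        also have "\<bar>- (r * (s - ?x))\<bar> \<le> R * (1 / M)"
          unfolding abs_minus_cancel abs_mult using s True R by (intro mult_mono) (auto simp: r_def)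
        finally have "norm (cis (- r * s) - cis (- r * ?x)) * norm (f ?x) \<le> R * (1 / M) * B"
          using s0 B R by (intro mult_mono) auto
        also have "\<dots> \<le> \<eta> / 4" using MB M \<eta> by (simp add: field_simps)
        finally have 2: "norm ((cis (- r * s) - cis (- r * ?x)) * f ?x) \<le> \<eta> / 4" by (simp add: norm_mult)
        have "?g s - ?g ?x = cis (- r * s) * (f s - f ?x) + (cis (- r * s) - cis (- r * ?x)) * f ?x"
          by (simp add: algebra_simps)
        also have "norm \<dots> \<le> \<eta> / 4 + \<eta> / 4"
          by (intro norm_triangle_mono 2) (use 1 in \<open>simp add: norm_mult\<close>)
        finally show "norm (?g s - ?g ?x) \<le> \<eta> / 4 + \<eta> / 4" .
      qed
      then have "norm (integral {0..real n} ?g - (1 / M) *\<^sub>R (\<Sum>j<M * n. f (real j / M) * z ^ j)) \<le> \<eta> / 2 * n"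
        unfolding summand using M by simp
      moreover have "norm (integral {0..real n} ?g) \<le> \<eta> / 2 * n"
        using n True by (intro N1) (auto simp: N_def r_def)
      ultimately have "norm ((1 / M) *\<^sub>R (\<Sum>j<M * n. f (real j / M) * z ^ j)) \<le> \<eta> * n"
        using norm_triangle_sub[of "(1 / M) *\<^sub>R (\<Sum>j<M * n. f (real j / M) * z ^ j)" "integral {0..real n} ?g"]
        by (simp add: norm_minus_commute)
      then show ?thesis using M by (simp add: field_simps)
    next
      case False
      then have \<theta>M: "R < \<bar>\<theta>\<bar> * M" by (simp add: abs_mult)
      then have \<theta>0: "0 < \<bar>\<theta>\<bar>" using R M by (metis abs_ge_zero less_eq_real_def less_trans mult_zero_left not_less_iff_gr_or_eq)
      \<comment> \<open>The least integer \<open>m \<ge> x\<close> places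
        \<open>m * \<bar>\<theta>\<bar>\<close> between \<open>pi / 3\<close> and \<open>pi\<close>,
        so that \<open>cos (m * \<theta>) \<le> 1 / 2\<close> and hence
        \<open>norm (1 - z ^ m) \<ge> 1\<close>.\<close>
      define x where "x = pi / (3 * \<bar>\<theta>\<bar>)"
      have x: "0 < x" "x * \<bar>\<theta>\<bar> = pi / 3" using \<theta>0 by (auto simp: x_def)
      define m where "m = nat \<lceil>x\<rceil>"
      have m: "x \<le> m" "m < x + 1" using x(1) by (auto simp: m_def) linarith+
      have m\<theta>: "pi / 3 \<le> m * \<bar>\<theta>\<bar>" using mult_right_mono[OF m(1), of "\<bar>\<theta>\<bar>"] x(2) by simp
      have m\<theta>': "m * \<bar>\<theta>\<bar> \<le> pi"
      \<comment> \<open>Up to \<open>2 * pi / 3\<close> rounding \<open>x\<close> up cannot carry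
        the angle past \<open>pi\<close>; above it \<open>m = 1\<close> and the bound on
        \<open>\<theta>\<close> suffices.\<close>
      proof (cases "\<bar>\<theta>\<bar> \<le> 2 * pi / 3")
        case True
        have "m * \<bar>\<theta>\<bar> \<le> (x + 1) * \<bar>\<theta>\<bar>" using m by (intro mult_right_mono) auto
        then show ?thesis using True x(2) by (simp add: distrib_right)
      next
        case False
        then have "x \<le> 1" using \<theta>0 by (simp add: x_def field_simps)
        then have "real m < 2" "0 < real m" using m x(1) by linarith+
        then have "m = 1" by simp
        then show ?thesis using \<theta>(2) by simp
      qed
      have "cos (m * \<bar>\<theta>\<bar>) \<le> cos (pi / 3)"
        by (rule cos_monotone_0_pi_le) (use m\<theta> m\<theta>' in auto)
      then have cosm: "cos (m * \<theta>) \<le> 1 / 2" by (simp add: cos_60 abs_if split: if_splits)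
      have "z ^ m = cis (- (m * \<theta>))" by (simp add: \<theta>(1) Complex.DeMoivre)
      then have "(norm (1 - z ^ m))\<^sup>2 = (1 - cos (m * \<theta>))\<^sup>2 + (sin (m * \<theta>))\<^sup>2"
        by (simp add: cmod_power2)
      also have "\<dots> = 2 - 2 * cos (m * \<theta>)"
        using sin_cos_squared_add[of "m * \<theta>"] by (simp add: power2_eq_square algebra_simps)
      finally have "(norm (1 - z ^ m))\<^sup>2 = 2 - 2 * cos (m * \<theta>)" .
      then have "1\<^sup>2 \<le> (norm (1 - z ^ m))\<^sup>2" using cosm by simp
      then have zm: "1 \<le> norm (1 - z ^ m)" by (rule power2_le_imp_le) simp
      have mM: "m / M < d"
      proof -
        have "x \<le> pi * M / (3 * R)" 
          using \<theta>M \<theta>0 R M by (simp add: x_def field_simps)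
        also have "\<dots> \<le> 4 * M / (3 * R)" using pi_less_4 R M by (intro divide_right_mono mult_right_mono) auto
        also have "\<dots> = M * d / 3" by (simp add: R_def)
        finally have "x \<le> M * d / 3" .
        moreover have "1 \<le> M * d / 3" using Md d M by (simp add: field_simps)
        moreover have "0 < M * d" using M d by simp
        ultimately have "m < M * d" using m by linarith
        then show ?thesis using M by (simp add: field_simps)
      qed
      have "norm (\<Sum>j<M * n. f (real j / M) * z ^ j) \<le> \<eta> / 4 * real (M * n) + 2 * real m * B"
      proof (rule exponential_sum_shift_le[OF z zm])
        show "norm (f (real j / M)) \<le> B" for j by (rule B(2)) simp
        show "norm (f (real (j + m) / M) - f (real j / M)) \<le> \<eta> / 4" for j
          using mM by (intro d(2)) (auto simp: add_divide_distrib)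
      qed
      also have "2 * real m * B \<le> 3 * \<eta> / 4 * real (M * n)"
      proof -
        have "8 * d * B / (3 * \<eta>) \<le> n" using n by (simp add: N_def nat_ceiling_le_eq)
        then have "2 * (d * B) \<le> 3 * \<eta> / 4 * n" using \<eta> by (simp add: field_simps)
        then have "M * (2 * (d * B)) \<le> M * (3 * \<eta> / 4 * n)" by (rule mult_left_mono) simp
        moreover have "2 * real m * B \<le> 2 * (M * d) * B"
          using mM B M by (intro mult_right_mono) (auto simp: field_simps)
        ultimately show ?thesis by (simp add: mult_ac)
      qed
      finally show ?thesis by (simp add: algebra_simps)
    qed
  qed
  show ?thesis by (rule that[of M0 N]) (use main in simp)
qed

section \<open>The proportion of almost periods among grid shifts, and the uniqueness
  theorem\<close>

lemma pigeonhole_fiber: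
  assumes "finite P" "finite A" "g ` A \<subseteq> P"  "A \<noteq> {}"
  obtains p where "p \<in> P" "card A \<le> card P * card {x \<in> A. g x = p}"
proof -
  have "P \<noteq> {}" using assms by blast
  have "\<exists>p\<in>P. card A \<le> card P * card {x \<in> A. g x = p}"
  proof (rule ccontr)
    assume "\<not> ?thesis"
    then have "card P * card {x \<in> A. g x = p} < card A" if "p \<in> P" for p using that by force
    then have "(\<Sum>p\<in>P. card P * card {x \<in> A. g x = p}) < (\<Sum>p\<in>P. card A)"
      by (intro sum_strict_mono assms \<open>P \<noteq> {}\<close>)
    moreover have "(\<Sum>p\<in>P. card {x \<in> A. g x = p}) = card A"
      using sum.group[OF assms(2,1,3), of "\<lambda>_. 1::nat"] by simp
    ultimately show False by (simp flip: sum_distrib_left)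
  qed
  then show ?thesis using that by blast
qed

text \<open>The constant is the number of classes of translates, hence independent of
  \<open>M\<close> and \<open>K\<close>. By the pigeonhole principle one class contains a share of
  at least \<open>1 / card P\<close> of the shifts \<open>x / M\<close>, and the differences to its
  least element are almost periods.\<close>

lemma almost_period_count:
  fixes f :: "real \<Rightarrow> complex"
  assumes f: "almost_periodic f" and e: "0 < e"
  obtains q :: nat where "0 < q" "\<And>M K. 0 < M \<Longrightarrow> 0 < K \<Longrightarrow>
    \<exists>Q\<subseteq>{..<K}. K \<le> q * card Q \<and> (\<forall>d\<in>Q. \<forall>y\<ge>0. norm (f (y + real d / real M) - f y) \<le> e)"
proof -
  have e4: "0 < e / 4" using e by simp
  obtain P where P: "finite P" "P \<subseteq> {0..}"
    "\<And>s. 0 \<le> s \<Longrightarrow> \<exists>p\<in>P. \<forall>t\<ge>0. norm (f (t + s) - f (t + p)) \<le> e / 4"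
    using almost_periodic_precompact[OF f e4] by blast
  obtain l where l: "0 < l"
    "\<And>a. 0 \<le> a \<Longrightarrow> \<exists>\<tau>\<ge>a. \<tau> \<le> a + l \<and> (\<forall>t\<ge>0. norm (f (t + \<tau>) - f t) \<le> e / 4)"
    using almost_period_between[OF f e4] by blast
  obtain g where g: "\<And>s. 0 \<le> s \<Longrightarrow> g s \<in> P" "\<And>s t. 0 \<le> s \<Longrightarrow> 0 \<le> t \<Longrightarrow> norm (f (t + s) - f (t + g s)) \<le> e / 4"
    using P(3) by metis
  have P0: "P \<noteq> {}" using g(1)[of 0] by auto
  have "\<exists>Q\<subseteq>{..<K}. K \<le> card P * card Q \<and> (\<forall>d\<in>Q. \<forall>y\<ge>0. norm (f (y + real d / real M) - f y) \<le> e)"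
    if M: "0 < M" and K: "0 < K" for M K :: nat
  proof -
    obtain p where p: "p \<in> P" "card {..<K} \<le> card P * card {x \<in> {..<K}. g (real x / M) = p}"
      by (rule pigeonhole_fiber[of P "{..<K}" "\<lambda>x. g (real x / M)"]) (use P K g(1) in auto)
    define F where "F = {x \<in> {..<K}. g (real x / M) = p}"
    have F: "finite F" "K \<le> card P * card F"
      using p by (auto simp: F_def)
    have "card F \<noteq> 0" using F(2) K by (intro notI) simp
    then have "F \<noteq> {}" by auto
    define d0 where "d0 = Min F"
    have d0: "d0 \<in> F" "\<And>x. x \<in> F \<Longrightarrow> d0 \<le> x" using F(1) \<open>F \<noteq> {}\<close> by (auto simp: d0_def)
    have per: "norm (f (y + real (x - d0) / M) - f y) \<le> e" if x: "x \<in> F" and y: "0 \<le> y" for x y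
    proof -
      let ?s0 = "real d0 / M" and ?h = "real (x - d0) / M"
      \<comment> \<open>Two shifts of one class yield an almost period that works only from
        \<open>?s0\<close> onwards; a further almost period beyond \<open>?s0\<close> carries this
        back to all \<open>y \<ge> 0\<close>.\<close>
      obtain \<tau> where \<tau>: "?s0 \<le> \<tau>" "\<forall>t\<ge>0. norm (f (t + \<tau>) - f t) \<le> e / 4"
        using l(2)[of ?s0] by auto
      have sx: "real x / M = ?h + ?s0" using d0(2)[OF x] by (simp add: of_nat_diff diff_divide_distrib)
      let ?t = "y + \<tau> - ?s0"
      have t: "0 \<le> ?t" using \<tau> y by simp
      have gx: "g (real x / M) = p" "g ?s0 = p" using x d0(1) by (auto simp: F_def)
      have 1: "norm (f (?t + real x / M) - f (?t + p)) \<le> e / 4" "norm (f (?t + ?s0) - f (?t + p)) \<le> e / 4"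
        using g(2)[of "real x / M" ?t] g(2)[of ?s0 ?t] t gx by auto
      have eq: "?t + real x / M = (y + ?h) + \<tau>" "?t + ?s0 = y + \<tau>" unfolding sx by simp_all
      have 2: "norm (f ((y + ?h) + \<tau>) - f (y + ?h)) \<le> e / 4" "norm (f (y + \<tau>) - f y) \<le> e / 4"
        using \<tau>(2) y by auto
      have "f (y + ?h) - f y = ((f (?t + real x / M) - f (?t + p)) - (f (?t + ?s0) - f (?t + p)))
         + ((f (y + \<tau>) - f y) - (f ((y + ?h) + \<tau>) - f (y + ?h)))"
        unfolding eq by simp
      also have "norm \<dots> \<le> (e / 4 + e / 4) + (e / 4 + e / 4)"
        by (intro norm_triangle_mono order_trans[OF norm_triangle_ineq4] add_mono 1 2)
      finally show ?thesis by simp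
    qed
    have inj: "inj_on (\<lambda>x. x - d0) F" using d0(2) by (auto simp: inj_on_def) (metis le_add_diff_inverse2)
    show ?thesis
    proof (intro exI[of _ "(\<lambda>x. x - d0) ` F"] conjI ballI)
      show "(\<lambda>x. x - d0) ` F \<subseteq> {..<K}" by (auto simp: F_def)
      show "K \<le> card P * card ((\<lambda>x. x - d0) ` F)" using F by (simp add: card_image[OF inj])
    qed (use per in auto)
  qed
  then show ?thesis using that[of "card P"] P P0 by (simp add: card_gt_0_iff)
qed

text \<open>The order of choices matters: \<open>q\<close> depends on \<open>e\<close> alone, so the
  target \<open>c\<close> and the tolerance \<open>\<eta>\<close> are fixed before the mesh
  \<open>1 / M\<close> and the length \<open>n\<close>, which have to suit
  \<open>\<eta>\<close>.\<close>

lemma almost_periodic_eq_zero: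
  fixes f :: "real \<Rightarrow> complex"
  assumes f: "almost_periodic f"
    and zero: "\<And>r. (\<lambda>n. integral {0..real n} (\<lambda>t. cis (- r * t) * f t) / n) \<longlonglongrightarrow> 0"
    and t0: "0 \<le> t0"
  shows "f t0 = 0"
proof (rule ccontr)
  assume "f t0 \<noteq> 0"
  then obtain m N0 where m: "0 < m" "\<And>n. N0 \<le> n \<Longrightarrow> m * real n \<le> integral {0..real n} (\<lambda>t. (norm (f t))\<^sup>2)"
    using almost_periodic_mean_square_pos[OF f t0] by blast
  obtain B where B: "0 < B" "\<And>t. 0 \<le> t \<Longrightarrow> norm (f t) \<le> B"
    using almost_periodic_bounded[OF f] by blast
  \<comment> \<open>Replacing \<open>a (j + d)\<close> by \<open>a j\<close> in at most
    \<open>2 * L\<close> terms costs \<open>2 * L * e * B = m / 4 * L\<close>, half of the energy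
    bound \<open>m / 2 * L\<close>.\<close>
  define e where "e = m / (8 * B)"
  have e: "0 < e" using m B by (simp add: e_def)
  obtain q where q: "0 < q" "\<And>M K. 0 < M \<Longrightarrow> 0 < K \<Longrightarrow>
    \<exists>Q\<subseteq>{..<K}. K \<le> q * card Q \<and> (\<forall>d\<in>Q. \<forall>y\<ge>0. norm (f (y + real d / real M) - f y) \<le> e)"
    using almost_period_count[OF f e] by metis
  have mB: "0 < m / (4 * B)" using m B by simp
  obtain d where d: "0 < d" "\<And>s t. 0 \<le> s \<Longrightarrow> 0 \<le> t \<Longrightarrow> \<bar>s - t\<bar> < d \<Longrightarrow> norm (f s - f t) \<le> m / (4 * B)"
    using almost_periodic_uniformly_continuous[OF f mB] by blast
  \<comment> \<open>Makes \<open>L / q\<close> correlations of size \<open>m / 4 * L\<close> have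
    total energy exactly \<open>c * (2 * L) ^ 3\<close>.\<close>
  define c where "c = m\<^sup>2 / (128 * q)"
  have c: "0 < c" using m q by (simp add: c_def)
  \<comment> \<open>Aims at the energy \<open>c / 2 * (2 * L) ^ 3\<close>, strictly below the one
    just described.\<close>
  define \<eta> where "\<eta> = sqrt (c / (2 * B\<^sup>2))"
  have \<eta>: "0 < \<eta>" "\<eta>\<^sup>2 * B\<^sup>2 = c / 2" using c B by (auto simp: \<eta>_def)
  obtain M0 N1 where N1: "\<And>M n z. M0 \<le> M \<Longrightarrow> N1 \<le> n \<Longrightarrow> 0 < M \<Longrightarrow> norm z = 1 \<Longrightarrow>
    norm (\<Sum>j<M * n. f (real j / M) * z ^ j) \<le> \<eta> * (M * n)"
    using exponential_sum_small[OF f zero \<eta>(1)] by metis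
  define M where "M = Suc (max M0 (nat \<lceil>1 / d\<rceil>))"
  have M: "0 < M" "M0 \<le> M" by (auto simp: M_def)
  have "1 / d < M" unfolding M_def by linarith
  then have Md: "1 / M < d" using d M by (simp add: field_simps)
  define n where "n = Suc (max N0 N1)"
  \<comment> \<open>The sequence has length \<open>2 * L\<close> but is tested at lags
    \<open>d < L\<close> only, so the first \<open>L\<close> terms, whose energy is bounded below,
    survive in every correlation.\<close>
  define L where "L = M * n"
  have n: "0 < n" "N0 \<le> n" "N1 \<le> 2 * n" by (auto simp: n_def)
  have L: "0 < L" using M n by (simp add: L_def)
  define a where "a j = f (real j / M)" for j
  have aB: "norm (a j) \<le> B" for j unfolding a_def by (rule B(2)) simp
  have upper: "(\<Sum>d<2 * L. (norm (\<Sum>j<2 * L - d. a (j + d) * cnj (a j)))\<^sup>2) \<le>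
      (\<eta> * (2 * L))\<^sup>2 * (\<Sum>j<2 * L. (norm (a j))\<^sup>2)"
  proof (rule correlation_energy_le)
    fix z :: complex assume "norm z = 1"
    then have "norm (\<Sum>j<M * (2 * n). f (real j / M) * z ^ j) \<le> \<eta> * (M * (2 * n))"
      using N1[of M "2 * n" z] M n by simp
    then show "norm (\<Sum>j<2 * L. a j * z ^ j) \<le> \<eta> * (2 * L)"
      by (simp add: L_def a_def mult_ac)
  qed (use L in simp)
  also have "\<dots> \<le> (\<eta> * (2 * L))\<^sup>2 * (\<Sum>j<2 * L. B\<^sup>2)"
    by (intro mult_left_mono sum_mono power_mono aB) auto
  also have "\<dots> = (\<eta>\<^sup>2 * B\<^sup>2) * (2 * real L) ^ 3"
    by (simp add: power_mult_distrib power2_eq_square power3_eq_cube)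
  also have "\<dots> = c / 2 * (2 * real L) ^ 3" unfolding \<eta>(2) ..
  also have "\<dots> < c * (2 * real L) ^ 3" using c L by simp
  finally have upper: "(\<Sum>d<2 * L. (norm (\<Sum>j<2 * L - d. a (j + d) * cnj (a j)))\<^sup>2) < c * (2 * real L) ^ 3" .
  have energy: "m / 2 * L \<le> (\<Sum>j<L. (norm (a j))\<^sup>2)"
  proof -
    let ?g = "\<lambda>t. (norm (f t))\<^sup>2"
    have "norm (integral {0..real L * (1 / M)} ?g - (1 / M) *\<^sub>R (\<Sum>j<L. ?g (real j * (1 / M)))) \<le> m / 2 * (real L * (1 / M))"
    proof (rule Riemann_sum_approx)
      show "continuous_on {0..} ?g" by (intro continuous_intros almost_periodic_continuous[OF f])
      show "0 < 1 / real M" using M by simp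
      fix j s assume s: "real j * (1 / M) \<le> s" "s \<le> real j * (1 / M) + 1 / M"
      let ?x = "real j * (1 / M)"
      have s0: "0 \<le> ?x" "0 \<le> s" using s M by (auto intro: order_trans[rotated])
      have "norm (f s - f ?x) \<le> m / (4 * B)" using s s0 Md by (intro d(2)) auto
      then have 1: "\<bar>norm (f s) - norm (f ?x)\<bar> \<le> m / (4 * B)"
        using norm_triangle_ineq3[of "f s" "f ?x"] by linarith
      have "norm (?g s - ?g ?x) = \<bar>norm (f s) - norm (f ?x)\<bar> * (norm (f s) + norm (f ?x))"
        by (simp add: power2_eq_square square_diff_square_factored abs_mult)
      also have "\<dots> \<le> m / (4 * B) * (B + B)"
        using s0 mB by (intro mult_mono 1 add_mono B(2)) auto
      also have "\<dots> = m / 2" using B by simp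
      finally show "norm (?g s - ?g ?x) \<le> m / 2" .
    qed
    moreover have "real L * (1 / M) = n" using M by (simp add: L_def)
    ultimately have "norm (integral {0..real n} ?g - (1 / M) *\<^sub>R (\<Sum>j<L. ?g (real j * (1 / M)))) \<le> m / 2 * n"
      by (simp only:)
    then have "\<bar>integral {0..real n} ?g - (\<Sum>j<L. (norm (a j))\<^sup>2) / M\<bar> \<le> m / 2 * n"
      by (simp add: a_def)
    then have "m / 2 * n \<le> (\<Sum>j<L. (norm (a j))\<^sup>2) / M"
      using m(2)[OF n(2)] by linarith
    then show ?thesis using M by (simp add: L_def field_simps)
  qed
  obtain Q where Q: "Q \<subseteq> {..<L}" "L \<le> q * card Q" "\<And>d y. d \<in> Q \<Longrightarrow> 0 \<le> y \<Longrightarrow> norm (f (y + real d / real M) - f y) \<le> e"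
    using q(2)[OF M(1) L] by blast
  have corr: "m / 4 * L \<le> norm (\<Sum>j<2 * L - d. a (j + d) * cnj (a j))" if d: "d \<in> Q" for d
  proof -
    let ?J = "{..<2 * L - d}"
    have "norm (\<Sum>j\<in>?J. (a (j + d) - a j) * cnj (a j)) \<le> (\<Sum>j\<in>?J. e * B)"
    proof (rule sum_norm_le)
      fix j
      have "norm (a (j + d) - a j) \<le> e"
        using Q(3)[OF d, of "real j / M"] by (simp add: a_def add_divide_distrib)
      then show "norm ((a (j + d) - a j) * cnj (a j)) \<le> e * B"
        unfolding norm_mult using aB[of j] e by (intro mult_mono) auto
    qed
    also have "\<dots> \<le> (2 * L) * (e * B)"
    proof -
      have "real (2 * L - d) \<le> 2 * L" by linarith
      then show ?thesis using e B by (simp add: mult_right_mono)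
    qed
    also have "\<dots> = m / 4 * L" using B by (simp add: e_def)
    finally have 1: "norm (\<Sum>j\<in>?J. (a (j + d) - a j) * cnj (a j)) \<le> m / 4 * L" .
    have "(\<Sum>j<L. (norm (a j))\<^sup>2) \<le> (\<Sum>j\<in>?J. (norm (a j))\<^sup>2)"
      by (rule sum_mono2) (use d Q(1) in auto)
    also have "\<dots> = norm (\<Sum>j\<in>?J. a j * cnj (a j))"
    proof -
      have "(\<Sum>j\<in>?J. a j * cnj (a j)) = complex_of_real (\<Sum>j\<in>?J. (norm (a j))\<^sup>2)"
        by (simp only: of_real_sum complex_norm_square)
      then show ?thesis by (simp add: sum_nonneg del: of_real_sum)
    qed
    finally have 2: "m / 2 * L \<le> norm (\<Sum>j\<in>?J. a j * cnj (a j))" using energy by linarith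
    have "(\<Sum>j\<in>?J. a (j + d) * cnj (a j)) = (\<Sum>j\<in>?J. a j * cnj (a j)) + (\<Sum>j\<in>?J. (a (j + d) - a j) * cnj (a j))"
      by (simp add: algebra_simps flip: sum.distrib)
    then show ?thesis
      using 1 2 norm_diff_ineq[of "\<Sum>j\<in>?J. a j * cnj (a j)" "\<Sum>j\<in>?J. (a (j + d) - a j) * cnj (a j)"]
      by simp
  qed
  have "c * (2 * real L) ^ 3 = (L / q) * (m / 4 * L)\<^sup>2"
    by (simp add: c_def power2_eq_square power3_eq_cube mult_ac)
  also have "\<dots> \<le> card Q * (m / 4 * L)\<^sup>2"
  proof -
    have "real L \<le> real q * card Q" using Q(2) by (metis of_nat_le_iff of_nat_mult)
    then have "L / q \<le> card Q" using q(1) by (simp add: field_simps)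
    then show ?thesis by (rule mult_right_mono) simp
  qed
  also have "\<dots> = (\<Sum>d\<in>Q. (m / 4 * L)\<^sup>2)" by simp
  also have "\<dots> \<le> (\<Sum>d\<in>Q. (norm (\<Sum>j<2 * L - d. a (j + d) * cnj (a j)))\<^sup>2)"
    using m(1) by (intro sum_mono power_mono corr) auto
  also have "\<dots> \<le> (\<Sum>d<2 * L. (norm (\<Sum>j<2 * L - d. a (j + d) * cnj (a j)))\<^sup>2)"
    by (rule sum_mono2) (use Q(1) in auto)
  finally show False using upper by simp
qed

section \<open>Test functions and their translates\<close>

lemma has_vector_derivative_bilinear:
  assumes "bounded_bilinear b"
    and "(f has_vector_derivative f') (at x within S)" "(g has_vector_derivative g') (at x within S)"
  shows "((\<lambda>x. b (f x) (g x)) has_vector_derivative b (f x) g' + b f' (g x)) (at x within S)"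
  using bounded_bilinear.FDERIV[OF assms(1) assms(2,3)[unfolded has_vector_derivative_def]]
  by (simp add: has_vector_derivative_def bounded_bilinear.scaleR_left[OF assms(1)]
      bounded_bilinear.scaleR_right[OF assms(1)] scaleR_add_right)

lemma bounded_bilinear_scaleC: "bounded_bilinear (scaleC :: complex \<Rightarrow> 'a::complex_normed_vector \<Rightarrow> 'a)"
proof
  show "(r *\<^sub>R a) *\<^sub>C b = r *\<^sub>R a *\<^sub>C b" for r a and b :: 'a
    unfolding scaleR_conv_of_real[of r a] scaleC_of_real[symmetric, of r "a *\<^sub>C b"] scaleC_scaleC ..
  show "a *\<^sub>C r *\<^sub>R b = r *\<^sub>R a *\<^sub>C b" for r a and b :: 'a
    by (simp only: scaleC_of_real[symmetric] scaleC_scaleC mult.commute)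
  show "\<exists>K. \<forall>a (b::'a). norm (a *\<^sub>C b) \<le> norm a * norm b * K"
    by (intro exI[of _ 1]) (simp add: norm_scaleC)
qed (simp_all add: scaleC_add_left scaleC_add_right)

lemma smooth_has_vector_derivative:
  assumes "smooth \<phi>"
  shows "((vderiv ^^ n) \<phi> has_vector_derivative (vderiv ^^ Suc n) \<phi> t) (at t)"
  using assms by (simp add: smooth_def vderiv_def vector_derivative_works[symmetric])

lemma smooth_vderiv:
  assumes "smooth \<phi>" shows "smooth (vderiv \<phi>)"
proof -
  have "(vderiv ^^ n) (vderiv \<phi>) = (vderiv ^^ Suc n) \<phi>" for n by (simp add: funpow_swap1)
  then show ?thesis using assms unfolding smooth_def by metis
qed

lemma has_vector_derivative_translate:
  assumes "(\<phi> has_vector_derivative d) (at (t - s))"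
  shows "((\<lambda>t. \<phi> (t - s)) has_vector_derivative d) (at (t::real))"
proof -
  have "((\<phi> \<circ> (\<lambda>t. t - s)) has_vector_derivative 1 *\<^sub>R d) (at t)"
    by (rule vector_diff_chain_at) (auto intro!: derivative_eq_intros assms)
  then show ?thesis by (simp add: o_def)
qed

lemma vderiv_funpow_translate:
  assumes "smooth \<phi>"
  shows "(vderiv ^^ n) (\<lambda>t. \<phi> (t - s)) = (\<lambda>t. (vderiv ^^ n) \<phi> (t - s))"
proof (induction n)
  case (Suc n)
  have "vector_derivative (\<lambda>t. (vderiv ^^ n) \<phi> (t - s)) (at t) = (vderiv ^^ Suc n) \<phi> (t - s)" for t
    by (intro vector_derivative_at has_vector_derivative_translate smooth_has_vector_derivative assms)
  then show ?case by (simp add: Suc.IH vderiv_def[of "\<lambda>t. (vderiv ^^ n) \<phi> (t - s)"])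
qed simp

lemma smooth_translate:
  assumes "smooth \<phi>" shows "smooth (\<lambda>t. \<phi> (t - s))"
  unfolding smooth_def vderiv_funpow_translate[OF assms]
  using has_vector_derivative_translate[OF smooth_has_vector_derivative[OF assms]] differentiableI_vector by blast

lemma supp_translate: "supp (\<lambda>t. \<phi> (t - s)) = (+) s ` supp \<phi>"
proof -
  have "{t. \<phi> (t - s) \<noteq> 0} = (+) s ` {t. \<phi> t \<noteq> 0}"
    by (auto simp: image_iff) (metis add.commute diff_add_cancel)
  then show ?thesis by (simp add: supp_def closure_translation)
qed

lemma vderiv_eq_0_outside_supp:
  assumes "t \<notin> supp \<phi>" shows "vderiv \<phi> t = 0"
proof -
  have "(\<phi> has_vector_derivative 0) (at t)"
  proof (rule has_vector_derivative_transform_within_open[where f = "\<lambda>_. 0"])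
    show "open (- supp \<phi>)" by (simp add: supp_def open_Compl)
    show "0 = \<phi> x" if "x \<in> - supp \<phi>" for x
      using that closure_subset[of "{t. \<phi> t \<noteq> 0}"] by (auto simp: supp_def)
  qed (use assms in auto)
  then show ?thesis by (simp add: vderiv_def vector_derivative_at)
qed

lemma supp_vderiv: "supp (vderiv \<phi>) \<subseteq> supp \<phi>"
proof -
  have "{t. vderiv \<phi> t \<noteq> 0} \<subseteq> supp \<phi>" using vderiv_eq_0_outside_supp by blast
  then show ?thesis unfolding supp_def[of "vderiv \<phi>"] by (rule closure_minimal) (simp add: supp_def)
qed

lemma vderiv_funpow_eq_0_outside_supp: "t \<notin> supp \<phi> \<Longrightarrow> (vderiv ^^ n) \<phi> t = 0"
proof (induction n arbitrary: \<phi>)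
  case 0
  then show ?case using closure_subset[of "{t. \<phi> t \<noteq> 0}"] by (auto simp: supp_def)
next
  case (Suc n)
  then have "t \<notin> supp (vderiv \<phi>)" using supp_vderiv by blast
  then show ?case using Suc.IH by (simp add: funpow_swap1)
qed

lemma test_fun_vderiv: "\<phi> \<in> test_fun \<Longrightarrow> vderiv \<phi> \<in> test_fun"
  using supp_vderiv[of \<phi>] closed_Int_compact[of "supp (vderiv \<phi>)" "supp \<phi>"]
  by (auto simp: test_fun_def smooth_vderiv Int_absorb2 supp_def[of "vderiv \<phi>"])

lemma test_fun0_vderiv: "\<phi> \<in> test_fun0 \<Longrightarrow> vderiv \<phi> \<in> test_fun0"
  using supp_vderiv[of \<phi>] by (auto simp: test_fun0_def test_fun_vderiv)

lemma test_fun_translate: "\<phi> \<in> test_fun \<Longrightarrow> (\<lambda>t. \<phi> (t - s)) \<in> test_fun"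
  by (auto simp: test_fun_def smooth_translate supp_translate intro: compact_translation)

lemma test_fun0_translate: "\<phi> \<in> test_fun0 \<Longrightarrow> 0 \<le> s \<Longrightarrow> (\<lambda>t. \<phi> (t - s)) \<in> test_fun0"
  by (auto simp: test_fun0_def test_fun_translate supp_translate)

lemma test_fun_zero: "(\<lambda>_. 0) \<in> test_fun"
proof -
  have "(vderiv ^^ n) (\<lambda>_. 0) = (\<lambda>_. 0)" for n
    by (induction n) (auto simp: vderiv_def)
  then show ?thesis by (simp add: test_fun_def smooth_def supp_def)
qed

lemma test_fun_derivatives_bounded:
  assumes "\<phi> \<in> test_fun"
  obtains B where "0 < B" "\<And>j t. j \<le> n \<Longrightarrow> cmod ((vderiv ^^ j) \<phi> t) \<le> B"
proof -
  have "\<exists>B. \<forall>t. cmod ((vderiv ^^ j) \<phi> t) \<le> B" for j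
  proof -
    have sm: "smooth \<phi>" and c: "compact (supp \<phi>)" using assms by (auto simp: test_fun_def)
    have "continuous_on (supp \<phi>) ((vderiv ^^ j) \<phi>)"
      using has_vector_derivative_continuous[OF smooth_has_vector_derivative[OF sm]]
      by (simp add: continuous_at_imp_continuous_on)
    then have "bounded ((vderiv ^^ j) \<phi> ` supp \<phi>)"
      using c by (intro compact_imp_bounded compact_continuous_image)
    then obtain B where B: "\<And>t. t \<in> supp \<phi> \<Longrightarrow> cmod ((vderiv ^^ j) \<phi> t) \<le> B"
      by (auto simp: bounded_iff)
    have "cmod ((vderiv ^^ j) \<phi> t) \<le> max B 0" for t
      using B[of t] vderiv_funpow_eq_0_outside_supp[of t \<phi> j] by (cases "t \<in> supp \<phi>") auto
    then show ?thesis by blast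
  qed
  then obtain B where B: "\<And>j t. cmod ((vderiv ^^ j) \<phi> t) \<le> B j" by metis
  show ?thesis
  proof
    have fin: "finite (insert 1 (B ` {..n}))" by simp
    show "0 < Max (insert 1 (B ` {..n}))" by (rule less_le_trans[OF zero_less_one Max_ge[OF fin]]) simp
    show "cmod ((vderiv ^^ j) \<phi> t) \<le> Max (insert 1 (B ` {..n}))" if "j \<le> n" for j t
      by (rule order_trans[OF B Max_ge[OF fin]]) (use that in auto)
  qed
qed

text \<open>The mean value inequality is used for \<open>g'\<close> and then for \<open>g\<close>,
  which gives \<open>B\<close> in place of the sharp \<open>B / 2\<close>; what matters is the order
  \<open>h\<^sup>2\<close>.\<close>

lemma norm_Taylor_1_le:
  fixes g :: "real \<Rightarrow> complex"
  assumes g: "\<And>t. (g has_vector_derivative g' t) (at t)" "\<And>t. (g' has_vector_derivative g'' t) (at t)"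
    and B: "\<And>t. norm (g'' t) \<le> B"
  shows "norm (g (t + h) - g t - h *\<^sub>R g' t) \<le> B * h\<^sup>2"
proof -
  have lip: "norm (g' x - g' y) \<le> B * norm (x - y)" for x y
  proof (rule differentiable_bound[of UNIV g' "\<lambda>x h. h *\<^sub>R g'' x"])
    show "(g' has_derivative (\<lambda>h. h *\<^sub>R g'' x)) (at x within UNIV)" for x
      using g(2) by (simp add: has_vector_derivative_def)
    show "onorm (\<lambda>h. h *\<^sub>R g'' x) \<le> B" for x
      by (rule onorm_le) (simp add: mult_right_mono mult.commute[of _ "norm (g'' x)"] B)
  qed auto
  have B0: "0 \<le> B" using B[of 0] norm_ge_zero order_trans by blast
  have "norm (g (t + h) - g t - ((t + h) - t) *\<^sub>R g' t) \<le> norm ((t + h) - t) * (B * \<bar>h\<bar>)"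
  proof (rule vector_differentiable_bound_linearization[where S = "closed_segment t (t + h)"])
    show "(g has_vector_derivative g' x) (at x within closed_segment t (t + h))" for x
      using g(1) by (rule has_vector_derivative_at_within)
    show "norm (g' x - g' t) \<le> B * \<bar>h\<bar>" if "x \<in> closed_segment t (t + h)" for x
    proof -
      have "norm (x - t) \<le> \<bar>h\<bar>" using that by (auto simp: closed_segment_eq_real_ivl split: if_splits)
      then show ?thesis using order_trans[OF lip mult_left_mono[OF _ B0]] by blast
    qed
  qed auto
  then show ?thesis by (simp add: power2_eq_square abs_mult_self_eq mult_ac flip: abs_mult)
qed

section \<open>Differentiability along translations\<close>

text \<open>Continuity supplies a basic neighbourhood of zero mapped into the unit ball; among test
  functions on \<open>K\<close> it contains a seminorm ball of radius \<open>d\<close>, and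
  homogeneity turns this into an estimate with constant \<open>1 / d\<close>.\<close>

lemma op_distribution0_bound:
  assumes G: "op_distribution0 G" and K: "compact K"
  obtains m c where "0 < c" "\<And>\<phi> e. \<phi> \<in> test_fun_on K \<Longrightarrow> 0 < e \<Longrightarrow>
    (\<And>j t. j \<le> m \<Longrightarrow> cmod ((vderiv ^^ j) \<phi> t) \<le> e) \<Longrightarrow> norm (G \<phi>) \<le> c * e"
proof -
  have lin: "G (\<lambda>t. a * \<phi> t + b * \<psi> t) x = a *\<^sub>C G \<phi> x + b *\<^sub>C G \<psi> x"
    if "\<phi> \<in> test_fun" "\<psi> \<in> test_fun" for \<phi> \<psi> a b x
    using G that by (auto simp: op_distribution0_def)
  define U where "U = {\<phi> \<in> test_fun. G \<phi> \<in> ball 0 1}"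
  have "openin test_topology U"
    using openin_continuous_map_preimage[of test_topology euclidean G "ball 0 1"] G
    by (simp add: U_def op_distribution0_def)
  moreover have "G (\<lambda>_. 0) = 0"
    using lin[OF test_fun_zero test_fun_zero, of 0 0] by (intro blinfun_eqI) simp
  then have "(\<lambda>_. 0) \<in> U" by (simp add: U_def test_fun_zero)
  ultimately obtain V where V: "V \<in> zero_base" "\<forall>\<psi>\<in>V. (\<lambda>t. 0 + \<psi> t) \<in> U"
    unfolding openin_test_topology by meson
  then have "zero_nbhd_on K V" using K by (auto simp: zero_base_def)
  then obtain m d where d: "0 < d"
    "\<And>\<phi>. \<phi> \<in> test_fun_on K \<Longrightarrow> (\<forall>j\<le>m. \<forall>t. cmod ((vderiv ^^ j) \<phi> t) \<le> d) \<Longrightarrow> \<phi> \<in> V"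
    unfolding zero_nbhd_on_def by blast
  show ?thesis
  proof
    show "0 < 1 / d" using d by simp
    fix \<phi> and e :: real
    assume \<phi>: "\<phi> \<in> test_fun_on K" and e: "0 < e"
      and small: "\<And>j t. j \<le> m \<Longrightarrow> cmod ((vderiv ^^ j) \<phi> t) \<le> e"
    \<comment> \<open>The summand \<open>0 * \<phi> t\<close> only gives \<open>\<psi>\<close> the
      shape of the lemmas on linear combinations.\<close>
    define \<psi> where "\<psi> = (\<lambda>t. complex_of_real (d / e) * \<phi> t + 0 * \<phi> t)"
    have t: "\<phi> \<in> test_fun" "supp \<phi> \<subseteq> K" "smooth \<phi>" using \<phi> by (auto simp: test_fun_on_def test_fun_def)
    have "\<psi> \<in> test_fun" unfolding \<psi>_def by (rule test_fun_lincomb[OF t(1) t(1)])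
    moreover have "supp \<psi> \<subseteq> supp \<phi>"
      unfolding supp_def \<psi>_def by (rule closure_mono) auto
    ultimately have "\<psi> \<in> test_fun_on K" using t(2) by (auto simp: test_fun_on_def)
    moreover have "cmod ((vderiv ^^ j) \<psi> t) \<le> d" if "j \<le> m" for j t
    proof -
      have "(vderiv ^^ j) \<psi> t = complex_of_real (d / e) * (vderiv ^^ j) \<phi> t"
        by (simp only: \<psi>_def vderiv_funpow_lincomb[OF t(3) t(3)]) simp
      then have "cmod ((vderiv ^^ j) \<psi> t) = d / e * cmod ((vderiv ^^ j) \<phi> t)"
        using d e by (simp add: norm_mult norm_divide)
      also have "\<dots> \<le> d / e * e" using small[OF that] d e by (intro mult_left_mono) auto
      finally show ?thesis using e by simp
    qed
    ultimately have "\<psi> \<in> V" by (intro d(2)) auto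
    then have "norm (G \<psi>) < 1" using V(2) by (auto simp: U_def)
    moreover have "G \<psi> = (d / e) *\<^sub>R G \<phi>"
      by (rule blinfun_eqI) (simp only: \<psi>_def lin[OF t(1) t(1)], simp add: scaleC_of_real scaleR_blinfun.rep_eq del: of_real_divide)
    ultimately show "norm (G \<phi>) \<le> 1 / d * e" using d e by (simp add: field_simps)
  qed
qed

text \<open>For test functions on one compact set, \<open>G\<close> is controlled by finitely many
  derivatives, and each of these derivatives of the first-order remainder \<open>\<omega>\<close> is
  a Taylor remainder of a derivative of \<open>\<phi>\<close>, hence of order
  \<open>(r - s)\<^sup>2\<close>. The derivative thus exists in operator norm.\<close>

lemma translate_has_vector_derivative:
  assumes G: "op_distribution0 G" and \<phi>: "\<phi> \<in> test_fun"
  shows "((\<lambda>s. G (\<lambda>t. \<phi> (t - s))) has_vector_derivative - G (\<lambda>t. vderiv \<phi> (t - s))) (at s)"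
proof -
  have lin: "G (\<lambda>t. a * \<phi> t + b * \<psi> t) x = a *\<^sub>C G \<phi> x + b *\<^sub>C G \<psi> x"
    if "\<phi> \<in> test_fun" "\<psi> \<in> test_fun" for \<phi> \<psi> a b x
    using G that by (auto simp: op_distribution0_def)
  have sm: "smooth \<phi>" and "compact (supp \<phi>)" using \<phi> by (auto simp: test_fun_def)
  then obtain b where b: "supp \<phi> \<subseteq> {-b..b}" 
    by (metis bounded_subset_cbox_symmetric compact_imp_bounded box_real(2))
  \<comment> \<open>Contains the supports of all translates of \<open>\<phi>\<close> by
    \<open>r\<close> with \<open>\<bar>r - s\<bar> < 1\<close>.\<close>
  define K where "K = {- b - \<bar>s\<bar> - 1..b + \<bar>s\<bar> + 1}"
  have "compact K" by (simp add: K_def)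
  obtain m c where c: "0 < c" "\<And>\<phi> e. \<phi> \<in> test_fun_on K \<Longrightarrow> 0 < e \<Longrightarrow>
      (\<And>j t. j \<le> m \<Longrightarrow> cmod ((vderiv ^^ j) \<phi> t) \<le> e) \<Longrightarrow> norm (G \<phi>) \<le> c * e"
    using op_distribution0_bound[OF G \<open>compact K\<close>] by metis
  \<comment> \<open>The Taylor remainder of the derivative of order \<open>m\<close> involves two
    further orders.\<close>
  obtain B where B: "0 < B" "\<And>j t. j \<le> m + 2 \<Longrightarrow> cmod ((vderiv ^^ j) \<phi> t) \<le> B"
    using test_fun_derivatives_bounded[OF \<phi>] by blast
  have main: "norm (G (\<lambda>t. \<phi> (t - r)) - G (\<lambda>t. \<phi> (t - s)) - (r - s) *\<^sub>R - G (\<lambda>t. vderiv \<phi> (t - s))) \<le> c * (B * (r - s)\<^sup>2)"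
    if r: "r \<noteq> s" "\<bar>r - s\<bar> < 1" for r
  proof -
    define h where "h = r - s"
    define \<omega> where "\<omega> = (\<lambda>t. 1 * (1 * \<phi> (t - r) + (- 1) * \<phi> (t - s)) + complex_of_real h * vderiv \<phi> (t - s))"
    note tf = test_fun_translate[OF \<phi>] test_fun_translate[OF test_fun_vderiv[OF \<phi>]]
    note sms = smooth_translate[OF sm] smooth_translate[OF smooth_vderiv[OF sm]]
    have inner: "(\<lambda>t. 1 * \<phi> (t - r) + (- 1) * \<phi> (t - s)) \<in> test_fun"
      by (rule test_fun_lincomb[OF tf(1) tf(1)])
    have \<omega>: "\<omega> \<in> test_fun" unfolding \<omega>_def by (rule test_fun_lincomb[OF inner tf(2)])
    have G\<omega>: "G \<omega> = G (\<lambda>t. \<phi> (t - r)) - G (\<lambda>t. \<phi> (t - s)) - h *\<^sub>R - G (\<lambda>t. vderiv \<phi> (t - s))"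
    proof (rule blinfun_eqI)
      fix x
      have "G \<omega> x = 1 *\<^sub>C (1 *\<^sub>C G (\<lambda>t. \<phi> (t - r)) x + (- 1) *\<^sub>C G (\<lambda>t. \<phi> (t - s)) x)
          + complex_of_real h *\<^sub>C G (\<lambda>t. vderiv \<phi> (t - s)) x"
        unfolding \<omega>_def lin[OF inner tf(2)] lin[OF tf(1) tf(1)] ..
      then show "G \<omega> x = (G (\<lambda>t. \<phi> (t - r)) - G (\<lambda>t. \<phi> (t - s)) - h *\<^sub>R - G (\<lambda>t. vderiv \<phi> (t - s))) x"
        by (simp add: scaleC_of_real blinfun.bilinear_simps)
    qed
    have "supp \<omega> \<subseteq> K"
    proof -
      have "t \<in> K" if "\<omega> t \<noteq> 0" for t
      proof (rule ccontr)
        assume "t \<notin> K"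
        have "t \<in> K" if "x \<in> {-b..b}" "t = x + s \<or> t = x + r" for x
          using that r(2) abs_ge_self[of s] abs_ge_minus_self[of s] unfolding K_def by auto
        then have "t - r \<notin> supp \<phi>" "t - s \<notin> supp \<phi>"
          using b \<open>t \<notin> K\<close> by force+
        then have "\<omega> t = 0"
          using vderiv_funpow_eq_0_outside_supp[of "t - r" \<phi> 0] vderiv_funpow_eq_0_outside_supp[of "t - s" \<phi> 0]
            vderiv_eq_0_outside_supp[of "t - s" \<phi>] by (simp add: \<omega>_def)
        then show False using that by simp
      qed
      then show ?thesis unfolding supp_def by (intro closure_minimal) (auto simp: K_def)
    qed
    then have \<omega>K: "\<omega> \<in> test_fun_on K" using \<omega> by (simp add: test_fun_on_def)
    have "cmod ((vderiv ^^ j) \<omega> t) \<le> B * h\<^sup>2" if "j \<le> m" for j t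
    proof -
      have smi: "smooth (\<lambda>t. 1 * \<phi> (t - r) + (- 1) * \<phi> (t - s))" using inner by (simp add: test_fun_def)
      have "(vderiv ^^ j) \<omega> t = (vderiv ^^ j) \<phi> (t - r) - (vderiv ^^ j) \<phi> (t - s) + h * (vderiv ^^ Suc j) \<phi> (t - s)"
        unfolding \<omega>_def vderiv_funpow_lincomb[OF smi sms(2)] vderiv_funpow_lincomb[OF sms(1) sms(1)]
          vderiv_funpow_translate[OF sm] vderiv_funpow_translate[OF smooth_vderiv[OF sm]]
        by (simp add: funpow_swap1)
      also have "\<dots> = (vderiv ^^ j) \<phi> ((t - s) + (- h)) - (vderiv ^^ j) \<phi> (t - s) - (- h) *\<^sub>R (vderiv ^^ Suc j) \<phi> (t - s)"
        by (simp add: h_def scaleR_conv_of_real algebra_simps)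
      also have "cmod \<dots> \<le> B * (- h)\<^sup>2"
        by (rule norm_Taylor_1_le[OF smooth_has_vector_derivative[OF sm] smooth_has_vector_derivative[OF sm]])
          (use that in \<open>intro B(2), simp\<close>)
      finally show ?thesis by simp
    qed
    then have "norm (G \<omega>) \<le> c * (B * h\<^sup>2)"
      using r B by (intro c(2)[OF \<omega>K]) (auto simp: h_def)
    then show ?thesis by (simp only: G\<omega> h_def)
  qed
  show ?thesis
    unfolding has_vector_derivative_def
  proof (rule has_derivativeI_sandwich[of 1 _ _ _ _ "\<lambda>r. c * (B * \<bar>r - s\<bar>)"])
    show "bounded_linear (\<lambda>x. x *\<^sub>R - G (\<lambda>t. vderiv \<phi> (t - s)))" by (rule bounded_linear_scaleR_left)
    show "((\<lambda>r. c * (B * \<bar>r - s\<bar>)) \<longlongrightarrow> 0) (at s)" by (auto intro!: tendsto_eq_intros)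
    show "norm (G (\<lambda>t. \<phi> (t - r)) - G (\<lambda>t. \<phi> (t - s)) - (r - s) *\<^sub>R - G (\<lambda>t. vderiv \<phi> (t - s))) / norm (r - s) \<le> c * (B * \<bar>r - s\<bar>)"
      if "r \<noteq> s" "dist r s < 1" for r
    proof -
      have "c * (B * (r - s)\<^sup>2) = c * (B * \<bar>r - s\<bar>) * norm (r - s)" by (simp add: power2_eq_square)
      then show ?thesis
        using main[of r] that by (intro mult_imp_div_pos_le) (auto simp: dist_real_def)
    qed
  qed simp
qed

section \<open>Mild solutions and the generator\<close>

lemma C_distribution_semigroup_op: "C_distribution_semigroup C G \<Longrightarrow> op_distribution0 G"
  by (simp add: C_distribution_semigroup_def)

lemma op_distribution0_scaleC:
  assumes "op_distribution0 G" "\<phi> \<in> test_fun"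
  shows "G \<phi> (c *\<^sub>C x) = c *\<^sub>C G \<phi> x"
  using assms by (auto simp: op_distribution0_def clinear_ops_def bounded_clinear_def)

lemma op_distribution0_minus:
  assumes G: "op_distribution0 G" and \<phi>: "\<phi> \<in> test_fun"
  shows "G (\<lambda>t. - \<phi> t) x = - G \<phi> x"
proof -
  have "G (\<lambda>t. (- 1) * \<phi> t + 0 * \<phi> t) x = (- 1) *\<^sub>C G \<phi> x + 0 *\<^sub>C G \<phi> x"
    using G \<phi> unfolding op_distribution0_def by blast
  then show ?thesis by simp
qed

lemma mem_generator_iff:
  assumes G: "op_distribution0 G"
  shows "(x, y) \<in> generator G \<longleftrightarrow> (\<forall>\<phi>\<in>test_fun0. - G (vderiv \<phi>) x = G \<phi> y)"
proof -
  have "G (dist_conv (\<lambda>\<psi>. - dist_deriv (delta 0) \<psi>) \<phi>) x = - G (vderiv \<phi>) x" if "\<phi> \<in> test_fun0" for \<phi>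
    using that by (simp add: test_fun0_def test_fun_def dist_conv_minus_delta_deriv
        op_distribution0_minus[OF G test_fun_vderiv])
  then show ?thesis by (simp add: generator_def dist_op_def)
qed

lemma generator_zero: "op_distribution0 G \<Longrightarrow> (0, 0) \<in> generator G"
  by (simp add: mem_generator_iff)

lemma generator_add:
  "op_distribution0 G \<Longrightarrow> (x, y) \<in> generator G \<Longrightarrow> (x', y') \<in> generator G \<Longrightarrow> (x + x', y + y') \<in> generator G"
  by (simp add: mem_generator_iff blinfun.add_right)

lemma generator_scaleC:
  assumes "op_distribution0 G" "(x, y) \<in> generator G"
  shows "(c *\<^sub>C x, c *\<^sub>C y) \<in> generator G"
  using assms by (auto simp: mem_generator_iff op_distribution0_scaleC test_fun0_def test_fun_vderiv
      simp flip: complex_vector.scale_minus_right)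

text \<open>The derivative of \<open>s \<mapsto> G (\<phi> (\<cdot> - (t - s))) (\<integral>\<^sub>0\<^sup>s u)\<close> collapses to that of
  \<open>s \<mapsto> - \<integral>\<^sub>0\<^sup>t\<^sup>-\<^sup>s G (\<phi> (\<cdot> - r)) x dr\<close>.\<close>

lemma mild_solution_translate:
  assumes G: "op_distribution0 G"
    and u: "continuous_on {0..} u" "\<And>t. 0 \<le> t \<Longrightarrow> (integral {0..t} u, u t - x) \<in> generator G"
    and \<phi>: "\<phi> \<in> test_fun0" and t: "0 \<le> t"
  shows "G (\<lambda>s. \<phi> (s - t)) x = G \<phi> (u t)"
proof -
  have \<phi>t: "\<phi> \<in> test_fun" using \<phi> by (simp add: test_fun0_def)
  define F where "F s = G (\<lambda>r. \<phi> (r - s))" for s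
  define F' where "F' s = G (\<lambda>r. vderiv \<phi> (r - s))" for s
  define U where "U s = integral {0..s} u" for s
  define Q where "Q s = integral {0..s} (\<lambda>r. F r x)" for s
  have F: "(F has_vector_derivative - F' s) (at s within S)" for s S
    unfolding F_def F'_def
    by (rule has_vector_derivative_at_within[OF translate_has_vector_derivative[OF G \<phi>t]])
  have U: "(U has_vector_derivative u s) (at s within {0..b})" if "s \<in> {0..b}" for s b
    unfolding U_def by (rule integral_has_vector_derivative[OF continuous_on_subset[OF u(1)] that]) auto
  have contF: "continuous_on S (\<lambda>r. F r x)" for S
    using has_vector_derivative_continuous[OF F[of _ UNIV]]
    by (intro continuous_intros continuous_at_imp_continuous_on ballI) auto
  have Q: "(Q has_vector_derivative F s x) (at s within {0..b})" if "s \<in> {0..b}" for s b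
    unfolding Q_def by (rule integral_has_vector_derivative[OF contF that])
  have FU: "F 0 (U b) = Q b" if b: "0 \<le> b" for b
  proof -
    \<comment> \<open>Its end values are \<open>h b = F 0 (U b)\<close> and
      \<open>h 0 = Q b\<close>, as \<open>U 0\<close> and \<open>Q 0\<close> vanish;
      \<open>b - s \<ge> 0\<close> keeps the translated test function in
      \<open>test_fun0\<close>.\<close>
    define h where "h s = F (b - s) (U s) + Q (b - s)" for s
    have "(h has_vector_derivative 0) (at s within {0..b})" if s: "s \<in> {0..b}" for s
    proof -
      have refl: "((\<lambda>s. b - s) has_vector_derivative - 1) (at s within {0..b})"
        by (auto intro!: derivative_eq_intros)
      have im: "(\<lambda>s. b - s) ` {0..b} = {0..b}"
        by (auto simp: image_iff intro: bexI[of _ "b - _"])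
      have "((F \<circ> (\<lambda>s. b - s)) has_vector_derivative (- 1) *\<^sub>R - F' (b - s)) (at s within {0..b})"
        by (rule vector_diff_chain_within[OF refl F])
      then have 1: "((\<lambda>s. F (b - s)) has_vector_derivative F' (b - s)) (at s within {0..b})"
        by (simp add: o_def)
      have "((Q \<circ> (\<lambda>s. b - s)) has_vector_derivative (- 1) *\<^sub>R F (b - s) x) (at s within {0..b})"
        by (rule vector_diff_chain_within[OF refl]) (unfold im, rule Q, use s in auto)
      then have 2: "((\<lambda>s. Q (b - s)) has_vector_derivative - F (b - s) x) (at s within {0..b})"
        by (simp add: o_def)
      have "(h has_vector_derivative (F (b - s) (u s) + F' (b - s) (U s)) + - F (b - s) x) (at s within {0..b})"
        unfolding h_def
        by (intro has_vector_derivative_add 2 has_vector_derivative_bilinear[OF bounded_bilinear_blinfun_apply 1 U[OF s]])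
      moreover have "- F' (b - s) (U s) = F (b - s) (u s - x)"
      proof -
        have "vderiv (\<lambda>r. \<phi> (r - (b - s))) = (\<lambda>r. vderiv \<phi> (r - (b - s)))"
          using vderiv_funpow_translate[of \<phi> 1] \<phi>t by (simp add: test_fun_def)
        then show ?thesis
          using u(2)[of s] s test_fun0_translate[OF \<phi>, of "b - s"]
          unfolding mem_generator_iff[OF G] F_def F'_def U_def by force
      qed
      ultimately show ?thesis by (simp add: blinfun.diff_right algebra_simps)
    qed
    then obtain c where "\<And>s. s \<in> {0..b} \<Longrightarrow> h s = c"
      using has_vector_derivative_zero_constant[of "{0..b}" h] by (metis convex_closed_interval convex_real_interval(5))
    then have "h b = h 0" using b by simp
    then show ?thesis by (simp add: h_def U_def Q_def)
  qed
  \<comment> \<open>The identity \<open>F 0 (U s) = Q s\<close> is differentiated at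
    \<open>t\<close> in two ways. The interval extends to \<open>t + 1\<close> so that it is
    nondegenerate also for \<open>t = 0\<close>.\<close>
  have "((\<lambda>s. F 0 (U s)) has_vector_derivative F 0 (u t)) (at t within {0..t + 1})"
    by (rule bounded_linear.has_vector_derivative[OF blinfun.bounded_linear_right U]) (use t in auto)
  moreover have "((\<lambda>s. F 0 (U s)) has_vector_derivative F t x) (at t within {0..t + 1})"
    by (rule has_vector_derivative_transform[OF _ _ Q]) (use t FU in auto)
  ultimately have "F 0 (u t) = F t x"
    by (intro vector_derivative_unique_within_closed_interval[of 0 "t + 1" t]) (use t in auto)
  then show ?thesis by (simp add: F_def)
qed

lemma C_distribution_semigroup_eqI:
  assumes "C_distribution_semigroup C G" "\<And>\<phi>. \<phi> \<in> test_fun0 \<Longrightarrow> G \<phi> x = G \<phi> y"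
  shows "x = y"
proof -
  have "x - y \<in> (\<Inter>\<phi>\<in>test_fun0. {x. G \<phi> x = 0})" using assms(2) by (simp add: blinfun.diff_right)
  also have "\<dots> = {0}" using assms(1) by (simp only: C_distribution_semigroup_def)
  finally show ?thesis by simp
qed

text \<open>The translation formula for mild solutions puts \<open>u t\<close> into the graph, and
  since the operators \<open>G \<phi>\<close> with \<open>\<phi>\<close> in \<open>test_fun0\<close>
  have trivial common kernel, no other value is possible.\<close>

lemma op_app_delta:
  assumes G: "C_distribution_semigroup C G"
    and u: "continuous_on {0..} u" "\<And>t. 0 \<le> t \<Longrightarrow> (integral {0..t} u, u t - x) \<in> generator G"
    and t: "0 \<le> t"
  shows "op_app (dist_op G (delta t)) x = u t"
  unfolding op_app_def
proof (rule the_equality)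
  have sol: "G (\<lambda>s. \<phi> (s - t)) x = G \<phi> (u t)" if "\<phi> \<in> test_fun0" for \<phi>
    by (rule mild_solution_translate[OF C_distribution_semigroup_op[OF G] u that t])
  show "(x, u t) \<in> dist_op G (delta t)"
    using sol by (simp add: dist_op_def dist_conv_delta)
  fix y assume y: "(x, y) \<in> dist_op G (delta t)"
  show "y = u t"
  proof (rule C_distribution_semigroup_eqI[OF G])
    fix \<phi> assume \<phi>: "\<phi> \<in> test_fun0"
    then have "G (\<lambda>s. \<phi> (s - t)) x = G \<phi> y" using y by (simp add: dist_op_def dist_conv_delta)
    then show "G \<phi> y = G \<phi> (u t)" using sol[OF \<phi>] by simp
  qed
qed

lemma cis_has_vector_derivative:
  "((\<lambda>t. cis (r * t)) has_vector_derivative (\<i> * complex_of_real r) * cis (r * t)) (at t within S)"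
proof -
  have "((\<lambda>t. Complex (cos (r * t)) (sin (r * t))) has_vector_derivative Complex (- r * sin (r * t)) (r * cos (r * t))) (at t within S)"
    unfolding has_vector_derivative_complex_iff by (auto intro!: derivative_eq_intros)
  moreover have "Complex (- r * sin (r * t)) (r * cos (r * t)) = (\<i> * complex_of_real r) * cis (r * t)"
    by (simp add: complex_eq_iff)
  ultimately show ?thesis by (simp add: cis.code)
qed

lemma continuous_on_scaleC [continuous_intros]:
  fixes g :: "_ \<Rightarrow> 'a::complex_normed_vector"
  assumes "continuous_on S f" "continuous_on S g"
  shows "continuous_on S (\<lambda>t. f t *\<^sub>C g t)"
  by (rule bounded_bilinear.continuous_on[OF bounded_bilinear_scaleC assms])

text \<open>Formally an integration by parts. As \<open>u s\<close> need not lie in the domain of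
  the generator, it is carried out on \<open>w s\<close>, which equals
  \<open>cis (- r * s) *\<^sub>C G \<phi> (u s)\<close> and is differentiable because translation of
  \<open>\<phi>\<close> is; its end values give the boundary terms.\<close>

lemma modulated_integral_mem_generator:
  fixes r T :: real
  assumes G: "op_distribution0 G"
    and u: "continuous_on {0..} u" "\<And>t. 0 \<le> t \<Longrightarrow> (integral {0..t} u, u t - x) \<in> generator G"
    and T: "0 \<le> T"
  defines "Y \<equiv> integral {0..T} (\<lambda>s. cis (- r * s) *\<^sub>C u s)"
  shows "(Y, cis (- r * T) *\<^sub>C u T - x + (\<i> * r) *\<^sub>C Y) \<in> generator G"
  unfolding mem_generator_iff[OF G]
proof
  fix \<phi> assume \<phi>: "\<phi> \<in> test_fun0"
  then have \<phi>t: "\<phi> \<in> test_fun" by (simp add: test_fun0_def)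
  let ?v = "\<lambda>s. cis (- r * s) *\<^sub>C u s"
  define w where "w s = cis (- r * s) *\<^sub>C G (\<lambda>t. \<phi> (t - s)) x" for s
  have v: "?v integrable_on {0..T}"
    by (rule integrable_on_halfline) (auto intro!: continuous_intros u)
  have "((\<lambda>s. - G (vderiv \<phi>) (?v s) - G \<phi> ((\<i> * r) *\<^sub>C ?v s)) has_integral w T - w 0) {0..T}"
  proof (rule fundamental_theorem_of_calculus[OF T])
    fix s assume s: "s \<in> {0..T}"
    have F: "((\<lambda>s. G (\<lambda>t. \<phi> (t - s)) x) has_vector_derivative - G (\<lambda>t. vderiv \<phi> (t - s)) x) (at s within {0..T})"
      using bounded_linear.has_vector_derivative[OF blinfun.bounded_linear_left
          has_vector_derivative_at_within[OF translate_has_vector_derivative[OF G \<phi>t, of s]], of x]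
      by (simp add: blinfun.minus_left)
    have "(w has_vector_derivative cis (- r * s) *\<^sub>C (- G (\<lambda>t. vderiv \<phi> (t - s)) x)
        + ((\<i> * complex_of_real (- r)) * cis (- r * s)) *\<^sub>C G (\<lambda>t. \<phi> (t - s)) x) (at s within {0..T})"
      unfolding w_def by (rule has_vector_derivative_bilinear[OF bounded_bilinear_scaleC cis_has_vector_derivative F])
    \<comment> \<open>\<open>vderiv \<phi>\<close> is again in \<open>test_fun0\<close>, so the
      translation formula covers the derivative term as well.\<close>
    moreover have "G (\<lambda>t. vderiv \<phi> (t - s)) x = G (vderiv \<phi>) (u s)" "G (\<lambda>t. \<phi> (t - s)) x = G \<phi> (u s)"
      using mild_solution_translate[OF G u] test_fun0_vderiv[OF \<phi>] \<phi> s by auto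
    ultimately show "(w has_vector_derivative - G (vderiv \<phi>) (?v s) - G \<phi> ((\<i> * r) *\<^sub>C ?v s)) (at s within {0..T})"
      by (simp add: op_distribution0_scaleC[OF G] \<phi>t test_fun_vderiv scaleC_scaleC)
  qed
  moreover have "((\<lambda>s. - G (vderiv \<phi>) (?v s) - G \<phi> ((\<i> * r) *\<^sub>C ?v s)) has_integral - G (vderiv \<phi>) Y - G \<phi> ((\<i> * r) *\<^sub>C Y)) {0..T}"
    unfolding Y_def
    using has_integral_linear[OF integrable_integral[OF v] blinfun.bounded_linear_right[of "G (vderiv \<phi>)"]]
      has_integral_linear[OF has_integral_linear[OF integrable_integral[OF v]
          bounded_bilinear.bounded_linear_right[OF bounded_bilinear_scaleC, of "\<i> * r"]]
        blinfun.bounded_linear_right[of "G \<phi>"]]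
    by (intro has_integral_diff has_integral_neg) (simp_all add: o_def)
  ultimately have "w T - w 0 = - G (vderiv \<phi>) Y - G \<phi> ((\<i> * r) *\<^sub>C Y)"
    by (rule has_integral_unique)
  moreover have "w T = G \<phi> (cis (- r * T) *\<^sub>C u T)" "w 0 = G \<phi> x"
    using mild_solution_translate[OF G u \<phi> T] by (simp_all add: w_def op_distribution0_scaleC[OF G] \<phi>t)
  ultimately show "- G (vderiv \<phi>) Y = G \<phi> (cis (- r * T) *\<^sub>C u T - x + (\<i> * r) *\<^sub>C Y)"
    by (simp add: blinfun.add_right blinfun.diff_right algebra_simps)
qed

section \<open>Eigenvectors and trigonometric polynomials\<close>

text \<open>Induction on the set of frequencies: \<open>common_representatives\<close> joins a net
  for the earlier ones with a net of the circle for the new one.\<close>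

lemma cis_joint_net:
  fixes r :: "'b \<Rightarrow> real"
  assumes "finite F" "0 < e"
  obtains T where "finite T" "T \<subseteq> {0..}"
    "\<And>s. 0 \<le> s \<Longrightarrow> \<exists>p\<in>T. \<forall>v\<in>F. norm (cis (r v * s) - cis (r v * p)) \<le> e"
proof -
  have "\<exists>T. finite T \<and> T \<subseteq> {0..} \<and> (\<forall>s\<ge>0. \<exists>p\<in>T. \<forall>v\<in>F. norm (cis (r v * s) - cis (r v * p)) \<le> e)"
    if "0 < e" for e
    using assms(1) that
  proof (induction F arbitrary: e)
    case empty
    then show ?case by (intro exI[of _ "{0}"]) auto
  next
    case (insert w F)
    obtain P where P: "finite P" "\<And>s. s \<in> {0..} \<Longrightarrow> \<exists>p\<in>P. \<forall>v\<in>F. norm (cis (r v * s) - cis (r v * p)) \<le> e / 2"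
      using insert.IH[of "e / 2"] insert.prems by (auto simp: half_gt_zero)
    obtain Q where Q: "finite Q" "\<And>x. \<exists>q\<in>Q. norm (cis x - q) < e / 2"
      using circle_net[of "e / 2"] insert.prems by auto
    have Q': "\<exists>q\<in>Q. norm (cis (r w * s) - q) < e / 2" if "s \<in> {0..}" for s by (rule Q(2))
    obtain T where T: "finite T" "T \<subseteq> {0..}" and rep: "\<And>s. s \<in> {0..} \<Longrightarrow> \<exists>t\<in>T.
        (\<exists>p\<in>P. (\<forall>v\<in>F. norm (cis (r v * s) - cis (r v * p)) \<le> e / 2) \<and> (\<forall>v\<in>F. norm (cis (r v * t) - cis (r v * p)) \<le> e / 2)) \<and>
        (\<exists>q\<in>Q. norm (cis (r w * s) - q) < e / 2 \<and> norm (cis (r w * t) - q) < e / 2)"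
      by (rule common_representatives[where R = "\<lambda>s p. \<forall>v\<in>F. norm (cis (r v * s) - cis (r v * p)) \<le> e / 2"
          and S = "\<lambda>s q. norm (cis (r w * s) - q) < e / 2" and A = "{0..}", OF P Q(1) Q']) (assumption, assumption, rule that)
    have "\<exists>p\<in>T. \<forall>v\<in>insert w F. norm (cis (r v * s) - cis (r v * p)) \<le> e" if s: "0 \<le> s" for s
    proof -
      have "s \<in> {0..}" using s by simp
      then obtain t p q where t: "t \<in> T"
        and p: "\<And>v. v \<in> F \<Longrightarrow> norm (cis (r v * s) - cis (r v * p)) \<le> e / 2"
          "\<And>v. v \<in> F \<Longrightarrow> norm (cis (r v * t) - cis (r v * p)) \<le> e / 2"
        and q: "norm (cis (r w * s) - q) < e / 2" "norm (cis (r w * t) - q) < e / 2"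
        using rep by blast
      have "norm (cis (r v * s) - cis (r v * t)) \<le> e" if "v \<in> insert w F" for v
      proof (cases "v = w")
        case True
        then show ?thesis using norm_diff_triangle_less[OF q(1), of "cis (r w * t)" "e / 2"] q(2)
          by (simp add: norm_minus_commute)
      next
        case False
        then have v: "v \<in> F" using that by simp
        show ?thesis
          using norm_diff_triangle_le[OF p(1)[OF v], of "cis (r v * t)" "e / 2"] p(2)[OF v]
          by (simp add: norm_minus_commute)
      qed
      then show ?thesis using t by blast
    qed
    then show ?case using T by blast
  qed
  then show ?thesis using that assms(2) by blast
qed

text \<open>Almost periods arise as differences: at \<open>a + l\<close> all phases nearly agree
  with those at one of finitely many points \<open>p\<close>, so \<open>a + l - p\<close> nearly
  fixes every exponential at once.\<close>

lemma almost_periodic_trig_polynomial: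
  assumes F: "finite F"
  shows "almost_periodic (\<lambda>t. \<Sum>v\<in>F. cis (r v * t) *\<^sub>C (y v :: 'a::complex_banach))"
  unfolding almost_periodic_def
proof (intro conjI allI impI)
  show "continuous_on {0..} (\<lambda>t. \<Sum>v\<in>F. cis (r v * t) *\<^sub>C y v)" by (intro continuous_intros)
  fix e :: real assume e: "0 < e"
  define N where "N = (\<Sum>v\<in>F. norm (y v)) + 1"
  have N: "0 < N" unfolding N_def by (intro add_nonneg_pos sum_nonneg) auto
  then have "0 < e / N" using e by simp
  then obtain T where T: "finite T" "T \<subseteq> {0..}"
    "\<And>s. 0 \<le> s \<Longrightarrow> \<exists>p\<in>T. \<forall>v\<in>F. norm (cis (r v * s) - cis (r v * p)) \<le> e / N"
    using cis_joint_net[OF F] by metis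
  define l where "l = Max (insert 1 T)"
  have "x \<le> l" if "x \<in> insert 1 T" for x
    unfolding l_def by (rule Max_ge) (use T(1) that in auto)
  then have l: "0 < l" "\<And>p. p \<in> T \<Longrightarrow> p \<le> l"
    by (auto intro: less_le_trans[OF zero_less_one])
  show "\<exists>l>0. \<forall>a\<ge>0. \<exists>\<tau>\<in>{a..a + l}. \<forall>t\<ge>0.
    norm ((\<Sum>v\<in>F. cis (r v * (t + \<tau>)) *\<^sub>C y v) - (\<Sum>v\<in>F. cis (r v * t) *\<^sub>C y v)) \<le> e"
  proof (intro exI[of _ l] conjI allI impI l(1))
    fix a :: real assume a: "0 \<le> a"
    then obtain p where p: "p \<in> T" "\<forall>v\<in>F. norm (cis (r v * (a + l)) - cis (r v * p)) \<le> e / N"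
      using T(3)[of "a + l"] l(1) by auto
    \<comment> \<open>Lies in the prescribed window because
      \<open>0 \<le> p \<le> l\<close>.\<close>
    let ?\<tau> = "a + l - p"
    show "\<exists>\<tau>\<in>{a..a + l}. \<forall>t\<ge>0.
      norm ((\<Sum>v\<in>F. cis (r v * (t + \<tau>)) *\<^sub>C y v) - (\<Sum>v\<in>F. cis (r v * t) *\<^sub>C y v)) \<le> e"
    proof (intro bexI[of _ ?\<tau>] allI impI)
      show "?\<tau> \<in> {a..a + l}" using l(2)[OF p(1)] p(1) T(2) by auto
      fix t :: real
      have "(\<Sum>v\<in>F. cis (r v * (t + ?\<tau>)) *\<^sub>C y v) - (\<Sum>v\<in>F. cis (r v * t) *\<^sub>C y v) =
          (\<Sum>v\<in>F. (cis (r v * (t - p)) * (cis (r v * (a + l)) - cis (r v * p))) *\<^sub>C y v)"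
      proof -
        have "cis (r v * (t - p)) * (cis (r v * (a + l)) - cis (r v * p)) = cis (r v * (t + ?\<tau>)) - cis (r v * t)" for v
          by (simp add: right_diff_distrib cis_mult) (simp add: algebra_simps)
        then show ?thesis by (simp only: sum_subtractf[symmetric] complex_vector.scale_left_diff_distrib)
      qed
      also have "norm \<dots> \<le> (\<Sum>v\<in>F. e / N * norm (y v))"
        by (intro sum_norm_le) (use p(2) in \<open>simp only: norm_scaleC norm_mult norm_cis mult_1_left mult_right_mono norm_ge_zero\<close>)
      also have "\<dots> = e / N * (\<Sum>v\<in>F. norm (y v))" by (simp add: sum_distrib_left)
      also have "\<dots> \<le> e / N * N" using e N by (intro mult_left_mono) (auto simp: N_def)
      finally show "norm ((\<Sum>v\<in>F. cis (r v * (t + ?\<tau>)) *\<^sub>C y v) - (\<Sum>v\<in>F. cis (r v * t) *\<^sub>C y v)) \<le> e"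
        using N by simp
    qed
  qed
qed

lemma almost_periodic_transfer:
  assumes "almost_periodic f" and eq: "\<And>t. 0 \<le> t \<Longrightarrow> g t = f t"
  shows "almost_periodic g"
  unfolding almost_periodic_def
proof (intro conjI allI impI)
  show "continuous_on {0..} g"
    using almost_periodic_continuous[OF assms(1)] by (rule continuous_on_eq) (simp add: eq)
  fix e :: real assume "0 < e"
  then obtain l where l: "0 < l"
    "\<And>a. 0 \<le> a \<Longrightarrow> \<exists>\<tau>\<ge>a. \<tau> \<le> a + l \<and> (\<forall>t\<ge>0. norm (f (t + \<tau>) - f t) \<le> e)"
    using almost_period_between[OF assms(1)] by blast
  have "\<exists>\<tau>\<in>{a..a + l}. \<forall>t\<ge>0. norm (g (t + \<tau>) - g t) \<le> e" if a: "0 \<le> a" for a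
  proof -
    obtain \<tau> where "a \<le> \<tau>" "\<tau> \<le> a + l" "\<forall>t\<ge>0. norm (f (t + \<tau>) - f t) \<le> e" using l(2)[OF a] by blast
    then show ?thesis using a by (intro bexI[of _ \<tau>]) (auto simp: eq)
  qed
  then show "\<exists>l>0. \<forall>a\<ge>0. \<exists>\<tau>\<in>{a..a + l}. \<forall>t\<ge>0. norm (g (t + \<tau>) - g t) \<le> e"
    using l(1) by blast
qed

text \<open>The scalar integral \<open>?w\<close> satisfies
  \<open>?w * (\<i> * r) = cis (r * t) - 1\<close> without any division, so \<open>r = 0\<close>
  needs no separate case; scaling the eigenvalue equation by \<open>?w\<close> gives the
  claim.\<close>

lemma eigenvector_mild_solution:
  assumes G: "op_distribution0 G" and v: "(v, (\<i> * complex_of_real r) *\<^sub>C v) \<in> generator G" and t: "0 \<le> t"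
  shows "(integral {0..t} (\<lambda>s. cis (r * s) *\<^sub>C v), cis (r * t) *\<^sub>C v - v) \<in> generator G"
proof -
  let ?w = "integral {0..t} (\<lambda>s. cis (r * s))"
  have int: "(\<lambda>s. cis (r * s)) integrable_on {0..t}"
    by (intro integrable_continuous_real continuous_intros)
  have "((\<lambda>s. (\<i> * complex_of_real r) * cis (r * s)) has_integral cis (r * t) - cis (r * 0)) {0..t}"
    by (rule fundamental_theorem_of_calculus[OF t cis_has_vector_derivative])
  moreover have "((\<lambda>s. (\<i> * complex_of_real r) * cis (r * s)) has_integral (\<i> * complex_of_real r) * ?w) {0..t}"
    by (rule has_integral_mult_right[OF integrable_integral[OF int]])
  ultimately have "cis (r * t) - cis (r * 0) = (\<i> * complex_of_real r) * ?w"
    by (rule has_integral_unique)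
  then have "?w * (\<i> * complex_of_real r) = cis (r * t) - 1" by (simp add: mult.commute)
  moreover have "integral {0..t} (\<lambda>s. cis (r * s) *\<^sub>C v) = ?w *\<^sub>C v"
    using integral_linear[OF int bounded_bilinear.bounded_linear_left[OF bounded_bilinear_scaleC, of v]]
    by (simp add: o_def)
  ultimately show ?thesis
    using generator_scaleC[OF G v, of ?w] by (simp add: scaleC_scaleC complex_vector.scale_left_diff_distrib)
qed

lemma trig_polynomial_mild_solution:
  assumes G: "op_distribution0 G" and F: "finite F"
    and ev: "\<And>v. v \<in> F \<Longrightarrow> (v, (\<i> * complex_of_real (r v)) *\<^sub>C v) \<in> generator G" and t: "0 \<le> t"
  shows "(integral {0..t} (\<lambda>s. \<Sum>v\<in>F. cis (r v * s) *\<^sub>C c v *\<^sub>C v),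
    (\<Sum>v\<in>F. cis (r v * t) *\<^sub>C c v *\<^sub>C v) - (\<Sum>v\<in>F. c v *\<^sub>C v)) \<in> generator G"
  using F ev
proof (induction F)
  case empty
  then show ?case by (simp add: generator_zero[OF G])
next
  case (insert w F)
  have "(c w *\<^sub>C w, (\<i> * complex_of_real (r w)) *\<^sub>C c w *\<^sub>C w) \<in> generator G"
    using generator_scaleC[OF G insert.prems[of w], of "c w"] by (simp add: scaleC_scaleC mult_ac)
  note generator_add[OF G eigenvector_mild_solution[OF G this t] insert.IH[OF insert.prems]]
  moreover have "integral {0..t} (\<lambda>s. \<Sum>v\<in>insert w F. cis (r v * s) *\<^sub>C c v *\<^sub>C v) =
      integral {0..t} (\<lambda>s. cis (r w * s) *\<^sub>C c w *\<^sub>C w) + integral {0..t} (\<lambda>s. \<Sum>v\<in>F. cis (r v * s) *\<^sub>C c v *\<^sub>C v)"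
    using insert.hyps
    by (simp, intro Henstock_Kurzweil_Integration.integral_add integrable_continuous_real continuous_intros)
  ultimately show ?case using insert.hyps by (simp add: algebra_simps)
qed

text \<open>The orbit of a combination of eigenvectors is the trigonometric polynomial with the same
  coefficients, which is both a mild solution and almost periodic.\<close>

lemma span_imaginary_eigenvectors:
  assumes G: "C_distribution_semigroup C G" and x: "x \<in> cspan (imaginary_eigenvectors (generator G))"
  shows "x \<in> solution_space (generator G)" "almost_periodic (\<lambda>t. op_app (dist_op G (delta t)) x)"
proof -
  note op = C_distribution_semigroup_op[OF G]
  obtain F c where F: "finite F" "F \<subseteq> imaginary_eigenvectors (generator G)" "x = (\<Sum>v\<in>F. c v *\<^sub>C v)"
    using x unfolding complex_vector.span_explicit by blast
  then have "\<forall>v\<in>F. \<exists>r::real. (v, (\<i> * complex_of_real r) *\<^sub>C v) \<in> generator G"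
    by (auto simp: imaginary_eigenvectors_def)
  then obtain r where r: "\<And>v. v \<in> F \<Longrightarrow> (v, (\<i> * complex_of_real (r v)) *\<^sub>C v) \<in> generator G"
    by metis
  define u where "u t = (\<Sum>v\<in>F. cis (r v * t) *\<^sub>C c v *\<^sub>C v)" for t
  have cont: "continuous_on {0..} u" unfolding u_def by (intro continuous_intros)
  have sol: "(integral {0..t} u, u t - x) \<in> generator G" if "0 \<le> t" for t
    using trig_polynomial_mild_solution[OF op F(1) r that, of c] by (simp add: u_def[abs_def] F(3))
  show "x \<in> solution_space (generator G)" using cont sol by (auto simp: solution_space_def)
  have "almost_periodic u" unfolding u_def by (rule almost_periodic_trig_polynomial[OF F(1)])
  moreover have "op_app (dist_op G (delta t)) x = u t" if "0 \<le> t" for t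
    by (rule op_app_delta[OF G cont sol that])
  ultimately show "almost_periodic (\<lambda>t. op_app (dist_op G (delta t)) x)"
    by (rule almost_periodic_transfer)
qed

section \<open>Totality of the eigenvectors\<close>

lemma cdual_bounded_linear: "f \<in> cdual \<Longrightarrow> bounded_linear f"
  and cdual_scaleC: "f \<in> cdual \<Longrightarrow> f (c *\<^sub>C x) = c * f x"
  by (auto simp: cdual_def bounded_clinear_def scaleC_complex_def)

lemma cdual_compose:
  assumes "f \<in> cdual" "T \<in> clinear_ops"
  shows "(\<lambda>x. f (T x)) \<in> cdual"
  using assms bounded_linear_compose[of f "blinfun_apply T"]
  by (auto simp: cdual_def bounded_clinear_def clinear_ops_def)

lemma csubspace_closure:
  fixes S :: "'a::complex_normed_vector set"
  assumes S: "csubspace S" shows "csubspace (closure S)"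
proof (rule complex_vector.subspaceI)
  show "0 \<in> closure S" using complex_vector.subspace_0[OF S] closure_subset by blast
  fix x y c assume x: "x \<in> closure S"
  then obtain X where X: "\<And>n. X n \<in> S" "X \<longlonglongrightarrow> x" by (auto simp: closure_sequential)
  have "(\<lambda>n. c *\<^sub>C X n) \<longlonglongrightarrow> c *\<^sub>C x"
    by (rule bounded_linear.tendsto[OF bounded_bilinear.bounded_linear_right[OF bounded_bilinear_scaleC] X(2)])
  then show "c *\<^sub>C x \<in> closure S"
    unfolding closure_sequential
    using X complex_vector.subspace_scale[OF S] by (intro exI[of _ "\<lambda>n. c *\<^sub>C X n"]) auto
  assume "y \<in> closure S"
  then obtain Y where Y: "\<And>n. Y n \<in> S" "Y \<longlonglongrightarrow> y" by (auto simp: closure_sequential)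
  show "x + y \<in> closure S"
    unfolding closure_sequential
    using tendsto_add[OF X(2) Y(2)] complex_vector.subspace_add[OF S X(1) Y(1)]
    by (intro exI[of _ "\<lambda>n. X n + Y n"]) auto
qed

text \<open>The eigenvector is the weak limit of the means of \<open>e\<^sup>-\<^sup>i\<^sup>r\<^sup>s u(s)\<close>.\<close>

lemma mean_eigenvector:
  fixes u :: "real \<Rightarrow> 'a::complex_banach"
  assumes G: "op_distribution0 G" and wsc: "weakly_sequentially_complete TYPE('a)"
    and u: "continuous_on {0..} u" "\<And>t. 0 \<le> t \<Longrightarrow> (integral {0..t} u, u t - x) \<in> generator G"
    and ap: "\<And>f. f \<in> cdual \<Longrightarrow> almost_periodic (\<lambda>t. f (u t))"
  obtains p where "(p, (\<i> * complex_of_real r) *\<^sub>C p) \<in> generator G"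
    "\<And>f. f \<in> cdual \<Longrightarrow> (\<lambda>n. integral {0..real n} (\<lambda>s. cis (- r * s) * f (u s)) / n) \<longlonglongrightarrow> f p"
proof -
  let ?Y = "\<lambda>n. integral {0..real n} (\<lambda>s. cis (- r * s) *\<^sub>C u s)"
  define X where "X n = complex_of_real (1 / real n) *\<^sub>C ?Y n" for n
  have int: "(\<lambda>s. cis (- r * s) *\<^sub>C u s) integrable_on {0..real n}" for n
    by (rule integrable_on_halfline) (auto intro!: continuous_intros u)
  have fX: "f (X n) = integral {0..real n} (\<lambda>s. cis (- r * s) * f (u s)) / n" if f: "f \<in> cdual" for f n
    using integral_linear[OF int cdual_bounded_linear[OF f], of n]
    by (simp add: X_def cdual_scaleC[OF f] o_def)
  have "Cauchy (\<lambda>n. f (X n))" if "f \<in> cdual" for f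
    using almost_periodic_means_Cauchy[OF ap[OF that], of "- r"] by (simp add: fX[OF that])
  then obtain p where p: "\<And>f. f \<in> cdual \<Longrightarrow> (\<lambda>n. f (X n)) \<longlonglongrightarrow> f p"
    using wsc unfolding weakly_sequentially_complete_def by blast
  have "(p, (\<i> * complex_of_real r) *\<^sub>C p) \<in> generator G"
    unfolding mem_generator_iff[OF G]
  proof
    fix \<phi> assume \<phi>: "\<phi> \<in> test_fun0"
    then have cl: "G \<phi> \<in> clinear_ops" "G (vderiv \<phi>) \<in> clinear_ops"
      using G by (auto simp: op_distribution0_def test_fun0_def test_fun_vderiv)
    have \<phi>t: "\<phi> \<in> test_fun" using \<phi> by (simp add: test_fun0_def)
    show "- G (vderiv \<phi>) p = G \<phi> ((\<i> * complex_of_real r) *\<^sub>C p)"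
    proof (rule cdual_separates)
      fix f :: "'a \<Rightarrow> complex" assume f: "f \<in> cdual"
      \<comment> \<open>Composition of \<open>f\<close> with the two operators gives functionals in
        \<open>cdual\<close> again, so the weak limit passes through \<open>G \<phi>\<close> and
        \<open>G (vderiv \<phi>)\<close>.\<close>
      define g where "g x = f (G \<phi> x)" for x
      define g' where "g' x = f (G (vderiv \<phi>) x)" for x
      have g: "g \<in> cdual" "g' \<in> cdual"
        using cdual_compose[OF f] cl by (auto simp: g_def[abs_def] g'_def[abs_def])
      have fneg: "f (- z) = - f z" for z using linear_neg[OF bounded_linear.linear[OF cdual_bounded_linear[OF f]]] .
      have gadd: "g (z + z') = g z + g z'" and gdiff: "g (z - z') = g z - g z'" for z z'
        using bounded_linear.linear[OF cdual_bounded_linear[OF g(1)]] by (simp_all add: linear_add linear_diff)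
      obtain B where B: "0 < B" "\<And>t. 0 \<le> t \<Longrightarrow> norm (g (u t)) \<le> B"
        using almost_periodic_bounded[OF ap[OF g(1)]] by blast
      \<comment> \<open>The boundary term of the mean; it tends to zero because
        \<open>g (u t)\<close>, being almost periodic, is bounded. At \<open>n = 0\<close> the
        convention \<open>1 / 0 = 0\<close> makes both sides of \<open>eq\<close> vanish.\<close>
      define z where "z n = complex_of_real (1 / real n) * (cis (- r * real n) * g (u (real n)) - g x)" for n
      have eq: "- g' (X n) = z n + (\<i> * complex_of_real r) * g (X n)" for n
      proof -
        have "- G (vderiv \<phi>) (?Y n) = G \<phi> (cis (- r * real n) *\<^sub>C u (real n) - x + (\<i> * complex_of_real r) *\<^sub>C ?Y n)"
          using modulated_integral_mem_generator[OF G u, of "real n" r] \<phi> unfolding mem_generator_iff[OF G] by auto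
        then have "f (- G (vderiv \<phi>) (?Y n)) = g (cis (- r * real n) *\<^sub>C u (real n) - x + (\<i> * complex_of_real r) *\<^sub>C ?Y n)"
          by (simp add: g_def)
        then have "- g' (?Y n) = cis (- r * real n) * g (u (real n)) - g x + (\<i> * complex_of_real r) * g (?Y n)"
          by (simp only: fneg gadd gdiff cdual_scaleC[OF g(1)] g'_def)
        then have "complex_of_real (1 / real n) * - g' (?Y n) =
            complex_of_real (1 / real n) * (cis (- r * real n) * g (u (real n)) - g x + (\<i> * complex_of_real r) * g (?Y n))"
          by simp
        then show ?thesis
          unfolding X_def z_def cdual_scaleC[OF g(1)] cdual_scaleC[OF g(2)] by (simp add: algebra_simps)
      qed
      have "z \<longlonglongrightarrow> 0"
      proof (rule Lim_null_comparison[where g = "\<lambda>n. (B + norm (g x)) * (1 / real n)"])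
        have "norm (z n) \<le> (B + norm (g x)) * (1 / real n)" for n
        proof -
          have "norm (cis (- r * real n) * g (u (real n)) - g x) \<le> B + norm (g x)"
            using norm_triangle_ineq4[of "cis (- r * real n) * g (u (real n))" "g x"] B(2)[of "real n"] by (simp add: norm_mult)
          then show ?thesis by (simp add: z_def norm_mult norm_divide divide_right_mono)
        qed
        then show "\<forall>\<^sub>F n in sequentially. norm (z n) \<le> (B + norm (g x)) * (1 / real n)" by simp
        show "(\<lambda>n. (B + norm (g x)) * (1 / real n)) \<longlonglongrightarrow> 0"
          by (intro tendsto_mult_right_zero lim_1_over_n)
      qed
      then have "(\<lambda>n. z n + (\<i> * complex_of_real r) * g (X n)) \<longlonglongrightarrow> 0 + (\<i> * complex_of_real r) * g p"
        by (intro tendsto_intros p g)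
      moreover have "(\<lambda>n. - g' (X n)) \<longlonglongrightarrow> - g' p" by (intro tendsto_intros p g)
      ultimately have "- g' p = (\<i> * complex_of_real r) * g p"
        unfolding eq by (simp add: LIMSEQ_unique)
      then show "f (- G (vderiv \<phi>) p) = f (G \<phi> ((\<i> * complex_of_real r) *\<^sub>C p))"
        by (simp add: fneg g'_def cdual_scaleC[OF g(1), unfolded g_def] g_def)
    qed
  qed
  moreover have "(\<lambda>n. integral {0..real n} (\<lambda>s. cis (- r * s) * f (u s)) / n) \<longlonglongrightarrow> f p" if "f \<in> cdual" for f
    using p[OF that] by (simp add: fX[OF that])
  ultimately show ?thesis using that by blast
qed

lemma imaginary_eigenvectors_total:
  fixes G :: "(real \<Rightarrow> complex) \<Rightarrow> ('a::complex_banach \<Rightarrow>\<^sub>L 'a)"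
  assumes G: "C_distribution_semigroup C G" and wsc: "weakly_sequentially_complete TYPE('a)"
    and E': "E' \<subseteq> solution_space (generator G)" "weakly_almost_periodic_on E' G" "closure E' = UNIV"
  shows "closure (cspan (imaginary_eigenvectors (generator G))) = UNIV" (is "closure (cspan ?D) = _")
proof (rule ccontr)
  note op = C_distribution_semigroup_op[OF G]
  assume "closure (cspan ?D) \<noteq> UNIV"
  then obtain z where z: "z \<notin> closure (cspan ?D)" by blast
  obtain f where f: "f \<in> cdual" "\<And>x. x \<in> closure (cspan ?D) \<Longrightarrow> f x = 0" "f z \<noteq> 0"
    using Hahn_Banach_separation[OF csubspace_closure[OF complex_vector.subspace_span] closed_closure z] by blast
  have "f x = 0" if x: "x \<in> E'" for x
  proof -
    have "x \<in> solution_space (generator G)" using E'(1) x by blast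
    then obtain u :: "real \<Rightarrow> 'a" where u: "continuous_on {0..} u" "\<And>t. 0 \<le> t \<Longrightarrow> (integral {0..t} u, u t - x) \<in> generator G"
      by (auto simp: solution_space_def)
    have eq: "op_app (dist_op G (delta t)) x = u t" if "0 \<le> t" for t
      by (rule op_app_delta[OF G u that])
    have ap: "almost_periodic (\<lambda>t. g (u t))" if "g \<in> cdual" for g
    proof -
      have "almost_periodic (\<lambda>t. g (op_app (dist_op G (delta t)) x))"
        using E'(2) x that by (auto simp: weakly_almost_periodic_on_def weakly_almost_periodic_def)
      then show ?thesis by (rule almost_periodic_transfer) (simp add: eq)
    qed
    have "(\<lambda>n. integral {0..real n} (\<lambda>s. cis (- r * s) * f (u s)) / n) \<longlonglongrightarrow> 0" for r
    proof -
      obtain p where p: "(p, (\<i> * complex_of_real r) *\<^sub>C p) \<in> generator G"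
        "(\<lambda>n. integral {0..real n} (\<lambda>s. cis (- r * s) * f (u s)) / n) \<longlonglongrightarrow> f p"
        using mean_eigenvector[OF op wsc u ap, of r] f(1) by blast
      have "f p = 0"
      proof (cases "p = 0")
        case True
        then show ?thesis using linear_0[OF bounded_linear.linear[OF cdual_bounded_linear[OF f(1)]]] by simp
      next
        case False
        then have "p \<in> ?D" using p(1) by (auto simp: imaginary_eigenvectors_def)
        then have "p \<in> closure (cspan ?D)" using closure_subset complex_vector.span_base by blast
        then show ?thesis by (rule f(2))
      qed
      then show ?thesis using p(2) by simp
    qed
    then have "f (u 0) = 0" using almost_periodic_eq_zero[OF ap[OF f(1)], of 0] by simp
    \<comment> \<open>At \<open>t = 0\<close> the solution property only places
      \<open>(0, u 0 - x)\<close> in the graph; the translation formula at \<open>0\<close> and the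
      separation of points by the operators \<open>G \<phi>\<close> give the initial value.\<close>
    moreover have "u 0 = x"
    proof (rule C_distribution_semigroup_eqI[OF G])
      fix \<phi> assume "\<phi> \<in> test_fun0"
      then show "G \<phi> (u 0) = G \<phi> x" using mild_solution_translate[OF op u, of \<phi> 0] by simp
    qed
    ultimately show ?thesis by simp
  qed
  moreover have "closed {x. f x = 0}"
    using bounded_linear.continuous_on[OF cdual_bounded_linear[OF f(1)] continuous_on_id]
    by (intro closed_Collect_eq continuous_intros) auto
  ultimately have "closure E' \<subseteq> {x. f x = 0}" by (intro closure_minimal) auto
  then show False using E'(3) f(3) by auto
qed

theorem proposition2p8:
  fixes C :: "'a::complex_banach \<Rightarrow>\<^sub>L 'a"
    and G :: "(real \<Rightarrow> complex) \<Rightarrow> ('a \<Rightarrow>\<^sub>L 'a)"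
    and A :: "('a \<times> 'a) set"
    and E' :: "'a set"
    and D :: "'a set"
  assumes "C \<in> clinear_ops" and "inj (blinfun_apply C)"
    and "C_distribution_semigroup C G"
    and "A = generator G"
    and "csubspace E'" and "E' \<subseteq> solution_space A"
    and "weakly_almost_periodic_on E' G"
    and "closure E' = UNIV"
    and "weakly_sequentially_complete TYPE('a)"
    and "D = imaginary_eigenvectors A"
  shows "closure (cspan D) = UNIV \<and>
    cspan D \<subseteq> solution_space A \<and> almost_periodic_on (cspan D) G"
  using imaginary_eigenvectors_total[of C G E'] span_imaginary_eigenvectors[of C G] assms
  by (auto simp: almost_periodic_on_def)

end
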